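(* Let $\mathcal{B}_{K,N}$ be the image of the Hitchin map $\pi([(\mathcal{E},\varphi)])=\operatorname{char}\varphi=\det(\lambda-\varphi(z))$ on $\mathcal{M}_{K,N}$. Then $\mathcal{B}_{K,N}$ is exactly the space of polynomials of the form $$(\lambda^K-z^N\,dz^K)+\bigl(P_2(z)\,dz^2\,\lambda^{K-2}+\cdots+P_i(z)\,dz^i\,\lambda^{K-i}+\cdots+P_K(z)\,dz^K\bigr),$$ where each $P_i(z)$ ($2\le i\le K$) is a polynomial in $z$ with $$\deg P_i\le\frac{N(i-1)}{K}-1$$ (with the convention $\deg 0=-\infty$).
   Context: $K\ge 2$ and $N\ge 1$ are coprime integers; $z$ is the standard coordinate on $\mathbb{C}\subset\mathbb{CP}^1$. Filtered bundles. A filtered rank $K$ bundle on $(\mathbb{CP}^1,\{\infty\})$ is a locally free $\mathcal{O}_{\mathbb{CP}^1}( *\{\infty\})$-module $\mathcal{E}$ of rank $K$ (where $\mathcal{O}_{\mathbb{CP}^1}( *\{\infty\})$ is the sheaf of meromorphic functions with poles only at $\infty$) with an increasing filtration by locally free $\mathcal{O}_{\mathbb{CP}^1}$-submodules $\mathcal{P}_\alpha\mathcal{E}$, $\alpha\in\mathbb{R}$, such that $\mathcal{P}_\alpha\mathcal{E}|_{\mathbb{C}}=\mathcal{E}|_{\mathbb{C}}$, $\mathcal{P}_\alpha\mathcal{E}=\bigcap_{\beta>\alpha}\mathcal{P}_\beta\mathcal{E}$, and near $\infty$, with $x=1/z$, $\mathcal{P}_{\alpha-1}\mathcal{E}=x\,\mathcal{P}_\alpha\mathcal{E}$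 (similarly over a disc with a marked point). For a section $s$ near $\infty$, its order is $\nu_\infty(s)=\inf\{\alpha: s\in\mathcal{P}_\alpha\mathcal{E}\}$. Direct sums and tensor products are filtered by $\mathcal{P}_\alpha(\mathcal{E}\oplus\mathcal{E}')=\mathcal{P}_\alpha\mathcal{E}\oplus\mathcal{P}_\alpha\mathcal{E}'$, $\mathcal{P}_\alpha(\mathcal{E}\otimes\mathcal{E}')=\sum_{\beta+\gamma=\alpha}\mathcal{P}_\beta\mathcal{E}\otimes\mathcal{P}_\gamma\mathcal{E}'$, and exterior powers as subbundles of tensor powers. A filtered $SL(K)$-bundle is a filtered rank $K$ bundle with a global section $\omega$ of $\wedge^K\mathcal{E}$ trivializing it on $\mathbb{C}$, with $\nu_\infty(\omega)=0$. A filtered $SL(K)$-Higgs bundle is a pair $(\mathcal{E},\varphi)$ with $\mathcal{E}$ a filtered $SL(K)$-bundle and $\varphi$ a traceless meromorphic section of $\operatorname{End}\mathcal{E}\otimes K_{\mathbb{CP}^1}$, holomorphic on $\mathbb{C}$. The category $\mathcal{C}_{K,N}$. Objects are filtered $SL(K)$-Higgs bundles $(\mathcal{E},\varphi)$ such that, for a disc $U$ around $\infty$ with coordinate $x=1/z$ and the ramified covering $\psi:\widetilde U\to U$, $x=u^{2K}$, with $\psi^*\mathcal{E}$ given its natural filtration (for which $\nu_{u=0}(\psi^*s)=2K\,\nu_\infty(s)$), there is a decomposition of filtered bundles $\psi^*\mathcal{E}=\bigoplus_{r=1}^K\mathcal{L}_r$ into filtered line bundles preserved by $\psi^*\varphi$,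 each $\mathcal{L}_r$ being equivalent to an ordinary line bundle with the standard filtration by pole order at $u=0$, and such that the restriction $\varphi_r$ of $\psi^*\varphi$ to $\mathcal{L}_r$ satisfies $(\varphi_r-d\mathfrak{a}_r)(\mathcal{P}_\alpha\mathcal{L}_r)\subset\mathcal{P}_{\alpha+1}\mathcal{L}_r\otimes K_{\widetilde U}$ for all $\alpha$, with $\mathfrak{a}_r=\frac{K}{K+N}e^{2\pi\mathrm{i}r/K}u^{-2(N+K)}$. Equivalently: there is a trivialization $g:\psi^*\mathcal{E}\to\mathcal{O}_{\widetilde U}^{\oplus K}$, inducing the filtration from the standard pole-order filtration, with $g(\psi^*\varphi)g^{-1}=-2K\operatorname{diag}(e^{2\pi\mathrm{i}/K},e^{4\pi\mathrm{i}/K},\dots,1)\frac{du}{u^{2K+2N+1}}+(\text{holomorphic in }u)$. Morphisms are isomorphisms of filtered bundles preserving the Higgs fields. $\mathcal{M}_{K,N}$ is the set of isomorphism classes of objects of $\mathcal{C}_{K,N}$. *)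

theory Defs
  imports
    "HOL-Complex_Analysis.Complex_Analysis"
    "HOL-Combinatorics.Permutations"
    "Jordan_Normal_Form.Char_Poly"
begin

unbundle no vec_syntax

section \<open>Curves with a marked point\<close>

text \<open>
  A curve is given by its topology, a marked point, the sheaf of holomorphic functions and
  a coordinate at the marked point that vanishes there. Only two instances are used: the
  Riemann sphere marked at infinity and a disc marked at its centre.
\<close>

record 'p marked_curve =
  top_of :: "'p topology"
  pt :: 'p
  hol :: "'p set \<Rightarrow> ('p \<Rightarrow> complex) set"
  coord :: "'p \<Rightarrow> complex"

text \<open>The point at infinity is \<^term>\<open>None\<close>. The coordinate \<open>1/z\<close> is only meaningful
  away from \<open>z = 0\<close>; it is only used on sufficiently small neighbourhoods of infinity.\<close>

definition CP1 :: "complex option marked_curve" where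
  "CP1 = \<lparr>
     top_of = Alexandroff_compactification euclidean,
     pt = None,
     hol = (\<lambda>U. {f. (\<lambda>z. f (Some z)) holomorphic_on {z. Some z \<in> U} \<and>
                 (None \<in> U \<longrightarrow>
                   (\<lambda>x. f (if x = 0 then None else Some (1 / x))) analytic_on {0})}),
     coord = (\<lambda>p. case p of None \<Rightarrow> 0 | Some z \<Rightarrow> 1 / z)\<rparr>"

definition disc :: "real \<Rightarrow> complex marked_curve" where
  "disc \<rho> = \<lparr>
     top_of = top_of_set (ball 0 \<rho>),
     pt = 0,
     hol = (\<lambda>U. {f. f holomorphic_on U}),
     coord = (\<lambda>u. u)\<rparr>"

text \<open>Meromorphic functions whose only pole is at the marked point. They are regarded as
  functions away from the marked point; the value there is irrelevant.\<close>

definition mero :: "'p marked_curve \<Rightarrow> 'p set \<Rightarrow> ('p \<Rightarrow> complex) set" where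
  "mero X U = {f. f \<in> hol X (U - {pt X}) \<and>
     (pt X \<in> U \<longrightarrow> (\<exists>V n. \<exists>g\<in>hol X V. openin (top_of X) V \<and> pt X \<in> V \<and> V \<subseteq> U \<and>
        (\<forall>q\<in>V - {pt X}. g q = coord X q ^ n * f q)))}"


section \<open>Locally free sheaves and filtered bundles\<close>

text \<open>
  A section of a locally free module over the sheaf of meromorphic functions with poles at
  the marked point is determined by its values in the fibres over the other points. After
  choosing a (not necessarily continuous) linear isomorphism of each of these fibres
  with \<open>\<complex>\<^sup>d\<close>, sections become vector-valued functions away from the marked point.
  Every locally free sheaf is thus, up to isomorphism, a sheaf of such functions; its
  holomorphic structure is carried by its local frames. The values of
  a section at the marked point and outside its domain are irrelevant.

  Taking the rank \<open>m\<close> smaller than \<open>d\<close> gives subbundles of a bundle of rank \<open>d\<close>.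
  The parameter \<open>R\<close> is the sheaf of rings.
\<close>

definition locally_free ::
  "'p marked_curve \<Rightarrow> ('p set \<Rightarrow> ('p \<Rightarrow> complex) set) \<Rightarrow> nat \<Rightarrow> nat \<Rightarrow>
   ('p set \<Rightarrow> ('p \<Rightarrow> complex vec) set) \<Rightarrow> bool" where
  "locally_free X R d m S \<longleftrightarrow>
     (\<forall>U s. openin (top_of X) U \<longrightarrow> s \<in> S U \<longrightarrow> (\<forall>q\<in>U - {pt X}. s q \<in> carrier_vec d)) \<and>
     (\<forall>U s t. openin (top_of X) U \<longrightarrow> s \<in> S U \<longrightarrow> (\<forall>q\<in>U - {pt X}. t q = s q) \<longrightarrow> t \<in> S U) \<and>
     (\<forall>U V s. openin (top_of X) U \<longrightarrow> openin (top_of X) V \<longrightarrow> V \<subseteq> U \<longrightarrow> s \<in> S U \<longrightarrow> s \<in> S V) \<and>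
     (\<forall>\<U> s. (\<forall>U\<in>\<U>. openin (top_of X) U \<and> s \<in> S U) \<longrightarrow> s \<in> S (\<Union>\<U>)) \<and>
     (\<forall>p\<in>topspace (top_of X). \<exists>U e. openin (top_of X) U \<and> p \<in> U \<and>
        (\<forall>q\<in>U - {pt X}. e q \<in> carrier_mat d m \<and>
           (\<forall>c\<in>carrier_vec m. e q *\<^sub>v c = 0\<^sub>v d \<longrightarrow> c = 0\<^sub>v m)) \<and>
        (\<forall>V. openin (top_of X) V \<longrightarrow> V \<subseteq> U \<longrightarrow>
           S V = {s. \<exists>f. (\<forall>j<m. f j \<in> R V) \<and>
                     (\<forall>q\<in>V - {pt X}. s q = e q *\<^sub>v Matrix.vec m (\<lambda>j. f j q))}))"

record 'p filtered_sheaf =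
  sec :: "'p set \<Rightarrow> ('p \<Rightarrow> complex vec) set"
  fil :: "real \<Rightarrow> 'p set \<Rightarrow> ('p \<Rightarrow> complex vec) set"

definition filtered_bundle ::
  "'p marked_curve \<Rightarrow> nat \<Rightarrow> nat \<Rightarrow> 'p filtered_sheaf \<Rightarrow> bool" where
  "filtered_bundle X d m E \<longleftrightarrow>
     locally_free X (mero X) d m (sec E) \<and>
     (\<forall>\<alpha>. locally_free X (hol X) d m (fil E \<alpha>)) \<and>
     (\<forall>\<alpha> U. openin (top_of X) U \<longrightarrow> fil E \<alpha> U \<subseteq> sec E U) \<and>
     (\<forall>\<alpha> \<beta> U. \<alpha> \<le> \<beta> \<longrightarrow> openin (top_of X) U \<longrightarrow> fil E \<alpha> U \<subseteq> fil E \<beta> U) \<and>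
     (\<forall>\<alpha> U. openin (top_of X) U \<longrightarrow> pt X \<notin> U \<longrightarrow> fil E \<alpha> U = sec E U) \<and>
     (\<forall>\<alpha> U. openin (top_of X) U \<longrightarrow> fil E \<alpha> U = (\<Inter>\<beta>\<in>{\<alpha><..}. fil E \<beta> U)) \<and>
     (\<exists>U. openin (top_of X) U \<and> pt X \<in> U \<and>
        (\<forall>\<alpha> V. openin (top_of X) V \<longrightarrow> V \<subseteq> U \<longrightarrow>
           fil E (\<alpha> - 1) V =
             {s. \<exists>t\<in>fil E \<alpha> V. \<forall>q\<in>V - {pt X}. s q = coord X q \<cdot>\<^sub>v t q}))"

definition filtered_direct_sum ::
  "'p marked_curve \<Rightarrow> nat \<Rightarrow> 'i set \<Rightarrow> ('i \<Rightarrow> 'p filtered_sheaf) \<Rightarrow> 'p filtered_sheaf \<Rightarrow> bool"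
where
  "filtered_direct_sum X d I L E \<longleftrightarrow>
     (\<forall>U. openin (top_of X) U \<longrightarrow>
        sec E U = {s. \<exists>t. (\<forall>r\<in>I. t r \<in> sec (L r) U) \<and>
                     (\<forall>q\<in>U - {pt X}. s q = Matrix.vec d (\<lambda>j. \<Sum>r\<in>I. t r q $ j))} \<and>
        (\<forall>t. (\<forall>r\<in>I. t r \<in> sec (L r) U) \<longrightarrow>
             (\<forall>q\<in>U - {pt X}. Matrix.vec d (\<lambda>j. \<Sum>r\<in>I. t r q $ j) = 0\<^sub>v d) \<longrightarrow>
             (\<forall>r\<in>I. \<forall>q\<in>U - {pt X}. t r q = 0\<^sub>v d)) \<and>
        (\<forall>\<alpha>. fil E \<alpha> U = {s. \<exists>t. (\<forall>r\<in>I. t r \<in> fil (L r) \<alpha> U) \<and>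
                     (\<forall>q\<in>U - {pt X}. s q = Matrix.vec d (\<lambda>j. \<Sum>r\<in>I. t r q $ j))}))"

text \<open>An ordinary holomorphic bundle \<open>M\<close> on a disc with centre \<open>0\<close> becomes a filtered bundle by
  allowing poles at \<open>0\<close> and filtering by pole order.\<close>

definition pole_order_filtration ::
  "(complex set \<Rightarrow> (complex \<Rightarrow> complex vec) set) \<Rightarrow> complex filtered_sheaf" where
  "pole_order_filtration M = \<lparr>
     sec = (\<lambda>U. {s. \<exists>n::nat. (\<lambda>u. u ^ n \<cdot>\<^sub>v s u) \<in> M U}),
     fil = (\<lambda>\<alpha> U. {s. (\<lambda>u. u powi \<lfloor>\<alpha>\<rfloor> \<cdot>\<^sub>v s u) \<in> M U})\<rparr>"

text \<open>Pullback along a map \<open>\<psi>\<close> ramified to order \<open>m\<close> at the marked point of \<open>Y\<close>. Step \<open>\<alpha>\<close>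
  of the filtration is generated by the products \<open>u\<^sup>-\<^sup>k \<psi>\<^sup>*t\<close> with \<open>t\<close> in step \<open>\<beta>\<close>
  and \<open>k + m \<beta> \<le> \<alpha>\<close>, where \<open>u\<close> is the coordinate of \<open>Y\<close>, assumed to be globally defined
  and nonzero away from the marked point.\<close>

definition pullback ::
  "'q marked_curve \<Rightarrow> 'p marked_curve \<Rightarrow> ('q \<Rightarrow> 'p) \<Rightarrow> nat \<Rightarrow> nat \<Rightarrow>
   'p filtered_sheaf \<Rightarrow> 'q filtered_sheaf" where
  "pullback Y X \<psi> m d E = \<lparr>
     sec = (\<lambda>W. {s. \<forall>p\<in>W. \<exists>W' V. openin (top_of Y) W' \<and> p \<in> W' \<and> W' \<subseteq> W \<and>
              openin (top_of X) V \<and> \<psi> ` W' \<subseteq> V \<and>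
              (\<exists>(n::nat) f t. (\<forall>i<n. f i \<in> mero Y W' \<and> t i \<in> sec E V) \<and>
                 (\<forall>q\<in>W' - {pt Y}. s q =
                    Matrix.vec d (\<lambda>j. \<Sum>i<n. f i q * (t i (\<psi> q) $ j))))}),
     fil = (\<lambda>\<alpha> W. {s. \<forall>p\<in>W. \<exists>W' V. openin (top_of Y) W' \<and> p \<in> W' \<and> W' \<subseteq> W \<and>
              openin (top_of X) V \<and> \<psi> ` W' \<subseteq> V \<and>
              (\<exists>(n::nat) f t (k :: nat \<Rightarrow> int) \<beta>.
                 (\<forall>i<n. f i \<in> hol Y W' \<and> t i \<in> fil E (\<beta> i) V \<and>
                        of_int (k i) + real m * \<beta> i \<le> \<alpha>) \<and>
                 (\<forall>q\<in>W' - {pt Y}. s q = Matrix.vec d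
                    (\<lambda>j. \<Sum>i<n. f i q * coord Y q powi (- k i) * (t i (\<psi> q) $ j))))})\<rparr>"


section \<open>Top exterior power\<close>

text \<open>Tensors in the \<open>K\<close>-th tensor power of \<open>\<complex>\<^sup>K\<close> are given by their components, and the
  exterior power is the space of antisymmetric tensors.\<close>

definition indices :: "nat \<Rightarrow> nat list set" where
  "indices K = {js. length js = K \<and> set js \<subseteq> {..<K}}"

definition tensor_fil ::
  "'p marked_curve \<Rightarrow> nat \<Rightarrow> 'p filtered_sheaf \<Rightarrow> real \<Rightarrow> 'p set \<Rightarrow>
   ('p \<Rightarrow> nat list \<Rightarrow> complex) set" where
  "tensor_fil X K E \<alpha> U = {\<tau>. \<forall>p\<in>U. \<exists>V. openin (top_of X) V \<and> p \<in> V \<and> V \<subseteq> U \<and>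
     (\<exists>(n::nat) s \<beta>. (\<forall>k<n. (\<Sum>j<K. \<beta> k j) = \<alpha> \<and> (\<forall>j<K. s k j \<in> fil E (\<beta> k j) V)) \<and>
        (\<forall>q\<in>V - {pt X}. \<forall>js\<in>indices K. \<tau> q js = (\<Sum>k<n. \<Prod>j<K. s k j q $ (js ! j))))}"

definition tensor_sec ::
  "'p marked_curve \<Rightarrow> nat \<Rightarrow> 'p filtered_sheaf \<Rightarrow> 'p set \<Rightarrow>
   ('p \<Rightarrow> nat list \<Rightarrow> complex) set" where
  "tensor_sec X K E U = {\<tau>. \<forall>p\<in>U. \<exists>V. openin (top_of X) V \<and> p \<in> V \<and> V \<subseteq> U \<and>
     (\<exists>(n::nat) s. (\<forall>k<n. \<forall>j<K. s k j \<in> sec E V) \<and>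
        (\<forall>q\<in>V - {pt X}. \<forall>js\<in>indices K. \<tau> q js = (\<Sum>k<n. \<Prod>j<K. s k j q $ (js ! j))))}"

definition antisymmetric :: "nat \<Rightarrow> (nat list \<Rightarrow> complex) \<Rightarrow> bool" where
  "antisymmetric K \<tau> \<longleftrightarrow>
     (\<forall>\<pi> js. \<pi> permutes {..<K} \<longrightarrow> js \<in> indices K \<longrightarrow>
        \<tau> (permute_list \<pi> js) = of_int (sign \<pi>) * \<tau> js)"

definition ext_fil ::
  "'p marked_curve \<Rightarrow> nat \<Rightarrow> 'p filtered_sheaf \<Rightarrow> real \<Rightarrow> 'p set \<Rightarrow>
   ('p \<Rightarrow> nat list \<Rightarrow> complex) set" where
  "ext_fil X K E \<alpha> U = {\<tau> \<in> tensor_fil X K E \<alpha> U. \<forall>q\<in>U - {pt X}. antisymmetric K (\<tau> q)}"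

definition ext_sec ::
  "'p marked_curve \<Rightarrow> nat \<Rightarrow> 'p filtered_sheaf \<Rightarrow> 'p set \<Rightarrow>
   ('p \<Rightarrow> nat list \<Rightarrow> complex) set" where
  "ext_sec X K E U = {\<tau> \<in> tensor_sec X K E U. \<forall>q\<in>U - {pt X}. antisymmetric K (\<tau> q)}"

definition ext_order ::
  "'p marked_curve \<Rightarrow> nat \<Rightarrow> 'p filtered_sheaf \<Rightarrow> ('p \<Rightarrow> nat list \<Rightarrow> complex) \<Rightarrow> ereal" where
  "ext_order X K E \<omega> =
     Inf {ereal \<alpha> |\<alpha>. \<exists>U. openin (top_of X) U \<and> pt X \<in> U \<and> \<omega> \<in> ext_fil X K E \<alpha> U}"

definition SL_structure ::
  "'p marked_curve \<Rightarrow> nat \<Rightarrow> 'p filtered_sheaf \<Rightarrow> ('p \<Rightarrow> nat list \<Rightarrow> complex) \<Rightarrow> bool" where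
  "SL_structure X K E \<omega> \<longleftrightarrow>
     \<omega> \<in> ext_sec X K E (topspace (top_of X)) \<and>
     (\<forall>q\<in>topspace (top_of X) - {pt X}. \<exists>js\<in>indices K. \<omega> q js \<noteq> 0) \<and>
     ext_order X K E \<omega> = 0"


section \<open>Filtered Higgs bundles on the sphere\<close>

text \<open>The Higgs field is \<open>A dz\<close>, where \<open>A\<close> is the matrix-valued function \<open>higgs\<close>. Since \<open>dz\<close>
  has neither zeros nor poles on the affine line, \<open>A dz\<close> is meromorphic on the sphere and
  holomorphic on the affine line iff \<open>A\<close> preserves the sections of the underlying module.\<close>

record higgs_bundle =
  underlying :: "complex option filtered_sheaf"
  vol :: "complex option \<Rightarrow> nat list \<Rightarrow> complex"
  higgs :: "complex option \<Rightarrow> complex mat"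

definition filtered_SL_Higgs_bundle :: "nat \<Rightarrow> higgs_bundle \<Rightarrow> bool" where
  "filtered_SL_Higgs_bundle K H \<longleftrightarrow>
     filtered_bundle CP1 K K (underlying H) \<and>
     SL_structure CP1 K (underlying H) (vol H) \<and>
     (\<forall>z. higgs H (Some z) \<in> carrier_mat K K \<and> (\<Sum>i<K. higgs H (Some z) $$ (i, i)) = 0) \<and>
     (\<forall>U. openin (top_of CP1) U \<longrightarrow> (\<forall>s\<in>sec (underlying H) U.
        (\<lambda>q. higgs H q *\<^sub>v s q) \<in> sec (underlying H) U))"

text \<open>The covering \<open>x = u\<^sup>2\<^sup>K\<close>, where \<open>x = 1/z\<close>.\<close>

definition cover_map :: "nat \<Rightarrow> complex \<Rightarrow> complex option" where
  "cover_map K u = (if u = 0 then None else Some (1 / u ^ (2 * K)))"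

definition pulled_back_higgs :: "nat \<Rightarrow> higgs_bundle \<Rightarrow> complex \<Rightarrow> complex mat" where
  \<comment> \<open>the coefficient of \<open>du\<close>\<close>
  "pulled_back_higgs K H u = deriv (\<lambda>w. 1 / w ^ (2 * K)) u \<cdot>\<^sub>m higgs H (cover_map K u)"

definition irregular_part :: "nat \<Rightarrow> nat \<Rightarrow> nat \<Rightarrow> complex \<Rightarrow> complex" where
  "irregular_part K N r u =
     of_nat K / of_nat (K + N) * exp (2 * of_real pi * \<i> * of_nat r / of_nat K)
       / u ^ (2 * (N + K))"

text \<open>The condition at infinity. The form \<open>du\<close> trivializes the canonical bundle of the disc,
  so one-forms are again represented by their coefficients.\<close>

definition good_at_infinity :: "nat \<Rightarrow> nat \<Rightarrow> higgs_bundle \<Rightarrow> bool" where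
  "good_at_infinity K N H \<longleftrightarrow> (\<exists>\<rho>>0. \<exists>L :: nat \<Rightarrow> complex filtered_sheaf.
     filtered_direct_sum (disc \<rho>) K {1..K} L
       (pullback (disc \<rho>) CP1 (cover_map K) (2 * K) K (underlying H)) \<and>
     (\<forall>r\<in>{1..K}.
        filtered_bundle (disc \<rho>) K 1 (L r) \<and>
        (\<exists>M. locally_free (disc \<rho>) (hol (disc \<rho>)) K 1 M \<and>
           (\<forall>U. openin (top_of (disc \<rho>)) U \<longrightarrow>
              sec (L r) U = sec (pole_order_filtration M) U \<and>
              (\<forall>\<alpha>. fil (L r) \<alpha> U = fil (pole_order_filtration M) \<alpha> U))) \<and>
        (\<forall>U. openin (top_of (disc \<rho>)) U \<longrightarrow>
           (\<forall>s\<in>sec (L r) U. (\<lambda>u. pulled_back_higgs K H u *\<^sub>v s u) \<in> sec (L r) U) \<and>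
           (\<forall>\<alpha>. \<forall>s\<in>fil (L r) \<alpha> U.
              (\<lambda>u. pulled_back_higgs K H u *\<^sub>v s u - deriv (irregular_part K N r) u \<cdot>\<^sub>v s u)
                \<in> fil (L r) (\<alpha> + 1) U))))"

definition C_objects :: "nat \<Rightarrow> nat \<Rightarrow> higgs_bundle set" where
  "C_objects K N = {H. filtered_SL_Higgs_bundle K H \<and> good_at_infinity K N H}"

text \<open>An isomorphism of sheaves is given by the linear isomorphisms it induces on fibres.\<close>

definition C_isomorphism ::
  "nat \<Rightarrow> (complex option \<Rightarrow> complex mat) \<Rightarrow> higgs_bundle \<Rightarrow> higgs_bundle \<Rightarrow> bool" where
  "C_isomorphism K g H H' \<longleftrightarrow>
     (\<forall>z. g (Some z) \<in> carrier_mat K K \<and> invertible_mat (g (Some z)) \<and>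
          g (Some z) * higgs H (Some z) = higgs H' (Some z) * g (Some z)) \<and>
     (\<forall>U. openin (top_of CP1) U \<longrightarrow>
        sec (underlying H') U =
          {t. \<exists>s\<in>sec (underlying H) U. \<forall>q\<in>U - {pt CP1}. t q = g q *\<^sub>v s q} \<and>
        (\<forall>\<alpha>. fil (underlying H') \<alpha> U =
          {t. \<exists>s\<in>fil (underlying H) \<alpha> U. \<forall>q\<in>U - {pt CP1}. t q = g q *\<^sub>v s q}))"

definition moduli :: "nat \<Rightarrow> nat \<Rightarrow> higgs_bundle set set" where
  "moduli K N = C_objects K N //
     {(H, H'). H \<in> C_objects K N \<and> H' \<in> C_objects K N \<and> (\<exists>g. C_isomorphism K g H H')}"

text \<open>The polynomial \<open>det (\<lambda> - A(z) dz)\<close> in \<open>\<lambda>\<close>, whose coefficient at \<open>\<lambda>\<^sup>K\<^sup>-\<^sup>i\<close> is a multiple of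
  \<open>dz\<^sup>i\<close>, is represented by \<open>det (y - A(z))\<close>, where \<open>\<lambda> = y dz\<close>.\<close>

definition char_higgs :: "higgs_bundle \<Rightarrow> complex \<Rightarrow> complex poly" where
  "char_higgs H z = char_poly (higgs H (Some z))"

text \<open>Isomorphic objects have the same characteristic polynomial, so the image of an
  isomorphism class is a singleton.\<close>

definition hitchin_map :: "higgs_bundle set \<Rightarrow> complex \<Rightarrow> complex poly" where
  "hitchin_map c = the_elem (char_higgs ` c)"

definition hitchin_base :: "nat \<Rightarrow> nat \<Rightarrow> (complex \<Rightarrow> complex poly) set" where
  "hitchin_base K N = hitchin_map ` moduli K N"

end

theory Submission
  imports Defs
begin

text \<open>
  The inclusion of the image in the space of polynomials is a growth estimate. The coefficients of the
  characteristic polynomial are entire functions of \<open>z\<close> (lemma \<open>char_higgs_entire\<close>). On the covering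
  \<open>z = 1 / u ^ (2 * K)\<close> of a neighbourhood of infinity, the decomposition into lines diagonalizes the Higgs field, and
  the condition on the irregular parts determines its eigenvalues up to a relative error of order
  \<open>u ^ (2 * N + 2 * K)\<close>: they are \<open>unity_root K r / u ^ (2 * N)\<close> to leading order (lemma
  \<open>eigenvalues_at_infinity\<close>). The leading parts produce \<open>\<lambda> ^ K - z ^ N\<close>, and the error bounds the growth of the
  coefficient of \<open>\<lambda> ^ (K - i)\<close> by \<open>\<bar>z\<bar>\<close> to the power \<open>N * (i - 1) / K - 1\<close>. An entire function of such growth
  is a polynomial of at most that degree (lemmas \<open>entire_of_polynomial_growth\<close> and \<open>char_higgs_in_base\<close>).

  Conversely, a polynomial of the given form is the characteristic polynomial of a companion matrix, acting on
  the trivial bundle of rank \<open>K\<close>, and only the filtration at infinity has to be chosen. With \<open>y = w / u ^ (2 * N)\<close>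
  the characteristic equation becomes a perturbation of \<open>w ^ K = 1\<close> that is divisible by \<open>u ^ (2 * N + 2 * K)\<close>
  precisely because of the degree bounds, so its roots continue holomorphically to \<open>u = 0\<close> (lemma
  \<open>base_poly_roots_at_infinity\<close>). The eigenvectors \<open>(1, y, ..., y ^ (K - 1))\<close> then span a lattice that is diagonal in the
  standard basis: they differ from it by a diagonal matrix of powers of \<open>u\<close> and an invertible holomorphic Vandermonde
  matrix. Declaring this lattice, normalized to have determinant of order zero, to be the step of order zero
  defines a filtration that is visibly given by weights of the standard basis vectors, and for which the required
  decomposition holds by construction (lemmas \<open>filtered_SL_Higgs_bundle_model\<close> and \<open>good_at_infinity_model\<close>).

  All sheaves that occur are given by an injective frame together with a weight for each of its columns. That such
  data define filtered bundles is shown once, for curves with a coordinate at the marked point (lemma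
  \<open>framed_sheaf_filtered_bundle\<close>), and applied to the sphere and to the disc.
\<close>

section \<open>Functions of bounded pole order\<close>

text \<open>
  The bound refers to the pole at the marked point, so a negative \<open>k\<close> prescribes a zero. Every sheaf below is
  described through these functions: they refine \<^const>\<open>mero\<close> by the order of the pole and multiply additively in \<open>k\<close>.
\<close>

definition pole_le :: "'p marked_curve \<Rightarrow> int \<Rightarrow> 'p set \<Rightarrow> ('p \<Rightarrow> complex) set" where
  "pole_le X k U = {f. f \<in> hol X (U - {pt X}) \<and>
     (pt X \<in> U \<longrightarrow> (\<exists>V. \<exists>g\<in>hol X V. openin (top_of X) V \<and> pt X \<in> V \<and> V \<subseteq> U \<and>
        (\<forall>q\<in>V - {pt X}. g q = coord X q powi k * f q)))}"

text \<open>
  The properties of the sphere and of the disc that the theory of filtered bundles uses: holomorphic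
  functions form a sheaf of rings, and the coordinate is invertible on a punctured neighbourhood \<open>U0\<close> of
  the marked point.
\<close>

locale coordinate_curve =
  fixes X :: "'p marked_curve" and U0 :: "'p set"
  assumes open_del: "openin (top_of X) U \<Longrightarrow> openin (top_of X) (U - {pt X})"
    and hol_cong: "openin (top_of X) U \<Longrightarrow> f \<in> hol X U \<Longrightarrow> (\<And>q. q \<in> U \<Longrightarrow> g q = f q) \<Longrightarrow> g \<in> hol X U"
    and hol_mono: "f \<in> hol X U \<Longrightarrow> openin (top_of X) U \<Longrightarrow> openin (top_of X) V \<Longrightarrow> V \<subseteq> U \<Longrightarrow> f \<in> hol X V"
    and hol_Union: "(\<And>U. U \<in> \<U> \<Longrightarrow> openin (top_of X) U \<and> f \<in> hol X U) \<Longrightarrow> f \<in> hol X (\<Union>\<U>)"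
    and hol_const: "(\<lambda>_. c) \<in> hol X U"
    and hol_add: "openin (top_of X) U \<Longrightarrow> f \<in> hol X U \<Longrightarrow> g \<in> hol X U \<Longrightarrow> (\<lambda>q. f q + g q) \<in> hol X U"
    and hol_mult: "openin (top_of X) U \<Longrightarrow> f \<in> hol X U \<Longrightarrow> g \<in> hol X U \<Longrightarrow> (\<lambda>q. f q * g q) \<in> hol X U"
    and open_U0: "openin (top_of X) U0"
    and pt_U0: "pt X \<in> U0"
    and coord_hol: "coord X \<in> hol X U0"
    and coord_nz: "q \<in> U0 - {pt X} \<Longrightarrow> coord X q \<noteq> 0"
    and inv_coord_hol: "(\<lambda>q. inverse (coord X q)) \<in> hol X (U0 - {pt X})"
begin

abbreviation "opn \<equiv> openin (top_of X)"

lemma hol_glue_pt: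
  assumes "opn U" "f \<in> hol X (U - {pt X})" "opn V" "pt X \<in> V" "V \<subseteq> U" "f \<in> hol X V"
  shows "f \<in> hol X U"
proof -
  have "f \<in> hol X (\<Union>{U - {pt X}, V})" by (rule hol_Union) (use assms open_del in auto)
  moreover have "\<Union>{U - {pt X}, V} = U" using assms by auto
  ultimately show ?thesis by simp
qed

lemma hol_power: "opn U \<Longrightarrow> f \<in> hol X U \<Longrightarrow> (\<lambda>q. f q ^ n) \<in> hol X U"
  by (induction n) (simp_all add: hol_const hol_mult)

lemma hol_coord_powi:
  assumes "opn V" "V \<subseteq> U0 - {pt X}"
  shows "(\<lambda>q. coord X q powi k) \<in> hol X V"
proof -
  have 1: "coord X \<in> hol X V" by (rule hol_mono[OF coord_hol open_U0]) (use assms in auto)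
  have 2: "(\<lambda>q. inverse (coord X q)) \<in> hol X V"
    by (rule hol_mono[OF inv_coord_hol open_del[OF open_U0]]) (use assms in auto)
  show ?thesis
  proof (cases "k \<ge> 0")
    case True
    then show ?thesis using hol_power[OF assms(1) 1, of "nat k"] by (simp add: power_int_def)
  next
    case False
    then show ?thesis using hol_power[OF assms(1) 2, of "nat (- k)"]
      by (simp add: power_int_def power_inverse)
  qed
qed

lemma hol_coord_power: "opn V \<Longrightarrow> V \<subseteq> U0 \<Longrightarrow> (\<lambda>q. coord X q ^ n) \<in> hol X V"
  by (rule hol_power) (auto intro: hol_mono[OF coord_hol open_U0])

lemma pole_le_off: "pt X \<notin> U \<Longrightarrow> pole_le X k U = hol X U"
  by (simp add: pole_le_def)

lemma pole_le_nearE: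
  assumes "f \<in> pole_le X k U" "pt X \<in> U" "opn U"
  obtains V g where "opn V" "pt X \<in> V" "V \<subseteq> U" "V \<subseteq> U0" "g \<in> hol X V"
    "\<forall>q\<in>V - {pt X}. g q = coord X q powi k * f q"
proof -
  obtain V g where V: "g \<in> hol X V" "opn V" "pt X \<in> V" "V \<subseteq> U"
    "\<forall>q\<in>V - {pt X}. g q = coord X q powi k * f q"
    using assms by (auto simp: pole_le_def)
  show thesis
  proof (rule that[of "V \<inter> U0" g])
    show "g \<in> hol X (V \<inter> U0)" by (rule hol_mono[OF V(1,2)]) (use V open_U0 in auto)
  qed (use V open_U0 pt_U0 in auto)
qed

lemma pole_le_cong:
  assumes "opn U" "f \<in> pole_le X k U" "\<And>q. q \<in> U - {pt X} \<Longrightarrow> g q = f q"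
  shows "g \<in> pole_le X k U"
proof -
  have "g \<in> hol X (U - {pt X})"
    by (rule hol_cong[of _ f]) (use assms open_del in \<open>auto simp: pole_le_def\<close>)
  moreover have "\<exists>V. \<exists>h\<in>hol X V. opn V \<and> pt X \<in> V \<and> V \<subseteq> U \<and>
        (\<forall>q\<in>V - {pt X}. h q = coord X q powi k * g q)" if pt: "pt X \<in> U"
  proof -
    obtain V h where V: "opn V" "pt X \<in> V" "V \<subseteq> U" "V \<subseteq> U0" "h \<in> hol X V"
      "\<forall>q\<in>V - {pt X}. h q = coord X q powi k * f q"
      by (rule pole_le_nearE[OF assms(2) pt assms(1)])
    have "\<forall>q\<in>V - {pt X}. h q = coord X q powi k * g q"
      using V(3,6) assms(3) by auto
    then show ?thesis using V by blast
  qed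
  ultimately show ?thesis by (simp add: pole_le_def)
qed

lemma pole_le_mono_set:
  assumes "f \<in> pole_le X k U" "opn U" "opn V" "V \<subseteq> U"
  shows "f \<in> pole_le X k V"
proof -
  have "f \<in> hol X (V - {pt X})"
    by (rule hol_mono[of f "U - {pt X}"]) (use assms open_del in \<open>auto simp: pole_le_def\<close>)
  moreover have "\<exists>W. \<exists>h\<in>hol X W. opn W \<and> pt X \<in> W \<and> W \<subseteq> V \<and>
        (\<forall>q\<in>W - {pt X}. h q = coord X q powi k * f q)" if pt: "pt X \<in> V"
  proof -
    obtain W h where W: "opn W" "pt X \<in> W" "W \<subseteq> U" "W \<subseteq> U0" "h \<in> hol X W"
      "\<forall>q\<in>W - {pt X}. h q = coord X q powi k * f q"
      by (rule pole_le_nearE[OF assms(1) subsetD[OF assms(4) pt] assms(2)])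
    have "h \<in> hol X (W \<inter> V)" by (rule hol_mono[OF W(5,1)]) (use W assms in auto)
    then show ?thesis using W pt assms by (intro exI[of _ "W \<inter> V"] bexI[of _ h]) auto
  qed
  ultimately show ?thesis by (simp add: pole_le_def)
qed

lemma pole_le_Union:
  assumes "\<And>U. U \<in> \<U> \<Longrightarrow> opn U \<and> f \<in> pole_le X k U"
  shows "f \<in> pole_le X k (\<Union>\<U>)"
proof -
  have "f \<in> hol X (\<Union>((\<lambda>U. U - {pt X}) ` \<U>))"
    by (rule hol_Union) (use assms open_del in \<open>auto simp: pole_le_def\<close>)
  moreover have "\<Union>((\<lambda>U. U - {pt X}) ` \<U>) = \<Union>\<U> - {pt X}" by auto
  moreover have "\<exists>W. \<exists>h\<in>hol X W. opn W \<and> pt X \<in> W \<and> W \<subseteq> \<Union>\<U> \<and>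
        (\<forall>q\<in>W - {pt X}. h q = coord X q powi k * f q)" if pt: "pt X \<in> \<Union>\<U>"
  proof -
    obtain U where U: "U \<in> \<U>" "pt X \<in> U" using pt by auto
    have 1: "opn U" "f \<in> pole_le X k U" using assms[OF U(1)] by auto
    obtain W h where W: "opn W" "pt X \<in> W" "W \<subseteq> U" "W \<subseteq> U0" "h \<in> hol X W"
      "\<forall>q\<in>W - {pt X}. h q = coord X q powi k * f q"
      by (rule pole_le_nearE[OF 1(2) U(2) 1(1)])
    show ?thesis
      by (rule exI[of _ W], rule bexI[of _ h]) (use W U in auto)
  qed
  ultimately show ?thesis by (simp add: pole_le_def)
qed

lemma pole_le_add:
  assumes "opn U" "f \<in> pole_le X k U" "g \<in> pole_le X k U"
  shows "(\<lambda>q. f q + g q) \<in> pole_le X k U"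
proof -
  have "(\<lambda>q. f q + g q) \<in> hol X (U - {pt X})"
    by (rule hol_add) (use assms open_del in \<open>auto simp: pole_le_def\<close>)
  moreover have "\<exists>W. \<exists>h\<in>hol X W. opn W \<and> pt X \<in> W \<and> W \<subseteq> U \<and>
        (\<forall>q\<in>W - {pt X}. h q = coord X q powi k * (f q + g q))" if pt: "pt X \<in> U"
  proof -
    obtain W h where W: "opn W" "pt X \<in> W" "W \<subseteq> U" "W \<subseteq> U0" "h \<in> hol X W"
      "\<forall>q\<in>W - {pt X}. h q = coord X q powi k * f q"
      by (rule pole_le_nearE[OF assms(2) pt assms(1)])
    obtain W' h' where W': "opn W'" "pt X \<in> W'" "W' \<subseteq> U" "W' \<subseteq> U0" "h' \<in> hol X W'"
      "\<forall>q\<in>W' - {pt X}. h' q = coord X q powi k * g q"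
      by (rule pole_le_nearE[OF assms(3) pt assms(1)])
    have "(\<lambda>q. h q + h' q) \<in> hol X (W \<inter> W')"
      by (rule hol_add) (use W W' in \<open>auto intro: hol_mono\<close>)
    then show ?thesis using W W' 
      by (intro exI[of _ "W \<inter> W'"] bexI[of _ "\<lambda>q. h q + h' q"]) (auto simp: algebra_simps)
  qed
  ultimately show ?thesis by (simp add: pole_le_def)
qed

lemma pole_le_mult:
  assumes "opn U" "f \<in> pole_le X k U" "g \<in> pole_le X l U"
  shows "(\<lambda>q. f q * g q) \<in> pole_le X (k + l) U"
proof -
  have "(\<lambda>q. f q * g q) \<in> hol X (U - {pt X})"
    by (rule hol_mult) (use assms open_del in \<open>auto simp: pole_le_def\<close>)
  moreover have "\<exists>W. \<exists>h\<in>hol X W. opn W \<and> pt X \<in> W \<and> W \<subseteq> U \<and>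
        (\<forall>q\<in>W - {pt X}. h q = coord X q powi (k + l) * (f q * g q))" if pt: "pt X \<in> U"
  proof -
    obtain W h where W: "opn W" "pt X \<in> W" "W \<subseteq> U" "W \<subseteq> U0" "h \<in> hol X W"
      "\<forall>q\<in>W - {pt X}. h q = coord X q powi k * f q"
      by (rule pole_le_nearE[OF assms(2) pt assms(1)])
    obtain W' h' where W': "opn W'" "pt X \<in> W'" "W' \<subseteq> U" "W' \<subseteq> U0" "h' \<in> hol X W'"
      "\<forall>q\<in>W' - {pt X}. h' q = coord X q powi l * g q"
      by (rule pole_le_nearE[OF assms(3) pt assms(1)])
    have "(\<lambda>q. h q * h' q) \<in> hol X (W \<inter> W')"
      by (rule hol_mult) (use W W' in \<open>auto intro: hol_mono\<close>)
    moreover have "h q * h' q = coord X q powi (k + l) * (f q * g q)" if "q \<in> W \<inter> W' - {pt X}" for q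
      using that bspec[OF W(6), of q] bspec[OF W'(6), of q] coord_nz[of q] W(4) by (auto simp: power_int_add)
    ultimately show ?thesis using W W' 
      by (intro exI[of _ "W \<inter> W'"] bexI[of _ "\<lambda>q. h q * h' q"]) auto
  qed
  ultimately show ?thesis by (simp add: pole_le_def)
qed

lemma hol_pole_le:
  assumes "opn U" "f \<in> hol X U" shows "f \<in> pole_le X 0 U"
  using assms hol_mono[OF assms(2,1) open_del[OF assms(1)]]
  unfolding pole_le_def mem_Collect_eq
  by (intro conjI impI exI[of _ U] bexI[of _ f] ballI) auto

lemma pole_le_mono:
  assumes "opn U" "f \<in> pole_le X k U" "k \<le> l"
  shows "f \<in> pole_le X l U"
proof -
  have "\<exists>W. \<exists>h\<in>hol X W. opn W \<and> pt X \<in> W \<and> W \<subseteq> U \<and>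
        (\<forall>q\<in>W - {pt X}. h q = coord X q powi l * f q)" if pt: "pt X \<in> U"
  proof -
    obtain W h where W: "opn W" "pt X \<in> W" "W \<subseteq> U" "W \<subseteq> U0" "h \<in> hol X W"
      "\<forall>q\<in>W - {pt X}. h q = coord X q powi k * f q"
      by (rule pole_le_nearE[OF assms(2) pt assms(1)])
    have 1: "(\<lambda>q. coord X q ^ nat (l - k) * h q) \<in> hol X W"
      by (rule hol_mult) (use W in \<open>auto intro: hol_coord_power\<close>)
    have 2: "coord X q ^ nat (l - k) * h q = coord X q powi l * f q"
      if "q \<in> W - {pt X}" for q
    proof -
      have e1: "coord X q ^ nat (l - k) = coord X q powi (l - k)"
        using assms(3) by (simp add: power_int_def)
      have e2: "coord X q powi (l - k) * coord X q powi k = coord X q powi l"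
        using coord_nz[of q] that W(4) by (subst power_int_add[symmetric]) auto
      show ?thesis unfolding bspec[OF W(6) that] e1 mult.assoc[symmetric] e2 ..
    qed
    show ?thesis
      by (rule exI[of _ W], rule bexI[OF _ 1]) (use W(1-3) 2 in blast)
  qed
  then show ?thesis using assms(2) by (simp add: pole_le_def)
qed

lemma pole_le_const: "opn U \<Longrightarrow> (\<lambda>_. c) \<in> pole_le X 0 U"
  by (intro hol_pole_le hol_const)

lemma pole_le_zero: "opn U \<Longrightarrow> (\<lambda>_. 0) \<in> pole_le X k U"
  using hol_const[of 0] unfolding pole_le_def mem_Collect_eq
  by (intro conjI impI exI[of _ U] bexI[of _ "\<lambda>_. 0"] ballI) auto

lemma pole_le_cmult:
  assumes "opn U" "f \<in> pole_le X k U" shows "(\<lambda>q. c * f q) \<in> pole_le X k U"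
  using pole_le_mult[OF assms(1) pole_le_const[OF assms(1), of c] assms(2)] by simp

lemma pole_le_sum:
  assumes "opn U" "\<And>i. i \<in> I \<Longrightarrow> f i \<in> pole_le X k U"
  shows "(\<lambda>q. \<Sum>i\<in>I. f i q) \<in> pole_le X k U"
  using assms(2)
proof (induction I rule: infinite_finite_induct)
  case (insert i I)
  then show ?case using pole_le_add[OF assms(1), of "f i" k "\<lambda>q. \<Sum>i\<in>I. f i q"] by simp
qed (simp_all add: pole_le_zero[OF assms(1)])

lemma pole_le_prod:
  assumes "opn U" "\<And>i. i \<in> I \<Longrightarrow> f i \<in> pole_le X (k i) U"
  shows "(\<lambda>q. \<Prod>i\<in>I. f i q) \<in> pole_le X (\<Sum>i\<in>I. k i) U"
  using assms(2)
proof (induction I rule: infinite_finite_induct)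
  case (insert i I)
  then show ?case
    using pole_le_mult[OF assms(1), of "f i" "k i" "\<lambda>q. \<Prod>i\<in>I. f i q" "sum k I"] by simp
qed (simp_all add: pole_le_const[OF assms(1)])

lemma pole_le_coord_powi:
  assumes "opn U" "U \<subseteq> U0"
  shows "(\<lambda>q. coord X q powi (- k)) \<in> pole_le X k U"
proof -
  have "(\<lambda>q. coord X q powi (- k)) \<in> hol X (U - {pt X})"
    by (rule hol_coord_powi) (use assms open_del in auto)
  moreover have "coord X q powi k * coord X q powi (- k) = 1" if "q \<in> U - {pt X}" for q
    using coord_nz[of q] that assms(2) by (subst power_int_add[symmetric]) auto
  ultimately show ?thesis using assms(1) hol_const[of 1 U]
    unfolding pole_le_def mem_Collect_eq
    by (intro conjI impI exI[of _ U] bexI[of _ "\<lambda>_. 1"] ballI) auto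
qed

text \<open>
  Near the marked point the coordinate is invertible, so the germ condition in the definition glues with the
  function on the punctured set. This turns a bound on the pole into divisibility in the ring of
  holomorphic functions.
\<close>

lemma pole_le_iff_hol:
  assumes "opn U" "U \<subseteq> U0"
  shows "f \<in> pole_le X k U \<longleftrightarrow>
    (\<exists>g\<in>hol X U. \<forall>q\<in>U - {pt X}. f q = coord X q powi (- k) * g q)" (is "?L \<longleftrightarrow> ?R")
proof
  assume ?R
  then obtain g where g: "g \<in> hol X U" "\<forall>q\<in>U - {pt X}. f q = coord X q powi (- k) * g q" by auto
  show ?L
    by (rule pole_le_cong[OF assms(1)
          pole_le_mult[OF assms(1) pole_le_coord_powi[OF assms, of k] hol_pole_le[OF assms(1) g(1)],
            simplified]])
      (use g(2) in auto)
next
  assume L: ?L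
  have inv: "coord X q powi (- k) * coord X q powi k = 1" if "q \<in> U - {pt X}" for q
    using coord_nz[of q] that assms(2) by (subst power_int_add[symmetric]) auto
  have off: "(\<lambda>q. coord X q powi k * f q) \<in> hol X (U - {pt X})"
    by (intro hol_mult hol_coord_powi) (use L assms open_del in \<open>auto simp: pole_le_def\<close>)
  show ?R
  proof (cases "pt X \<in> U")
    case True
    obtain W h where W: "opn W" "pt X \<in> W" "W \<subseteq> U" "W \<subseteq> U0" "h \<in> hol X W"
      "\<forall>q\<in>W - {pt X}. h q = coord X q powi k * f q"
      by (rule pole_le_nearE[OF L True assms(1)])
    define g where "g q = (if q = pt X then h q else coord X q powi k * f q)" for q
    have "g \<in> hol X U"
    proof (rule hol_glue_pt[OF assms(1) _ W(1,2,3)])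
      show "g \<in> hol X (U - {pt X})"
        by (rule hol_cong[OF _ off]) (use assms open_del in \<open>auto simp: g_def\<close>)
      show "g \<in> hol X W" by (rule hol_cong[OF W(1,5)]) (use W(6) in \<open>auto simp: g_def\<close>)
    qed
    moreover have "f q = coord X q powi (- k) * g q" if "q \<in> U - {pt X}" for q
      using inv[OF that] that by (simp add: g_def mult.assoc[symmetric])
    ultimately show ?thesis by (intro bexI[of _ g]) auto
  next
    case False
    then have "U - {pt X} = U" by auto
    show ?thesis
    proof (intro bexI[of _ "\<lambda>q. coord X q powi k * f q"] ballI)
      show "f q = coord X q powi (- k) * (coord X q powi k * f q)" if "q \<in> U - {pt X}" for q
        using inv[OF that] by (metis mult.assoc mult_1)
    qed (use off \<open>U - {pt X} = U\<close> in simp)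
  qed
qed

lemma mero_nearE:
  assumes "f \<in> mero X U" "pt X \<in> U"
  obtains V n g where "opn V" "pt X \<in> V" "V \<subseteq> U" "g \<in> hol X V"
    "\<forall>q\<in>V - {pt X}. g q = coord X q ^ n * f q"
proof -
  have "\<exists>V n. \<exists>g\<in>hol X V. opn V \<and> pt X \<in> V \<and> V \<subseteq> U \<and>
        (\<forall>q\<in>V - {pt X}. g q = coord X q ^ n * f q)"
    using assms by (simp add: mero_def)
  then show thesis using that by blast
qed

text \<open>
  Meromorphic functions are exhausted by the functions of bounded pole order, which reduces their ring
  operations to those of the graded pieces.
\<close>

lemma mero_iff: 
  assumes "opn U"
  shows "f \<in> mero X U \<longleftrightarrow> (\<exists>k. f \<in> pole_le X k U)" 
proof
  assume L: "f \<in> mero X U"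
  show "\<exists>k. f \<in> pole_le X k U"
  proof (cases "pt X \<in> U")
    case True
    obtain V n g where V: "opn V" "pt X \<in> V" "V \<subseteq> U" "g \<in> hol X V"
      "\<forall>q\<in>V - {pt X}. g q = coord X q ^ n * f q" by (rule mero_nearE[OF L True])
    have "f \<in> pole_le X (int n) U" unfolding pole_le_def mem_Collect_eq
    proof (intro conjI impI exI[of _ V] bexI[of _ g])
      show "f \<in> hol X (U - {pt X})" using L by (simp add: mero_def)
    qed (use V in simp_all)
    then show ?thesis by (rule exI)
  next
    case False
    then have "f \<in> pole_le X 0 U" using L by (simp add: mero_def pole_le_def)
    then show ?thesis by (rule exI)
  qed
next
  assume "\<exists>k. f \<in> pole_le X k U"
  then obtain k where k: "f \<in> pole_le X k U" by (rule exE)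
  define n where "n = nat k"
  have *: "f \<in> pole_le X (int n) U" by (rule pole_le_mono[OF assms k]) (auto simp: n_def)
  show "f \<in> mero X U" unfolding mero_def mem_Collect_eq
  proof (intro conjI impI)
    show "f \<in> hol X (U - {pt X})" using * by (simp add: pole_le_def)
    assume pt: "pt X \<in> U"
    obtain V g where V: "opn V" "pt X \<in> V" "V \<subseteq> U" "V \<subseteq> U0" "g \<in> hol X V"
      "\<forall>q\<in>V - {pt X}. g q = coord X q powi (int n) * f q"
      by (rule pole_le_nearE[OF * pt assms])
    show "\<exists>V n. \<exists>g\<in>hol X V. openin (top_of X) V \<and> pt X \<in> V \<and> V \<subseteq> U \<and>
        (\<forall>q\<in>V - {pt X}. g q = coord X q ^ n * f q)"
      by (rule exI[of _ V], rule exI[of _ n], rule bexI[of _ g]) (use V in simp_all)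
  qed
qed

lemma mero_iff_nat: 
  assumes "opn U"
  shows "f \<in> mero X U \<longleftrightarrow> (\<exists>n::nat. f \<in> pole_le X (int n) U)"
proof
  assume "f \<in> mero X U"
  from mero_iff[OF assms, THEN iffD1, OF this] obtain k where "f \<in> pole_le X k U" by (rule exE)
  then have "f \<in> pole_le X (int (nat k)) U" by (rule pole_le_mono[OF assms]) auto
  then show "\<exists>n::nat. f \<in> pole_le X (int n) U" by (rule exI)
next
  assume "\<exists>n::nat. f \<in> pole_le X (int n) U"
  then obtain n where "f \<in> pole_le X (int n) U" by (rule exE)
  then show "f \<in> mero X U" by (intro mero_iff[OF assms, THEN iffD2] exI)
qed

lemma pole_le_mero: "opn U \<Longrightarrow> f \<in> pole_le X k U \<Longrightarrow> f \<in> mero X U"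
  by (intro mero_iff[THEN iffD2] exI)

lemma mero_const: "opn U \<Longrightarrow> (\<lambda>_. c) \<in> mero X U"
  by (rule pole_le_mero[OF _ pole_le_const])

lemma mero_mult:
  assumes "opn U" "f \<in> mero X U" "g \<in> mero X U" shows "(\<lambda>q. f q * g q) \<in> mero X U"
proof -
  from mero_iff[OF assms(1), THEN iffD1, OF assms(2)] obtain k where k: "f \<in> pole_le X k U" ..
  from mero_iff[OF assms(1), THEN iffD1, OF assms(3)] obtain l where l: "g \<in> pole_le X l U" ..
  from pole_le_mult[OF assms(1) k l] show ?thesis by (rule pole_le_mero[OF assms(1)])
qed

lemma mero_add:
  assumes "opn U" "f \<in> mero X U" "g \<in> mero X U" shows "(\<lambda>q. f q + g q) \<in> mero X U"
proof -
  from mero_iff[OF assms(1), THEN iffD1, OF assms(2)] obtain k where k: "f \<in> pole_le X k U" ..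
  from mero_iff[OF assms(1), THEN iffD1, OF assms(3)] obtain l where l: "g \<in> pole_le X l U" ..
  from pole_le_add[OF assms(1) pole_le_mono[OF assms(1) k, of "max k l"]
      pole_le_mono[OF assms(1) l, of "max k l"]] have "(\<lambda>q. f q + g q) \<in> pole_le X (max k l) U" by simp
  then show ?thesis by (rule pole_le_mero[OF assms(1)])
qed

lemma mero_sum:
  assumes "opn U" "\<And>i. i \<in> I \<Longrightarrow> f i \<in> mero X U"
  shows "(\<lambda>q. \<Sum>i\<in>I. f i q) \<in> mero X U"
  using assms(2)
proof (induction I rule: infinite_finite_induct)
  case (insert i I)
  then show ?case using mero_add[OF assms(1), of "f i" "\<lambda>q. \<Sum>i\<in>I. f i q"] by simp
qed (simp_all add: mero_const[OF assms(1)])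

lemma mero_cong: 
  assumes "opn U" "f \<in> mero X U" "\<And>q. q \<in> U - {pt X} \<Longrightarrow> g q = f q" shows "g \<in> mero X U"
proof -
  from mero_iff[OF assms(1), THEN iffD1, OF assms(2)] obtain k where k: "f \<in> pole_le X k U" ..
  from pole_le_cong[OF assms(1) k assms(3)] show ?thesis by (rule pole_le_mero[OF assms(1)])
qed

lemma mero_mono_set:
  assumes "f \<in> mero X U" "opn U" "opn V" "V \<subseteq> U" shows "f \<in> mero X V"
proof -
  from mero_iff[OF assms(2), THEN iffD1, OF assms(1)] obtain k where k: "f \<in> pole_le X k U" ..
  from pole_le_mono_set[OF k assms(2-4)] show ?thesis by (rule pole_le_mero[OF assms(3)])
qed

lemma mero_Union:
  assumes "\<And>U. U \<in> \<U> \<Longrightarrow> opn U \<and> f \<in> mero X U" shows "f \<in> mero X (\<Union>\<U>)"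
proof -
  have h: "f \<in> hol X (\<Union>((\<lambda>U. U - {pt X}) ` \<U>))"
  proof (rule hol_Union)
    fix W assume "W \<in> (\<lambda>U. U - {pt X}) ` \<U>"
    then obtain U where U: "U \<in> \<U>" "W = U - {pt X}" by auto
    then show "opn W \<and> f \<in> hol X W" using assms[OF U(1)] open_del[of U] by (simp add: mero_def)
  qed
  have eq: "\<Union>((\<lambda>U. U - {pt X}) ` \<U>) = \<Union>\<U> - {pt X}" by blast
  have 1: "f \<in> hol X (\<Union>\<U> - {pt X})" by (rule h[unfolded eq])
  have 2: "\<exists>V n. \<exists>g\<in>hol X V. openin (top_of X) V \<and> pt X \<in> V \<and> V \<subseteq> \<Union>\<U> \<and>
        (\<forall>q\<in>V - {pt X}. g q = coord X q ^ n * f q)" if pt: "pt X \<in> \<Union>\<U>"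
  proof -
    obtain U where U: "U \<in> \<U>" "pt X \<in> U" using pt by auto
    have "f \<in> mero X U" using assms[OF U(1)] by (rule conjunct2)
    from mero_nearE[OF this U(2)] obtain V n g where V: "opn V" "pt X \<in> V" "V \<subseteq> U" "g \<in> hol X V"
      "\<forall>q\<in>V - {pt X}. g q = coord X q ^ n * f q" .
    have "V \<subseteq> \<Union>\<U>" using V(3) U(1) by auto
    with V show ?thesis by blast
  qed
  show ?thesis unfolding mero_def mem_Collect_eq using 1 2 by (intro conjI impI)
qed

end

section \<open>Filtered bundles spanned by a frame\<close>

text \<open>
  Sections with coefficients in \<open>T j\<close> along the \<open>j\<close>-th column of the frame \<open>e\<close>. The coefficient sheaf
  may depend on the column because the columns of a frame carry different weights.
\<close>

definition frame_span ::
  "'p marked_curve \<Rightarrow> nat \<Rightarrow> ('p \<Rightarrow> complex mat) \<Rightarrow> (nat \<Rightarrow> 'p set \<Rightarrow> ('p \<Rightarrow> complex) set) \<Rightarrow>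
   'p set \<Rightarrow> ('p \<Rightarrow> complex vec) set" where
  "frame_span X m e T U = {s. \<exists>f. (\<forall>j<m. f j \<in> T j U) \<and>
     (\<forall>q\<in>U - {pt X}. s q = e q *\<^sub>v Matrix.vec m (\<lambda>j. f j q))}"

lemma frame_spanI:
  assumes "\<And>j. j < m \<Longrightarrow> f j \<in> T j U"
    and "\<And>q. q \<in> U - {pt X} \<Longrightarrow> s q = e q *\<^sub>v Matrix.vec m (\<lambda>j. f j q)"
  shows "s \<in> frame_span X m e T U"
  unfolding frame_span_def by (rule CollectI, rule exI[of _ f]) (simp add: assms)

lemma frame_spanE:
  assumes "s \<in> frame_span X m e T U"
  obtains f where "\<forall>j<m. f j \<in> T j U"
    "\<forall>q\<in>U - {pt X}. s q = e q *\<^sub>v Matrix.vec m (\<lambda>j. f j q)"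
proof -
  have "\<exists>f. (\<forall>j<m. f j \<in> T j U) \<and> (\<forall>q\<in>U - {pt X}. s q = e q *\<^sub>v Matrix.vec m (\<lambda>j. f j q))"
    using assms by (simp add: frame_span_def)
  then show thesis using that by blast
qed

lemma frame_span_mono:
  assumes "\<And>j f. j < m \<Longrightarrow> f \<in> T j U \<Longrightarrow> f \<in> T' j U"
  shows "frame_span X m e T U \<subseteq> frame_span X m e T' U"
proof
  fix s assume "s \<in> frame_span X m e T U"
  then show "s \<in> frame_span X m e T' U"
  proof (rule frame_spanE)
    fix f assume f': "\<forall>j<m. f j \<in> T j U"
      "\<forall>q\<in>U - {pt X}. s q = e q *\<^sub>v Matrix.vec m (\<lambda>j. f j q)"
    note f = f'[rule_format]
    show "s \<in> frame_span X m e T' U"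
      by (rule frame_spanI[where f = f]) (rule assms[OF _ f(1)] f(2), assumption+)+
  qed
qed

text \<open>
  The number \<open>a j\<close> is the order of the \<open>j\<close>-th column: a section of order at most \<open>\<alpha>\<close> may have a
  coefficient with a pole of order \<open>\<lfloor>\<alpha> - a j\<rfloor>\<close> there.
\<close>

definition framed_sheaf ::
  "'p marked_curve \<Rightarrow> nat \<Rightarrow> ('p \<Rightarrow> complex mat) \<Rightarrow> (nat \<Rightarrow> real) \<Rightarrow> 'p filtered_sheaf" where
  "framed_sheaf X m e a = \<lparr>
     sec = frame_span X m e (\<lambda>_. mero X),
     fil = (\<lambda>\<alpha>. frame_span X m e (\<lambda>j. pole_le X \<lfloor>\<alpha> - a j\<rfloor>))\<rparr>"

locale framed_curve = coordinate_curve X U0 for X :: "'p marked_curve" and U0 +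
  fixes d m :: nat and e :: "'p \<Rightarrow> complex mat"
  assumes pt_top: "pt X \<in> topspace (top_of X)"
    and e_carrier: "q \<in> topspace (top_of X) - {pt X} \<Longrightarrow> e q \<in> carrier_mat d m"
    and e_inj: "q \<in> topspace (top_of X) - {pt X} \<Longrightarrow> c \<in> carrier_vec m \<Longrightarrow>
       e q *\<^sub>v c = 0\<^sub>v d \<Longrightarrow> c = 0\<^sub>v m"
begin

lemma openD: "opn U \<Longrightarrow> q \<in> U \<Longrightarrow> q \<in> topspace (top_of X)"
  using openin_subset by blast

lemma e_cancel:
  assumes "q \<in> topspace (top_of X) - {pt X}" "c \<in> carrier_vec m" "c' \<in> carrier_vec m"
    "e q *\<^sub>v c = e q *\<^sub>v c'"
  shows "c = c'"
proof -
  have "e q *\<^sub>v (c - c') = e q *\<^sub>v c - e q *\<^sub>v c'"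
    by (rule mult_minus_distrib_mat_vec[OF e_carrier[OF assms(1)] assms(2,3)])
  also have "\<dots> = 0\<^sub>v d" using assms(4) e_carrier[OF assms(1)] by auto
  finally have "c - c' = 0\<^sub>v m" using e_inj[OF assms(1)] assms(2,3) by auto
  then show ?thesis using assms(2,3) 
    by (metis carrier_vecD eq_vecI index_minus_vec(1) index_zero_vec(1) right_minus_eq)
qed

lemma frame_coeff_unique:
  assumes "q \<in> topspace (top_of X) - {pt X}"
    "e q *\<^sub>v Matrix.vec m f = e q *\<^sub>v Matrix.vec m g" "j < m"
  shows "f j = g j"
proof -
  have "Matrix.vec m f = Matrix.vec m g" by (rule e_cancel[OF assms(1) _ _ assms(2)]) auto
  then have "Matrix.vec m f $ j = Matrix.vec m g $ j" by simp
  then show ?thesis using assms(3) by simp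
qed

text \<open>
  Coefficients with respect to an injective frame are unique, hence coefficients found on the members of a
  covering agree on overlaps and glue.
\<close>

lemma locally_free_frame_span:
  assumes cong: "\<And>j U f g. opn U \<Longrightarrow> f \<in> T j U \<Longrightarrow> (\<And>q. q \<in> U - {pt X} \<Longrightarrow> g q = f q) \<Longrightarrow> g \<in> T j U"
    and mono: "\<And>j U V f. f \<in> T j U \<Longrightarrow> opn U \<Longrightarrow> opn V \<Longrightarrow> V \<subseteq> U \<Longrightarrow> f \<in> T j V"
    and Un: "\<And>j \<U> f. (\<And>U. U \<in> \<U> \<Longrightarrow> opn U \<and> f \<in> T j U) \<Longrightarrow> f \<in> T j (\<Union>\<U>)"
    and local: "\<And>p. p \<in> topspace (top_of X) \<Longrightarrow> \<exists>U e'. opn U \<and> p \<in> U \<and>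
        (\<forall>q\<in>U - {pt X}. e' q \<in> carrier_mat d m \<and>
           (\<forall>c\<in>carrier_vec m. e' q *\<^sub>v c = 0\<^sub>v d \<longrightarrow> c = 0\<^sub>v m)) \<and>
        (\<forall>V. opn V \<longrightarrow> V \<subseteq> U \<longrightarrow> frame_span X m e T V = frame_span X m e' (\<lambda>_. R) V)"
  shows "locally_free X R d m (frame_span X m e T)"
  unfolding locally_free_def
proof (intro conjI allI impI ballI)
  fix U s q assume "opn U" "s \<in> frame_span X m e T U" "q \<in> U - {pt X}"
  moreover from this have "e q \<in> carrier_mat d m" using openD by (intro e_carrier) auto
  ultimately show "s q \<in> carrier_vec d" by (auto simp: frame_span_def)
next
  fix U s t assume "opn U" "s \<in> frame_span X m e T U" "\<forall>q\<in>U - {pt X}. t q = s q"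
  then show "t \<in> frame_span X m e T U" by (auto simp: frame_span_def)
next
  fix U V s assume *: "opn U" "opn V" "V \<subseteq> U" "s \<in> frame_span X m e T U"
  from *(4) obtain f where f': "\<forall>j<m. f j \<in> T j U"
      "\<forall>q\<in>U - {pt X}. s q = e q *\<^sub>v Matrix.vec m (\<lambda>j. f j q)"
    by (rule frame_spanE)
    note f = f'[rule_format]
  have 1: "f j \<in> T j V" if "j < m" for j by (rule mono[OF f(1)[OF that] *(1,2,3)])
  have 2: "s q = e q *\<^sub>v Matrix.vec m (\<lambda>j. f j q)" if "q \<in> V - {pt X}" for q
    by (rule f(2)) (use that *(3) in blast)
  show "s \<in> frame_span X m e T V" by (rule frame_spanI[where f = f]) (fact 1, fact 2)
next
  fix \<U> s assume a: "\<forall>U\<in>\<U>. opn U \<and> s \<in> frame_span X m e T U"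
  have "\<forall>U\<in>\<U>. \<exists>f. (\<forall>j<m. f j \<in> T j U) \<and>
      (\<forall>q\<in>U - {pt X}. s q = e q *\<^sub>v Matrix.vec m (\<lambda>j. f j q))"
    using a by (simp add: frame_span_def)
  from bchoice[OF this] obtain F where "\<forall>U\<in>\<U>. (\<forall>j<m. F U j \<in> T j U) \<and>
      (\<forall>q\<in>U - {pt X}. s q = e q *\<^sub>v Matrix.vec m (\<lambda>j. F U j q))" ..
  then have F: "U \<in> \<U> \<Longrightarrow> j < m \<Longrightarrow> F U j \<in> T j U"
    "U \<in> \<U> \<Longrightarrow> q \<in> U - {pt X} \<Longrightarrow> s q = e q *\<^sub>v Matrix.vec m (\<lambda>j. F U j q)" for U j q
    by simp_all
  define g where "g j q = F (SOME U. U \<in> \<U> \<and> q \<in> U) j q" for j q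
  have g: "g j q = F U j q" if "U \<in> \<U>" "q \<in> U - {pt X}" "j < m" for j q U
  proof -
    define W where "W = (SOME U. U \<in> \<U> \<and> q \<in> U)"
    have W: "W \<in> \<U> \<and> q \<in> W" unfolding W_def by (rule someI[of _ U]) (use that in auto)
    have q: "q \<in> topspace (top_of X) - {pt X}" using that a openD by auto
    have "e q *\<^sub>v Matrix.vec m (\<lambda>j. F W j q) = e q *\<^sub>v Matrix.vec m (\<lambda>j. F U j q)"
      using F(2)[of W q] F(2)[of U q] W that by auto
    from frame_coeff_unique[OF q this that(3)] show ?thesis by (simp add: g_def W_def)
  qed
  have 1: "g j \<in> T j (\<Union>\<U>)" if "j < m" for j
  proof (rule Un)
    fix U assume U: "U \<in> \<U>"
    then show "opn U \<and> g j \<in> T j U" using a cong[OF _ F(1)[OF U that], of "g j"] g[OF U _ that] by auto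
  qed
  have 2: "s q = e q *\<^sub>v Matrix.vec m (\<lambda>j. g j q)" if qU: "q \<in> \<Union>\<U> - {pt X}" for q
  proof -
    obtain U where U: "U \<in> \<U>" "q \<in> U - {pt X}" using qU by auto
    have "Matrix.vec m (\<lambda>j. g j q) = Matrix.vec m (\<lambda>j. F U j q)"
      using g[OF U] by (intro eq_vecI) auto
    then show ?thesis using F(2)[OF U] by simp
  qed
  show "s \<in> frame_span X m e T (\<Union>\<U>)" by (rule frame_spanI[where f = g]) (fact 1, fact 2)
next
  fix p assume "p \<in> topspace (top_of X)"
  from local[OF this] show "\<exists>U ea. opn U \<and> p \<in> U \<and> (\<forall>q\<in>U - {pt X}.
               ea q \<in> carrier_mat d m \<and> (\<forall>c\<in>carrier_vec m. ea q *\<^sub>v c = 0\<^sub>v d \<longrightarrow> c = 0\<^sub>v m)) \<and>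
            (\<forall>V. opn V \<longrightarrow> V \<subseteq> U \<longrightarrow> frame_span X m e T V =
                {s. \<exists>f. (\<forall>j<m. f j \<in> R V) \<and> (\<forall>q\<in>V - {pt X}. s q = ea q *\<^sub>v Matrix.vec m (\<lambda>j. f j q))})"
    unfolding frame_span_def[of X m _ "\<lambda>_. R"] .
qed

lemma locally_free_mero: "locally_free X (mero X) d m (frame_span X m e (\<lambda>_. mero X))"
proof (rule locally_free_frame_span)
  show "\<exists>U e'. opn U \<and> p \<in> U \<and> (\<forall>q\<in>U - {pt X}. e' q \<in> carrier_mat d m \<and>
           (\<forall>c\<in>carrier_vec m. e' q *\<^sub>v c = 0\<^sub>v d \<longrightarrow> c = 0\<^sub>v m)) \<and>
        (\<forall>V. opn V \<longrightarrow> V \<subseteq> U \<longrightarrow> frame_span X m e (\<lambda>_. mero X) V = frame_span X m e' (\<lambda>_. mero X) V)"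
    if "p \<in> topspace (top_of X)" for p
    by (rule exI[of _ "topspace (top_of X)"], rule exI[of _ e]) (use that e_carrier e_inj in auto)
qed (use mero_cong mero_mono_set mero_Union in blast)+

text \<open>
  Away from the marked point the pole condition is empty. Near it the columns are rescaled by powers of the
  coordinate, which makes \<open>pole_le\<close> coefficients holomorphic ones.
\<close>

lemma locally_free_hol:
  "locally_free X (hol X) d m (frame_span X m e (\<lambda>j. pole_le X (k j)))"
proof (rule locally_free_frame_span)
  fix p assume p: "p \<in> topspace (top_of X)"
  show "\<exists>U e'. opn U \<and> p \<in> U \<and> (\<forall>q\<in>U - {pt X}. e' q \<in> carrier_mat d m \<and>
           (\<forall>c\<in>carrier_vec m. e' q *\<^sub>v c = 0\<^sub>v d \<longrightarrow> c = 0\<^sub>v m)) \<and>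
        (\<forall>V. opn V \<longrightarrow> V \<subseteq> U \<longrightarrow> frame_span X m e (\<lambda>j. pole_le X (k j)) V = frame_span X m e' (\<lambda>_. hol X) V)"
  proof (cases "p = pt X")
    case False
    show ?thesis
    proof (rule exI[of _ "topspace (top_of X) - {pt X}"], rule exI[of _ e], intro conjI ballI allI impI)
      fix V assume "opn V" "V \<subseteq> topspace (top_of X) - {pt X}"
      then have "pt X \<notin> V" by auto
      then show "frame_span X m e (\<lambda>j. pole_le X (k j)) V = frame_span X m e (\<lambda>_. hol X) V"
        unfolding frame_span_def by (simp add: pole_le_off)
    qed (use p False open_del[OF openin_topspace] e_carrier e_inj in auto)
  next
    case True
    define e' where "e' q = e q * mat m m (\<lambda>(i,j). if i = j then coord X q powi (- k j) else 0)" for q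
    have e'v: "e' q *\<^sub>v Matrix.vec m f = e q *\<^sub>v Matrix.vec m (\<lambda>j. coord X q powi (- k j) * f j)"
      if "q \<in> topspace (top_of X) - {pt X}" for q f
    proof -
      have "mat m m (\<lambda>(i,j). if i = j then coord X q powi (- k j) else 0) *\<^sub>v Matrix.vec m f
         = Matrix.vec m (\<lambda>j. coord X q powi (- k j) * f j)"
        by (rule eq_vecI) (auto simp: scalar_prod_def sum.remove[of "{0..<m}"])
      then show ?thesis unfolding e'_def
        by (subst assoc_mult_mat_vec[OF e_carrier[OF that]]) auto
    qed
    show ?thesis
    proof (rule exI[of _ U0], rule exI[of _ e'], intro conjI ballI allI impI)
      fix q assume "q \<in> U0 - {pt X}"
      then have q: "q \<in> topspace (top_of X) - {pt X}" "coord X q \<noteq> 0"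
        using openD[OF open_U0] coord_nz by auto
      show "e' q \<in> carrier_mat d m" unfolding e'_def using e_carrier[OF q(1)] by auto
      fix c :: "complex vec" assume c: "c \<in> carrier_vec m" "e' q *\<^sub>v c = 0\<^sub>v d"
      have "c = Matrix.vec m (\<lambda>j. c $ j)" using c(1) by auto
      then have "e q *\<^sub>v Matrix.vec m (\<lambda>j. coord X q powi (- k j) * c $ j) = 0\<^sub>v d"
        using c(2) e'v[OF q(1), of "\<lambda>j. c $ j"] by simp
      from e_inj[OF q(1) _ this] have z: "Matrix.vec m (\<lambda>j. coord X q powi (- k j) * c $ j) = 0\<^sub>v m" by auto
      show "c = 0\<^sub>v m"
      proof (rule eq_vecI)
        fix j assume "j < dim_vec (0\<^sub>v m :: complex vec)"
        then have j: "j < m" by simp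
        have "Matrix.vec m (\<lambda>j. coord X q powi (- k j) * c $ j) $ j = (0\<^sub>v m :: complex vec) $ j"
          using z by simp
        then show "c $ j = (0\<^sub>v m :: complex vec) $ j" using j q(2) by simp
      qed (use c in auto)
    next
      fix V assume V: "opn V" "V \<subseteq> U0"
      show "frame_span X m e (\<lambda>j. pole_le X (k j)) V = frame_span X m e' (\<lambda>_. hol X) V" (is "?L = ?R")
      proof (intro equalityI subsetI)
        fix s assume "s \<in> ?L"
        then obtain f where f': "\<forall>j<m. f j \<in> pole_le X (k j) V"
          "\<forall>q\<in>V - {pt X}. s q = e q *\<^sub>v Matrix.vec m (\<lambda>j. f j q)"
          by (rule frame_spanE)
          note f = f'[rule_format]
        have "\<forall>j\<in>{..<m}. \<exists>g. g \<in> hol X V \<and> (\<forall>q\<in>V - {pt X}. f j q = coord X q powi (- k j) * g q)"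
        proof
          fix j assume "j \<in> {..<m}"
          then have "f j \<in> pole_le X (k j) V" using f(1) by simp
          from iffD1[OF pole_le_iff_hol[OF V] this]
          show "\<exists>g. g \<in> hol X V \<and> (\<forall>q\<in>V - {pt X}. f j q = coord X q powi (- k j) * g q)"
            by (simp add: Bex_def)
        qed
        from bchoice[OF this] obtain g where "\<forall>j\<in>{..<m}. g j \<in> hol X V \<and>
          (\<forall>q\<in>V - {pt X}. f j q = coord X q powi (- k j) * g j q)" ..
        then have g: "j < m \<Longrightarrow> g j \<in> hol X V"
          "j < m \<Longrightarrow> q \<in> V - {pt X} \<Longrightarrow> f j q = coord X q powi (- k j) * g j q" for j q
          by simp_all
        have 1: "s q = e' q *\<^sub>v Matrix.vec m (\<lambda>j. g j q)" if q: "q \<in> V - {pt X}" for q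
        proof -
          have "Matrix.vec m (\<lambda>j. f j q) = Matrix.vec m (\<lambda>j. coord X q powi (- k j) * g j q)"
            using g(2)[OF _ q] by (intro eq_vecI) auto
          moreover have "q \<in> topspace (top_of X) - {pt X}" using q openD[OF V(1)] by auto
          ultimately show ?thesis using f(2)[OF q] e'v by simp
        qed
        show "s \<in> ?R" by (rule frame_spanI[where f = g]) (fact g(1), fact 1)
      next
        fix s assume "s \<in> ?R"
        then obtain g where g': "\<forall>j<m. g j \<in> hol X V"
          "\<forall>q\<in>V - {pt X}. s q = e' q *\<^sub>v Matrix.vec m (\<lambda>j. g j q)"
          by (rule frame_spanE)
          note g = g'[rule_format]
        have 1: "(\<lambda>q. coord X q powi (- k j) * g j q) \<in> pole_le X (k j) V" if "j < m" for j
          by (rule iffD2[OF pole_le_iff_hol[OF V]], rule bexI[OF _ g(1)[OF that]]) simp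
        have 2: "s q = e q *\<^sub>v Matrix.vec m (\<lambda>j. coord X q powi (- k j) * g j q)"
          if q: "q \<in> V - {pt X}" for q
          using g(2)[OF q] e'v q openD[OF V(1)] by auto
        show "s \<in> ?L"
          by (rule frame_spanI[where f = "\<lambda>j q. coord X q powi (- k j) * g j q"]) (fact 1, fact 2)
      qed
    qed (use True open_U0 pt_U0 in auto)
  qed
next
  show "g \<in> pole_le X (k j) U"
    if "opn U" "f \<in> pole_le X (k j) U" "\<And>q. q \<in> U - {pt X} \<Longrightarrow> g q = f q" for j U f g
    by (rule pole_le_cong[where f = f]) (fact that)+
  show "f \<in> pole_le X (k j) V"
    if "f \<in> pole_le X (k j) U" "opn U" "opn V" "V \<subseteq> U" for j U V f
    by (rule pole_le_mono_set[where U = U]) (fact that)+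
  show "f \<in> pole_le X (k j) (\<Union>\<U>)"
    if "\<And>U. U \<in> \<U> \<Longrightarrow> opn U \<and> f \<in> pole_le X (k j) U" for j \<U> f
    by (rule pole_le_Union) (fact that)
qed

text \<open>
  The filtration jumps only at the numbers \<open>a j + n\<close> with \<open>n\<close> an integer. Right continuity is that of
  the floor function, and shifting \<open>\<alpha>\<close> by one multiplies all coefficients by the coordinate.
\<close>

lemma framed_sheaf_filtered_bundle: "filtered_bundle X d m (framed_sheaf X m e a)"
  unfolding filtered_bundle_def
proof (intro conjI allI impI)
  show "locally_free X (mero X) d m (sec (framed_sheaf X m e a))"
    by (simp add: framed_sheaf_def locally_free_mero)
  show "locally_free X (hol X) d m (fil (framed_sheaf X m e a) \<alpha>)" for \<alpha>
    by (simp add: framed_sheaf_def locally_free_hol)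
  show "fil (framed_sheaf X m e a) \<alpha> U \<subseteq> sec (framed_sheaf X m e a) U" if "opn U" for \<alpha> U
    unfolding framed_sheaf_def by (simp, rule frame_span_mono, rule pole_le_mero[OF that])
  show inc: "fil (framed_sheaf X m e a) \<alpha> U \<subseteq> fil (framed_sheaf X m e a) \<beta> U"
    if "\<alpha> \<le> \<beta>" "opn U" for \<alpha> \<beta> U
    unfolding framed_sheaf_def
    by (simp, rule frame_span_mono, rule pole_le_mono[OF that(2)])
      (use that(1) in \<open>auto intro: floor_mono\<close>)
  show "fil (framed_sheaf X m e a) \<alpha> U = sec (framed_sheaf X m e a) U"
    if "opn U" "pt X \<notin> U" for \<alpha> U
  proof -
    have "mero X U = hol X U" using that(2) by (simp add: mero_def)
    then show ?thesis using pole_le_off[OF that(2)] by (simp add: framed_sheaf_def frame_span_def)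
  qed
  show "fil (framed_sheaf X m e a) \<alpha> U = (\<Inter>\<beta>\<in>{\<alpha><..}. fil (framed_sheaf X m e a) \<beta> U)"
    if U: "opn U" for \<alpha> U
  proof (intro equalityI subsetI INT_I)
    fix s \<beta> assume "s \<in> fil (framed_sheaf X m e a) \<alpha> U" "\<beta> \<in> {\<alpha><..}"
    then show "s \<in> fil (framed_sheaf X m e a) \<beta> U" using inc[of \<alpha> \<beta>, OF _ U] by auto
  next
    fix s assume s: "s \<in> (\<Inter>\<beta>\<in>{\<alpha><..}. fil (framed_sheaf X m e a) \<beta> U)"
    have ex: "\<exists>\<beta>>\<alpha>. \<lfloor>\<beta> - a j\<rfloor> = \<lfloor>\<alpha> - a j\<rfloor>" for j
    proof -
      define \<beta> where "\<beta> = (\<alpha> + (of_int \<lfloor>\<alpha> - a j\<rfloor> + 1 + a j)) / 2"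
      have "\<alpha> - a j < of_int \<lfloor>\<alpha> - a j\<rfloor> + 1" "of_int \<lfloor>\<alpha> - a j\<rfloor> \<le> \<alpha> - a j" by linarith+
      then have "\<beta> > \<alpha>" "\<lfloor>\<beta> - a j\<rfloor> = \<lfloor>\<alpha> - a j\<rfloor>"
        unfolding floor_eq_iff by (auto simp: \<beta>_def field_simps)
      then show ?thesis by blast
    qed
    have sf: "s \<in> fil (framed_sheaf X m e a) \<beta> U" if "\<beta> > \<alpha>" for \<beta> using s that by auto
    then have "\<forall>\<beta>\<in>{\<alpha><..}. \<exists>f. (\<forall>j<m. f j \<in> pole_le X \<lfloor>\<beta> - a j\<rfloor> U) \<and>
        (\<forall>q\<in>U - {pt X}. s q = e q *\<^sub>v Matrix.vec m (\<lambda>j. f j q))"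
      by (simp add: framed_sheaf_def frame_span_def)
    from bchoice[OF this] obtain F where
      "\<forall>\<beta>\<in>{\<alpha><..}. (\<forall>j<m. F \<beta> j \<in> pole_le X \<lfloor>\<beta> - a j\<rfloor> U) \<and>
        (\<forall>q\<in>U - {pt X}. s q = e q *\<^sub>v Matrix.vec m (\<lambda>j. F \<beta> j q))" ..
    then have F: "\<beta> > \<alpha> \<Longrightarrow> j < m \<Longrightarrow> F \<beta> j \<in> pole_le X \<lfloor>\<beta> - a j\<rfloor> U"
        "\<beta> > \<alpha> \<Longrightarrow> q \<in> U - {pt X} \<Longrightarrow> s q = e q *\<^sub>v Matrix.vec m (\<lambda>j. F \<beta> j q)" for \<beta> j q
      by simp_all
    have 1: "F (\<alpha> + 1) j \<in> pole_le X \<lfloor>\<alpha> - a j\<rfloor> U" if j: "j < m" for j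
    proof -
      obtain \<beta> where \<beta>: "\<beta> > \<alpha>" "\<lfloor>\<beta> - a j\<rfloor> = \<lfloor>\<alpha> - a j\<rfloor>" using ex by blast
      show ?thesis
      proof (rule pole_le_cong[OF U])
        show "F \<beta> j \<in> pole_le X \<lfloor>\<alpha> - a j\<rfloor> U" using F(1)[OF \<beta>(1) j] \<beta>(2) by simp
        fix q assume q: "q \<in> U - {pt X}"
        then have q': "q \<in> topspace (top_of X) - {pt X}" using openD[OF U] by auto
        have "e q *\<^sub>v Matrix.vec m (\<lambda>j. F (\<alpha> + 1) j q) = e q *\<^sub>v Matrix.vec m (\<lambda>j. F \<beta> j q)"
          using F(2)[of "\<alpha> + 1", OF _ q] F(2)[OF \<beta>(1) q] by simp
        from frame_coeff_unique[OF q' this j] show "F (\<alpha> + 1) j q = F \<beta> j q" .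
      qed
    qed
    have 2: "s q = e q *\<^sub>v Matrix.vec m (\<lambda>j. F (\<alpha> + 1) j q)" if "q \<in> U - {pt X}" for q
      by (rule F(2)[OF _ that]) simp
    show "s \<in> fil (framed_sheaf X m e a) \<alpha> U" unfolding framed_sheaf_def filtered_sheaf.simps
      by (rule frame_spanI[where f = "F (\<alpha> + 1)"]) (fact 1, fact 2)
  qed
  show "\<exists>U. opn U \<and> pt X \<in> U \<and> (\<forall>\<alpha> V. opn V \<longrightarrow> V \<subseteq> U \<longrightarrow>
           fil (framed_sheaf X m e a) (\<alpha> - 1) V =
             {s. \<exists>t\<in>fil (framed_sheaf X m e a) \<alpha> V. \<forall>q\<in>V - {pt X}. s q = coord X q \<cdot>\<^sub>v t q})"
  proof (rule exI[of _ U0], intro conjI allI impI open_U0 pt_U0)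
    fix \<alpha> V assume V: "opn V" "V \<subseteq> U0"
    have fl: "\<lfloor>\<alpha> - 1 - a j\<rfloor> = \<lfloor>\<alpha> - a j\<rfloor> - 1" for j by linarith
    have cV: "coord X \<in> pole_le X (- 1) V"
      using pole_le_coord_powi[OF V, of "- 1"] by simp
    have icV: "(\<lambda>q. inverse (coord X q)) \<in> pole_le X 1 V"
      using pole_le_coord_powi[OF V, of 1] by (simp add: power_int_minus)
    have sm: "e q *\<^sub>v Matrix.vec m (\<lambda>j. c * f j) = c \<cdot>\<^sub>v (e q *\<^sub>v Matrix.vec m f)"
      if "q \<in> V - {pt X}" for q c f
    proof -
      have "q \<in> topspace (top_of X) - {pt X}" using openD[OF V(1)] that by auto
      from e_carrier[OF this] have "e q *\<^sub>v (c \<cdot>\<^sub>v Matrix.vec m f) = c \<cdot>\<^sub>v (e q *\<^sub>v Matrix.vec m f)"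
        by (rule mult_mat_vec) auto
      moreover have "c \<cdot>\<^sub>v Matrix.vec m f = Matrix.vec m (\<lambda>j. c * f j)" by (intro eq_vecI) auto
      ultimately show ?thesis by simp
    qed
    show "fil (framed_sheaf X m e a) (\<alpha> - 1) V =
             {s. \<exists>t\<in>fil (framed_sheaf X m e a) \<alpha> V. \<forall>q\<in>V - {pt X}. s q = coord X q \<cdot>\<^sub>v t q}" (is "?L = ?R")
    proof (intro equalityI subsetI)
      fix s assume "s \<in> ?L"
      then obtain f where f': "\<forall>j<m. f j \<in> pole_le X (\<lfloor>\<alpha> - a j\<rfloor> - 1) V"
        "\<forall>q\<in>V - {pt X}. s q = e q *\<^sub>v Matrix.vec m (\<lambda>j. f j q)"
        unfolding framed_sheaf_def filtered_sheaf.simps fl by (rule frame_spanE)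
        note f = f'[rule_format]
      define g where "g = (\<lambda>j q. inverse (coord X q) * f j q)"
      have g: "g j \<in> pole_le X \<lfloor>\<alpha> - a j\<rfloor> V" if "j < m" for j
        using pole_le_mult[OF V(1) icV f(1)[OF that]] by (simp add: g_def)
      define t where "t q = e q *\<^sub>v Matrix.vec m (\<lambda>j. g j q)" for q
      have "t \<in> fil (framed_sheaf X m e a) \<alpha> V"
        unfolding framed_sheaf_def filtered_sheaf.simps
        by (rule frame_spanI[where f = g]) (fact g, simp add: t_def)
      moreover have "s q = coord X q \<cdot>\<^sub>v t q" if q: "q \<in> V - {pt X}" for q
      proof -
        have "coord X q \<noteq> 0" using q V(2) coord_nz by auto
        then have "Matrix.vec m (\<lambda>j. coord X q * g j q) = Matrix.vec m (\<lambda>j. f j q)"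
          by (intro eq_vecI) (auto simp: g_def)
        then show ?thesis using f(2)[OF q] sm[OF q, of "coord X q" "\<lambda>j. g j q"] by (simp add: t_def)
      qed
      ultimately show "s \<in> ?R" by blast
    next
      fix s assume "s \<in> ?R"
      then obtain t where t: "t \<in> fil (framed_sheaf X m e a) \<alpha> V" 
        "\<And>q. q \<in> V - {pt X} \<Longrightarrow> s q = coord X q \<cdot>\<^sub>v t q" by blast
      from t(1) obtain f where f': "\<forall>j<m. f j \<in> pole_le X \<lfloor>\<alpha> - a j\<rfloor> V"
        "\<forall>q\<in>V - {pt X}. t q = e q *\<^sub>v Matrix.vec m (\<lambda>j. f j q)"
        unfolding framed_sheaf_def filtered_sheaf.simps by (rule frame_spanE)
        note f = f'[rule_format]
      have 1: "(\<lambda>q. coord X q * f j q) \<in> pole_le X (\<lfloor>\<alpha> - a j\<rfloor> - 1) V" if "j < m" for j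
        using pole_le_mult[OF V(1) cV f(1)[OF that]] by simp
      have 2: "s q = e q *\<^sub>v Matrix.vec m (\<lambda>j. coord X q * f j q)" if q: "q \<in> V - {pt X}" for q
        using t(2)[OF q] f(2)[OF q] sm[OF q] by simp
      show "s \<in> ?L" unfolding framed_sheaf_def filtered_sheaf.simps fl
        by (rule frame_spanI[where f = "\<lambda>j q. coord X q * f j q"]) (fact 1, fact 2)
    qed
  qed
qed

end

section \<open>The sphere and the disc\<close>

lemma openin_CP1_finite_part:
  assumes "openin (top_of CP1) U"
  shows "open {z. Some z \<in> U}"
proof -
  have "openin (Alexandroff_compactification (euclidean :: complex topology)) U"
    using assms by (simp add: CP1_def)
  then consider V where "open V" "U = Some ` V" | C where "compact C" "U = insert None (Some ` (- C))"
    unfolding openin_Alexandroff_compactification by (auto simp: Compl_eq_Diff_UNIV)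
  then show ?thesis
  proof cases
    case 1
    then have "{z. Some z \<in> U} = V" by auto
    then show ?thesis using 1 by simp
  next
    case 2
    then have "{z. Some z \<in> U} = - C" by auto
    then show ?thesis using 2 by (simp add: compact_imp_closed open_Compl)
  qed
qed

lemma openin_CP1_at_infinity:
  assumes "openin (top_of CP1) U" "None \<in> U"
  obtains r where "r > 0" "\<forall>x. x \<noteq> 0 \<longrightarrow> cmod x < r \<longrightarrow> Some (1 / x) \<in> U"
proof -
  have "openin (Alexandroff_compactification (euclidean :: complex topology)) U"
    using assms by (simp add: CP1_def)
  then obtain C where C: "compact C" "U = insert None (Some ` (- C))"
    using assms(2) unfolding openin_Alexandroff_compactification by (auto simp: Compl_eq_Diff_UNIV)
  obtain B where B: "B > 0" "\<forall>z\<in>C. cmod z \<le> B"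
    using compact_imp_bounded[OF C(1)] unfolding bounded_pos by auto
  show thesis
  proof (rule that[of "1 / B"])
    show "\<forall>x. x \<noteq> 0 \<longrightarrow> cmod x < 1 / B \<longrightarrow> Some (1 / x) \<in> U"
    proof (intro allI impI)
    fix x :: complex assume x: "x \<noteq> 0" "cmod x < 1 / B"
    then have "cmod (1 / x) > B" using B(1) by (simp add: norm_divide field_simps)
    then have "1 / x \<notin> C" using B(2) by force
    then show "Some (1 / x) \<in> U" using C(2) by auto
    qed
  qed (use B in auto)
qed

lemma openin_CP1_delete: "openin (top_of CP1) (UNIV - {Some z})"
proof -
  have "UNIV - {Some z} = insert None (Some ` (topspace euclidean - {z}))"
  proof (rule Set.set_eqI)
    fix p show "p \<in> UNIV - {Some z} \<longleftrightarrow> p \<in> insert None (Some ` (topspace euclidean - {z}))"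
      by (cases p) auto
  qed
  moreover have "compactin euclidean {z}" "closedin euclidean {z}" by simp_all
  ultimately show ?thesis unfolding CP1_def marked_curve.simps openin_Alexandroff_compactification
    by (intro disjI2 exI[of _ "{z}"] conjI)
qed

lemma openin_CP1_Some: "open V \<Longrightarrow> openin (top_of CP1) (Some ` V)"
  by (simp add: CP1_def)

lemma pt_CP1 [simp]: "pt CP1 = None" by (simp add: CP1_def)

lemma topspace_CP1 [simp]: "topspace (top_of CP1) = UNIV"
proof (rule Set.set_eqI)
  fix p show "p \<in> topspace (top_of CP1) \<longleftrightarrow> p \<in> UNIV" by (cases p) (auto simp: CP1_def)
qed

lemma coord_CP1 [simp]: "coord CP1 (Some z) = 1 / z" "coord CP1 None = 0"
  by (auto simp: CP1_def)

lemma mem_hol_CP1: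
  "f \<in> hol CP1 U \<longleftrightarrow> (\<lambda>z. f (Some z)) holomorphic_on {z. Some z \<in> U} \<and>
     (None \<in> U \<longrightarrow> (\<lambda>x. f (if x = 0 then None else Some (1 / x))) analytic_on {0})"
  by (simp add: CP1_def)

interpretation CP1: coordinate_curve CP1 "UNIV - {Some 0}"
proof
  fix U assume U: "openin (top_of CP1) U"
  have fin: "open {z. Some z \<in> U}" by (rule openin_CP1_finite_part[OF U])
  have "openin (top_of CP1) (Some ` {z. Some z \<in> U})" by (rule openin_CP1_Some[OF fin])
  moreover have "Some ` {z. Some z \<in> U} = U - {pt CP1}" 
  proof (rule Set.set_eqI)
    fix p show "p \<in> Some ` {z. Some z \<in> U} \<longleftrightarrow> p \<in> U - {pt CP1}" by (cases p) auto
  qed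
  ultimately show "openin (top_of CP1) (U - {pt CP1})" by simp
  show "g \<in> hol CP1 U" if f: "f \<in> hol CP1 U" and eq: "\<And>q. q \<in> U \<Longrightarrow> g q = f q" for f g
    unfolding mem_hol_CP1
  proof (intro conjI impI)
    show "(\<lambda>z. g (Some z)) holomorphic_on {z. Some z \<in> U}"
      by (rule holomorphic_transform[of "\<lambda>z. f (Some z)"]) (use f eq in \<open>auto simp: mem_hol_CP1\<close>)
    assume "None \<in> U"
    from openin_CP1_at_infinity[OF U this] obtain r where
      r: "r > 0" "\<forall>x. x \<noteq> 0 \<longrightarrow> cmod x < r \<longrightarrow> Some (1 / x) \<in> U" .
    have "\<forall>\<^sub>F x in nhds 0. x \<in> ball (0::complex) r" by (rule eventually_nhds_in_open) (use r in auto)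
    then have "\<forall>\<^sub>F x in nhds 0. g (if x = 0 then None else Some (1 / x)) = f (if x = 0 then None else Some (1 / x))"
      by eventually_elim (use eq r(2) \<open>None \<in> U\<close> in auto)
    from analytic_at_cong[OF this refl] show "(\<lambda>x. g (if x = 0 then None else Some (1 / x))) analytic_on {0}"
      using f \<open>None \<in> U\<close> by (simp add: mem_hol_CP1)
  qed
  show "f \<in> hol CP1 V" if "f \<in> hol CP1 U" "openin (top_of CP1) V" "V \<subseteq> U" for f V
    using that by (auto simp: mem_hol_CP1 elim: holomorphic_on_subset)
  show "(\<lambda>q. f q + g q) \<in> hol CP1 U" if "f \<in> hol CP1 U" "g \<in> hol CP1 U" for f g
    using that by (auto simp: mem_hol_CP1 intro!: holomorphic_intros analytic_intros)
  show "(\<lambda>q. f q * g q) \<in> hol CP1 U" if "f \<in> hol CP1 U" "g \<in> hol CP1 U" for f g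
    using that by (auto simp: mem_hol_CP1 intro!: holomorphic_intros analytic_intros)
next
  fix \<U> f assume a: "\<And>U. U \<in> \<U> \<Longrightarrow> openin (top_of CP1) U \<and> f \<in> hol CP1 U"
  have "(\<lambda>z. f (Some z)) holomorphic_on (\<Union>U\<in>\<U>. {z. Some z \<in> U})"
    by (rule holomorphic_on_UN_open) (use a in \<open>auto simp: mem_hol_CP1 openin_CP1_finite_part\<close>)
  moreover have "(\<Union>U\<in>\<U>. {z. Some z \<in> U}) = {z. Some z \<in> \<Union>\<U>}" by auto
  ultimately show "f \<in> hol CP1 (\<Union>\<U>)" using a by (auto simp: mem_hol_CP1)
next
  show "(\<lambda>_. c) \<in> hol CP1 U" for c U by (auto simp: mem_hol_CP1)
  show "openin (top_of CP1) (UNIV - {Some 0})" by (rule openin_CP1_delete)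
  have e: "(\<lambda>x. coord CP1 (if x = 0 then None else Some (1 / x))) = (\<lambda>x. x)" by auto
  show "coord CP1 \<in> hol CP1 (UNIV - {Some 0})"
    unfolding mem_hol_CP1 e by (auto intro!: holomorphic_intros)
  show "(\<lambda>q. inverse (coord CP1 q)) \<in> hol CP1 (UNIV - {Some 0} - {pt CP1})"
    by (auto simp: mem_hol_CP1 intro!: holomorphic_intros)
  fix q assume "q \<in> UNIV - {Some 0} - {pt CP1}"
  then show "coord CP1 q \<noteq> 0" by (cases q) auto
qed auto

lemma pt_disc [simp]: "pt (disc \<rho>) = 0" by (simp add: disc_def)
lemma openin_disc: "openin (top_of (disc \<rho>)) U \<longleftrightarrow> open U \<and> U \<subseteq> ball 0 \<rho>"
  by (auto simp: disc_def openin_open_eq)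
lemma topspace_disc [simp]: "topspace (top_of (disc \<rho>)) = ball 0 \<rho>"
  by (simp add: disc_def)
lemma hol_disc [simp]: "f \<in> hol (disc \<rho>) U \<longleftrightarrow> f holomorphic_on U" by (simp add: disc_def)
lemma coord_disc [simp]: "coord (disc \<rho>) = (\<lambda>u. u)" by (simp add: disc_def)

lemma coordinate_curve_disc:
  assumes "\<rho> > 0" shows "coordinate_curve (disc \<rho>) (ball 0 \<rho>)"
proof
  fix \<U> f assume a: "\<And>U. U \<in> \<U> \<Longrightarrow> openin (top_of (disc \<rho>)) U \<and> f \<in> hol (disc \<rho>) U"
  have "f holomorphic_on (\<Union>U\<in>\<U>. U)"
    by (rule holomorphic_on_UN_open) (use a in \<open>auto simp: openin_disc\<close>)
  then show "f \<in> hol (disc \<rho>) (\<Union>\<U>)" by simp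
next
  show "g \<in> hol (disc \<rho>) U" if "f \<in> hol (disc \<rho>) U" "\<And>q. q \<in> U \<Longrightarrow> g q = f q" for f g U
    using that holomorphic_transform[of f U g] by simp
qed (use assms in \<open>auto simp: openin_disc intro!: holomorphic_intros elim: holomorphic_on_subset\<close>)

section \<open>Holomorphic continuation of simple roots\<close>

text \<open>
  The Newton map with the derivative frozen at the base point is a contraction in \<open>w\<close>, uniformly in
  small \<open>u\<close>. Its iterates from the constant \<open>w0\<close> are holomorphic and converge uniformly to the
  fixed point, which is the root.
\<close>

lemma holomorphic_implicit_function:
  fixes F F' :: "complex \<Rightarrow> complex \<Rightarrow> complex"
  assumes cont: "continuous_on UNIV (\<lambda>p. F' (fst p) (snd p))"
    and deriv: "\<And>u w. (F u has_field_derivative F' u w) (at w)"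
    and holo: "\<And>f S. open S \<Longrightarrow> f holomorphic_on S \<Longrightarrow> (\<lambda>u. F u (f u)) holomorphic_on S"
    and root: "F 0 w0 = 0" and simple: "F' 0 w0 \<noteq> 0"
  shows "\<exists>\<rho>>0. \<exists>w. w holomorphic_on ball 0 \<rho> \<and> w 0 = w0 \<and> (\<forall>u\<in>ball 0 \<rho>. F u (w u) = 0)"
proof -
  define c where "c = F' 0 w0"
  \<comment> \<open>fixed points of \<open>T u\<close> are the roots of \<open>F u\<close>\<close>
  define T where "T u w = w - F u w / c" for u w
  have c: "c \<noteq> 0" using simple by (simp add: c_def)
  have "isCont (\<lambda>p. 1 - F' (fst p) (snd p) / c) (0, w0)"
    using cont by (intro continuous_intros) (auto simp: continuous_on_eq_continuous_at c)
  then obtain d where d: "d > 0" "\<forall>p. dist p (0, w0) < d \<longrightarrow>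
      dist (1 - F' (fst p) (snd p) / c) (1 - F' 0 w0 / c) < 1 / 2"
    unfolding continuous_at_eps_delta by (elim allE[of _ "1 / 2"]) auto
  \<comment> \<open>halving makes the product of the two discs of radius \<open>\<delta>\<close> fit into the ball of radius \<open>d\<close>\<close>
  define \<delta> where "\<delta> = d / 2"
  have \<delta>: "\<delta> > 0" using d by (simp add: \<delta>_def)
  have small: "cmod (1 - F' u w / c) \<le> 1 / 2" if "cmod u < \<delta>" "cmod (w - w0) \<le> \<delta>" for u w
  proof -
    have "dist (u, w) (0, w0) \<le> cmod u + cmod (w - w0)"
      using norm_Pair_le[of u "w - w0"] by (simp add: dist_norm)
    also have "\<dots> < d" using that by (simp add: \<delta>_def)
    finally show ?thesis using d(2)[rule_format, of "(u, w)"] c by (simp add: c_def dist_norm)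
  qed
  have "(\<lambda>u. F u w0) holomorphic_on UNIV" using holo[of UNIV "\<lambda>_. w0"] by auto
  then have "isCont (\<lambda>u. F u w0 / c) 0"
    using holomorphic_on_imp_continuous_on continuous_on_eq_continuous_at[of UNIV]
    by (intro continuous_intros) (use c in auto)
  then obtain d' where d': "d' > 0" "\<forall>u. dist u 0 < d' \<longrightarrow> dist (F u w0 / c) (F 0 w0 / c) < \<delta> / 2"
    unfolding continuous_at_eps_delta using \<delta> by (elim allE[of _ "\<delta> / 2"]) auto
  define \<rho> where "\<rho> = min \<delta> d'"
  have \<rho>: "\<rho> > 0" using \<delta> d' by (simp add: \<rho>_def)
  have Tderiv: "(T u has_field_derivative (1 - F' u w / c)) (at w)" for u w
    unfolding T_def[abs_def] by (auto intro!: derivative_eq_intros deriv c)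
  have contr: "dist (T u x) (T u y) \<le> 1 / 2 * dist x y"
    if "u \<in> ball 0 \<rho>" "x \<in> cball w0 \<delta>" "y \<in> cball w0 \<delta>" for u x y
  proof -
    have "cmod (T u x - T u y) \<le> 1 / 2 * cmod (x - y)"
    proof (rule field_differentiable_bound[of "cball w0 \<delta>"])
      show "(T u has_field_derivative (1 - F' u z / c)) (at z within cball w0 \<delta>)" for z
        by (rule has_field_derivative_at_within[OF Tderiv])
      show "cmod (1 - F' u z / c) \<le> 1 / 2" if "z \<in> cball w0 \<delta>" for z
        by (rule small) (use that \<open>u \<in> ball 0 \<rho>\<close> in \<open>auto simp: \<rho>_def dist_norm norm_minus_commute\<close>)
    qed (use that in auto)
    then show ?thesis by (simp add: dist_norm)
  qed
  have maps: "T u x \<in> cball w0 \<delta>" if u: "u \<in> ball 0 \<rho>" and x: "x \<in> cball w0 \<delta>" for u x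
  proof -
    have "dist w0 (T u w0) \<le> \<delta> / 2"
      using d'(2)[rule_format, of u] u root by (simp add: T_def dist_norm \<rho>_def)
    moreover have "dist (T u w0) (T u x) \<le> 1 / 2 * dist w0 x"
      by (rule contr[OF u]) (use x \<delta> in auto)
    moreover have "dist w0 x \<le> \<delta>" using x by simp
    ultimately show ?thesis using dist_triangle[of w0 "T u x" "T u w0"] by simp
  qed
  have ex: "\<exists>!x. x \<in> cball w0 \<delta> \<and> T u x = x" if u: "u \<in> ball 0 \<rho>" for u
    by (rule Banach_fix[of _ "1 / 2"]) (use maps[OF u] contr[OF u] \<delta> in \<open>auto simp: complete_eq_closed\<close>)
  define w where "w u = (THE x. x \<in> cball w0 \<delta> \<and> T u x = x)" for u
  have w: "w u \<in> cball w0 \<delta>" "T u (w u) = w u" if "u \<in> ball 0 \<rho>" for u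
    using theI'[OF ex[OF that]] by (auto simp: w_def)
  define f where "f n u = (T u ^^ n) w0" for n u
  have fS: "f (Suc n) u = T u (f n u)" for n u by (simp add: f_def)
  have fin: "f n u \<in> cball w0 \<delta>" if "u \<in> ball 0 \<rho>" for n u
    by (induction n) (use \<delta> maps[OF that] in \<open>auto simp: fS simp del: mem_cball, simp_all add: f_def\<close>)
  have fhol: "f n holomorphic_on ball 0 \<rho>" for n
  proof (induction n)
    case (Suc n)
    have "(\<lambda>u. f n u - F u (f n u) / c) holomorphic_on ball 0 \<rho>"
      by (intro holomorphic_intros holo Suc) (use c in auto)
    then show ?case by (simp add: fS[abs_def] T_def)
  qed (simp add: f_def[abs_def])
  have err: "dist (f n u) (w u) \<le> (1 / 2) ^ n * \<delta>" if u: "u \<in> ball 0 \<rho>" for n u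
  proof (induction n)
    case 0
    then show ?case using w(1)[OF u] by (simp add: f_def)
  next
    case (Suc n)
    have "dist (f (Suc n) u) (w u) \<le> 1 / 2 * dist (f n u) (w u)"
      using contr[OF u fin[OF u] w(1)[OF u]] w(2)[OF u] by (simp add: fS)
    then show ?case using Suc by simp
  qed
  have ul: "uniform_limit (ball 0 \<rho>) f w sequentially"
  proof (rule uniform_limitI)
    fix e :: real assume e: "e > 0"
    have "(\<lambda>n. (1 / 2 :: real) ^ n * \<delta>) \<longlonglongrightarrow> 0"
      by (intro tendsto_mult_left_zero LIMSEQ_realpow_zero) auto
    then have "\<forall>\<^sub>F n in sequentially. (1 / 2 :: real) ^ n * \<delta> < e" by (rule order_tendstoD(2)[OF _ e])
    then show "\<forall>\<^sub>F n in sequentially. \<forall>x\<in>ball 0 \<rho>. dist (f n x) (w x) < e"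
    proof eventually_elim
      case (elim n)
      show ?case
      proof
        fix u :: complex assume "u \<in> ball 0 \<rho>"
        from err[OF this, of n] elim show "dist (f n u) (w u) < e" by linarith
      qed
    qed
  qed
  have "w holomorphic_on ball 0 \<rho>"
  proof (rule holomorphic_uniform_sequence[of _ f])
    fix x :: complex assume "x \<in> ball 0 \<rho>"
    then have "\<exists>e>0. cball x e \<subseteq> ball 0 \<rho>" 
      by (rule iffD1[OF spec[OF open_contains_cball_eq[OF open_ball]]])
    then obtain e where e: "e > 0" "cball x e \<subseteq> ball 0 \<rho>" by auto
    show "\<exists>d>0. cball x d \<subseteq> ball 0 \<rho> \<and> uniform_limit (cball x d) f w sequentially"
      by (rule exI[of _ e]) (use e uniform_limit_on_subset[OF ul e(2)] in simp)
  qed (use fhol in auto)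
  moreover have "w 0 = w0"
  proof -
    have "w0 \<in> cball w0 \<delta> \<and> T 0 w0 = w0" using \<delta> root by (simp add: T_def)
    moreover have "(0::complex) \<in> ball 0 \<rho>" using \<rho> by simp
    ultimately show ?thesis unfolding w_def by (intro the1_equality ex)
  qed
  moreover have "F u (w u) = 0" if "u \<in> ball 0 \<rho>" for u
    using w(2)[OF that] c by (simp add: T_def)
  ultimately show ?thesis using \<rho> by blast
qed

text \<open>
  The roots of \<open>w ^ K = 1\<close> are simple, so each of them continues holomorphically. The distance to the
  unperturbed root has the order of the perturbation because \<open>w ^ K - w0 ^ K\<close> is \<open>w - w0\<close> times a function that
  does not vanish at the origin.
\<close>

lemma perturbed_unity_root:
  fixes h :: "nat \<Rightarrow> complex \<Rightarrow> complex"
  assumes h: "\<And>i. h i holomorphic_on UNIV" and w0: "w0 ^ K = 1" and K: "K \<ge> 1" and M: "M \<ge> 1"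
  shows "\<exists>\<rho>>0. \<exists>w g. w holomorphic_on ball 0 \<rho> \<and> g holomorphic_on ball 0 \<rho> \<and>
    (\<forall>u\<in>ball 0 \<rho>. w u ^ K - 1 + (\<Sum>i=2..K. u ^ M * h i u * w u ^ (K - i)) = 0 \<and> w u = w0 + u ^ M * g u)"
proof -
  have w0nz: "w0 \<noteq> 0" using w0 K by (auto simp: power_0_left)
  define F where "F u w = w ^ K - 1 + (\<Sum>i=2..K. u ^ M * h i u * w ^ (K - i))" for u w
  define F' where "F' u w = of_nat K * w ^ (K - 1) +
     (\<Sum>i=2..K. u ^ M * h i u * (of_nat (K - i) * w ^ (K - i - 1)))" for u w
  have hc: "continuous_on UNIV (h i)" for i using h holomorphic_on_imp_continuous_on by blast
  have "\<exists>\<rho>>0. \<exists>w. w holomorphic_on ball 0 \<rho> \<and> w 0 = w0 \<and> (\<forall>u\<in>ball 0 \<rho>. F u (w u) = 0)"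
  proof (rule holomorphic_implicit_function[where F' = F'])
    show "continuous_on UNIV (\<lambda>p. F' (fst p) (snd p))"
      unfolding F'_def by (intro continuous_intros continuous_on_compose2[OF hc]) auto
    show "(F u has_field_derivative F' u w) (at w)" for u w
      unfolding F_def[abs_def] F'_def by (auto intro!: derivative_eq_intros sum.cong simp: mult_ac)
    show "(\<lambda>u. F u (f u)) holomorphic_on S" if "open S" "f holomorphic_on S" for f S
      unfolding F_def by (intro holomorphic_intros that holomorphic_on_subset[OF h]) auto
    show "F 0 w0 = 0" using w0 M by (simp add: F_def power_0_left)
    show "F' 0 w0 \<noteq> 0" using w0nz K M by (simp add: F'_def power_0_left)
  qed
  then obtain \<rho> w where \<rho>: "\<rho> > 0" and w: "w holomorphic_on ball 0 \<rho>" "w 0 = w0"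
    and root: "\<forall>u\<in>ball 0 \<rho>. F u (w u) = 0" by blast
  \<comment> \<open>the cofactor of \<open>w - w0\<close> in \<open>w ^ K - w0 ^ K\<close>\<close>
  define S where "S u = (\<Sum>j<K. w0 ^ (K - Suc j) * w u ^ j)" for u
  have Shol: "S holomorphic_on ball 0 \<rho>" unfolding S_def[abs_def] by (intro holomorphic_intros w)
  have "S 0 = (\<Sum>j<K. w0 ^ (K - 1))"
    unfolding S_def w(2) by (intro sum.cong) (auto simp: power_add[symmetric])
  then have "S 0 \<noteq> 0" using w0nz K by simp
  moreover have "isCont S 0"
    using holomorphic_on_imp_continuous_on[OF Shol] \<rho> by (simp add: continuous_on_eq_continuous_at)
  ultimately obtain r where r: "r > 0" "\<forall>u. dist 0 u < r \<longrightarrow> S u \<noteq> 0"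
    using continuous_at_avoid[of 0 S 0] by auto
  define \<rho>' where "\<rho>' = min \<rho> r"
  have sub: "ball 0 \<rho>' \<subseteq> ball (0 :: complex) \<rho>" by (auto simp: \<rho>'_def)
  define g where "g u = - (\<Sum>i=2..K. h i u * w u ^ (K - i)) / S u" for u
  have "g holomorphic_on ball 0 \<rho>'" unfolding g_def[abs_def]
    by (intro holomorphic_intros holomorphic_on_subset[OF w(1) sub] holomorphic_on_subset[OF Shol sub]
        holomorphic_on_subset[OF h]) (use r in \<open>auto simp: \<rho>'_def\<close>)
  moreover have "w u = w0 + u ^ M * g u" if u: "u \<in> ball 0 \<rho>'" for u
  proof -
    have "F u (w u) = 0" using root sub u by blast
    then have "w u ^ K - w0 ^ K = - (\<Sum>i=2..K. u ^ M * h i u * w u ^ (K - i))"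
      unfolding F_def w0 by (simp add: eq_neg_iff_add_eq_0)
    moreover have "w u ^ K - w0 ^ K = (w u - w0) * S u"
      unfolding S_def by (rule power_diff_sumr2)
    moreover have "S u \<noteq> 0" using r(2)[rule_format, of u] u by (simp add: \<rho>'_def)
    ultimately have "w u - w0 = - (\<Sum>i=2..K. u ^ M * h i u * w u ^ (K - i)) / S u"
      by (simp add: field_simps)
    also have "\<dots> = u ^ M * g u" by (simp add: g_def sum_distrib_left mult.assoc)
    finally show ?thesis by (simp add: algebra_simps)
  qed
  moreover have "w holomorphic_on ball 0 \<rho>'" by (rule holomorphic_on_subset[OF w(1) sub])
  moreover have "\<rho>' > 0" using \<rho> r by (simp add: \<rho>'_def)
  ultimately show ?thesis using root sub unfolding F_def by blast
qed

section \<open>Characteristic polynomials of matrix functions\<close>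

lemma holomorphic_coeff_mult:
  fixes p q :: "complex \<Rightarrow> complex poly"
  assumes "\<And>k. (\<lambda>z. coeff (p z) k) holomorphic_on S" "\<And>k. (\<lambda>z. coeff (q z) k) holomorphic_on S"
  shows "(\<lambda>z. coeff (p z * q z) k) holomorphic_on S"
  unfolding coeff_mult by (intro holomorphic_intros assms)

lemma holomorphic_coeff_prod:
  fixes p :: "'i \<Rightarrow> complex \<Rightarrow> complex poly"
  assumes "\<And>i k. i \<in> I \<Longrightarrow> (\<lambda>z. coeff (p i z) k) holomorphic_on S"
  shows "(\<lambda>z. coeff (\<Prod>i\<in>I. p i z) k) holomorphic_on S"
  using assms
proof (induction I arbitrary: k rule: infinite_finite_induct)
  case (insert i I)
  then show ?case using holomorphic_coeff_mult[of "p i" S "\<lambda>z. \<Prod>i\<in>I. p i z" k] by simp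
qed auto

lemma holomorphic_coeff_det:
  fixes A :: "complex \<Rightarrow> complex poly mat"
  assumes "\<And>z. z \<in> S \<Longrightarrow> A z \<in> carrier_mat n n"
    and "\<And>i j k. i < n \<Longrightarrow> j < n \<Longrightarrow> (\<lambda>z. coeff (A z $$ (i, j)) k) holomorphic_on S"
  shows "(\<lambda>z. coeff (det (A z)) k) holomorphic_on S"
proof (rule holomorphic_transform)
  show "(\<lambda>z. \<Sum>p\<in>{p. p permutes {0..<n}}. of_int (sign p) *
      coeff (\<Prod>i=0..<n. A z $$ (i, p i)) k) holomorphic_on S"
  proof (intro holomorphic_intros holomorphic_coeff_prod assms)
    fix p i assume "p \<in> {p. p permutes {0..<n}}" "i \<in> {0..<n}"
    then show "p i < n" using permutes_in_image[of p "{0..<n}" i] by auto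
  qed auto
  fix z assume z: "z \<in> S"
  have *: "coeff (of_int c * q) k = of_int c * coeff q k" for c and q :: "complex poly"
    by (simp add: of_int_poly)
  show "(\<Sum>p\<in>{p. p permutes {0..<n}}. of_int (sign p) * coeff (\<Prod>i=0..<n. A z $$ (i, p i)) k)
      = coeff (det (A z)) k"
    unfolding det_def'[OF assms(1)[OF z]] by (simp add: coeff_sum *)
qed

lemma holomorphic_coeff_char_poly:
  fixes A :: "complex \<Rightarrow> complex mat"
  assumes "\<And>z. z \<in> S \<Longrightarrow> A z \<in> carrier_mat n n"
    and "\<And>i j. i < n \<Longrightarrow> j < n \<Longrightarrow> (\<lambda>z. A z $$ (i, j)) holomorphic_on S"
  shows "(\<lambda>z. coeff (char_poly (A z)) k) holomorphic_on S"
  unfolding char_poly_def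
proof (rule holomorphic_coeff_det)
  show "char_poly_matrix (A z) \<in> carrier_mat n n" if "z \<in> S" for z using assms(1)[OF that] by simp
  fix i j k assume ij: "i < n" "j < n"
  show "(\<lambda>z. coeff (char_poly_matrix (A z) $$ (i, j)) k) holomorphic_on S"
  proof (rule holomorphic_transform)
    show "(\<lambda>z. coeff (if i = j then [:0, 1:] else 0) k - (if k = 0 then A z $$ (i, j) else 0)) holomorphic_on S"
      by (cases "k = 0") (auto intro!: holomorphic_intros assms ij)
    fix z assume "z \<in> S"
    from assms(1)[OF this] ij
    show "coeff (if i = j then [:0, 1:] else 0) k - (if k = 0 then A z $$ (i, j) else 0) =
        coeff (char_poly_matrix (A z) $$ (i, j)) k"
      by (auto simp: char_poly_matrix_def coeff_pCons split: nat.split)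
  qed
qed

lemma holomorphic_det:
  fixes A :: "complex \<Rightarrow> complex mat"
  assumes "\<And>z. z \<in> S \<Longrightarrow> A z \<in> carrier_mat n n"
    and "\<And>i j. i < n \<Longrightarrow> j < n \<Longrightarrow> (\<lambda>z. A z $$ (i, j)) holomorphic_on S"
  shows "(\<lambda>z. det (A z)) holomorphic_on S"
proof (rule holomorphic_transform)
  show "(\<lambda>z. \<Sum>p\<in>{p. p permutes {0..<n}}. of_int (sign p) * (\<Prod>i=0..<n. A z $$ (i, p i))) holomorphic_on S"
  proof (intro holomorphic_intros assms)
    fix p i assume "p \<in> {p. p permutes {0..<n}}" "i \<in> {0..<n}"
    then show "p i < n" using permutes_in_image[of p "{0..<n}" i] by auto
  qed auto
qed (simp add: det_def'[OF assms(1)])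

text \<open>
  Cramer's rule expresses the inverse by determinants.
\<close>

lemma holomorphic_inverse_matrix:
  fixes A :: "complex \<Rightarrow> complex mat"
  assumes A: "\<And>z. z \<in> S \<Longrightarrow> A z \<in> carrier_mat n n"
    and hol: "\<And>i j. i < n \<Longrightarrow> j < n \<Longrightarrow> (\<lambda>z. A z $$ (i, j)) holomorphic_on S"
    and nz: "\<And>z. z \<in> S \<Longrightarrow> det (A z) \<noteq> 0"
  obtains B where "\<forall>z\<in>S. B z \<in> carrier_mat n n \<and> A z * B z = 1\<^sub>m n \<and> B z * A z = 1\<^sub>m n"
    "\<forall>i<n. \<forall>j<n. (\<lambda>z. B z $$ (i, j)) holomorphic_on S"
proof -
  define B where "B z = (1 / det (A z)) \<cdot>\<^sub>m adj_mat (A z)" for z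
  show thesis
  proof (rule that[of B])
    show "\<forall>z\<in>S. B z \<in> carrier_mat n n \<and> A z * B z = 1\<^sub>m n \<and> B z * A z = 1\<^sub>m n"
    proof
      fix z assume z: "z \<in> S"
      note adj = adj_mat[OF A[OF z]]
      have sc: "(1 / det (A z)) \<cdot>\<^sub>m (det (A z) \<cdot>\<^sub>m 1\<^sub>m n) = (1\<^sub>m n :: complex mat)"
        using nz[OF z] by (intro eq_matI) auto
      show "B z \<in> carrier_mat n n \<and> A z * B z = 1\<^sub>m n \<and> B z * A z = 1\<^sub>m n"
        unfolding B_def using adj A[OF z] sc
        by (simp add: mult_smult_distrib[OF A[OF z] adj(1)] mult_smult_assoc_mat[OF adj(1) A[OF z]])
    qed
    show "\<forall>i<n. \<forall>j<n. (\<lambda>z. B z $$ (i, j)) holomorphic_on S"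
    proof (intro allI impI)
      fix i j assume ij: "i < n" "j < n"
      have md: "(\<lambda>z. det (mat_delete (A z) j i)) holomorphic_on S"
      proof (rule holomorphic_det)
        show "mat_delete (A z) j i \<in> carrier_mat (n - 1) (n - 1)" if "z \<in> S" for z
          using A[OF that] by (simp add: mat_delete_def)
        fix a b assume ab: "a < n - 1" "b < n - 1"
        show "(\<lambda>z. mat_delete (A z) j i $$ (a, b)) holomorphic_on S"
        proof (rule holomorphic_transform)
          show "(\<lambda>z. A z $$ (if a < j then a else Suc a, if b < i then b else Suc b)) holomorphic_on S"
            by (rule hol) (use ab in auto)
          fix z assume "z \<in> S"
          from A[OF this] ab show "A z $$ (if a < j then a else Suc a, if b < i then b else Suc b) =
              mat_delete (A z) j i $$ (a, b)" by (simp add: mat_delete_def)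
        qed
      qed
      show "(\<lambda>z. B z $$ (i, j)) holomorphic_on S"
      proof (rule holomorphic_transform)
        show "(\<lambda>z. 1 / det (A z) * ((- 1) ^ (j + i) * det (mat_delete (A z) j i))) holomorphic_on S"
          by (intro holomorphic_intros md holomorphic_det[OF A hol] nz)
        fix z assume "z \<in> S"
        from A[OF this] ij
        show "1 / det (A z) * ((- 1) ^ (j + i) * det (mat_delete (A z) j i)) = B z $$ (i, j)"
          by (simp add: B_def adj_mat_def cofactor_def)
      qed
    qed
  qed
qed

text \<open>
  The coefficients stand in the last row, so that \<open>(1, y, ..., y ^ (n - 1))\<close> is an eigenvector for each root \<open>y\<close>.
\<close>

definition companion :: "nat \<Rightarrow> (nat \<Rightarrow> complex) \<Rightarrow> complex mat" where
  "companion n c = mat n n (\<lambda>(i, j). if i = n - 1 then - c j else if j = Suc i then 1 else 0)"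

lemma companion_carrier [simp]: "companion n c \<in> carrier_mat n n"
  by (simp add: companion_def)

text \<open>
  Expansion along the first column leaves two minors: a smaller companion matrix, and a lower triangular
  matrix with \<open>- 1\<close> on the diagonal whose determinant cancels the sign of the cofactor.
\<close>

lemma char_poly_companion:
  assumes "n \<ge> 1"
  shows "char_poly (companion n c) = monom 1 n + (\<Sum>j<n. monom (c j) j)"
  using assms
proof (induction n arbitrary: c rule: nat_induct_at_least)
  case base
  have "char_poly_matrix (companion 1 c) \<in> carrier_mat 1 1" by simp
  from det_single[OF this] show ?case
    by (simp add: char_poly_def char_poly_matrix_def companion_def monom_0 monom_Suc)
next
  case (Suc n)
  let ?B = "char_poly_matrix (companion (Suc n) c)"
  have B: "?B \<in> carrier_mat (Suc n) (Suc n)" by simp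
  have ent: "?B $$ (i, j) = (if i = j then [:0, 1:] else 0) +
      (if i = n then [:c j:] else if j = Suc i then - 1 else 0)" if "i \<le> n" "j \<le> n" for i j
    using that by (auto simp: char_poly_matrix_def companion_def one_pCons)
  have m0: "mat_delete ?B 0 0 = char_poly_matrix (companion n (\<lambda>j. c (Suc j)))"
    using Suc(1) by (intro eq_matI) (auto simp: mat_delete_def char_poly_matrix_def companion_def)
  have mn: "det (mat_delete ?B n 0) = (- 1) ^ n"
  proof -
    have car: "mat_delete ?B n 0 \<in> carrier_mat n n"
      using mat_delete_carrier[OF B, of n 0] by simp
    have e: "mat_delete ?B n 0 $$ (i, j) = ?B $$ (i, Suc j)" if "i < n" "j < n" for i j
      using that carrier_matD[OF B] by (simp add: mat_delete_def)
    have "det (mat_delete ?B n 0) = prod_list (diag_mat (mat_delete ?B n 0))"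
      by (rule det_lower_triangular[OF _ car]) (simp add: e ent)
    also have "diag_mat (mat_delete ?B n 0) = replicate n (- 1)"
      using car by (intro nth_equalityI) (auto simp: diag_mat_def e ent)
    finally show ?thesis by (simp add: prod_list_replicate)
  qed
  have "char_poly (companion (Suc n) c) = (\<Sum>i<Suc n. ?B $$ (i, 0) * cofactor ?B i 0)"
    unfolding char_poly_def by (rule laplace_expansion_column[OF B]) simp
  also have "\<dots> = (\<Sum>i\<in>{0, n}. ?B $$ (i, 0) * cofactor ?B i 0)"
    by (rule sum.mono_neutral_right) (auto simp: ent)
  also have "\<dots> = ?B $$ (0, 0) * cofactor ?B 0 0 + ?B $$ (n, 0) * cofactor ?B n 0"
    using Suc(1) by simp
  also have "\<dots> = [:0, 1:] * char_poly (companion n (\<lambda>j. c (Suc j))) + [:c 0:]"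
    using Suc(1) by (simp add: ent cofactor_def m0 mn char_poly_def power_mult_distrib[symmetric])
  also have "\<dots> = monom 1 (Suc n) + (\<Sum>j<Suc n. monom (c j) j)"
  proof -
    have X: "[:0, 1:] * monom a j = monom a (Suc j)" for a :: complex and j
      by (simp add: monom_Suc)
    show ?thesis
      unfolding Suc(2) sum.lessThan_Suc_shift distrib_left sum_distrib_left X by (simp add: monom_0)
  qed
  finally show ?case .
qed

lemma companion_eigenvector:
  assumes "n \<ge> 1" "y ^ n + (\<Sum>j<n. c j * y ^ j) = 0"
  shows "companion n c *\<^sub>v Matrix.vec n (\<lambda>j. y ^ j) = y \<cdot>\<^sub>v Matrix.vec n (\<lambda>j. y ^ j)"
proof (rule eq_vecI)
  fix i assume "i < dim_vec (y \<cdot>\<^sub>v Matrix.vec n (\<lambda>j. y ^ j))"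
  then have i: "i < n" by simp
  have "(companion n c *\<^sub>v Matrix.vec n (\<lambda>j. y ^ j)) $ i =
      (\<Sum>j<n. (if i = n - 1 then - c j else if j = Suc i then 1 else 0) * y ^ j)"
    using i by (simp add: companion_def scalar_prod_def atLeast0LessThan)
  also have "\<dots> = y * y ^ i"
  proof (cases "i = n - 1")
    case True
    then have "(\<Sum>j<n. (if i = n - 1 then - c j else if j = Suc i then 1 else 0) * y ^ j)
      = - (\<Sum>j<n. c j * y ^ j)" by (simp add: sum_negf)
    also have "\<dots> = y ^ n" using assms(2) by (simp add: add_eq_0_iff)
    also have "\<dots> = y * y ^ i" using True i by (simp add: power_Suc[symmetric] del: power_Suc)
    finally show ?thesis .
  next
    case False
    then have "(\<Sum>j<n. (if i = n - 1 then - c j else if j = Suc i then 1 else 0) * y ^ j)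
      = (\<Sum>j<n. if j = Suc i then y ^ j else 0)" by (intro sum.cong) auto
    also have "\<dots> = y ^ Suc i" using False i by simp
    finally show ?thesis by simp
  qed
  finally show "(companion n c *\<^sub>v Matrix.vec n (\<lambda>j. y ^ j)) $ i = (y \<cdot>\<^sub>v Matrix.vec n (\<lambda>j. y ^ j)) $ i"
    using i by simp
qed (simp add: companion_def)

lemma poly_eq_0_of_many_roots:
  fixes p :: "complex poly"
  assumes "inj_on y {..<n}" "\<And>r. r < n \<Longrightarrow> poly p (y r) = 0" "\<And>k. k \<ge> n \<Longrightarrow> coeff p k = 0"
  shows "p = 0"
proof (rule ccontr)
  assume p: "p \<noteq> 0"
  have "n = card (y ` {..<n})" using card_image[OF assms(1)] by simp
  also have "\<dots> \<le> card {x. poly p x = 0}"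
    by (rule card_mono) (use assms(2) poly_roots_finite[OF p] in auto)
  also have "\<dots> \<le> degree p" by (rule card_poly_roots_bound[OF p])
  finally have "coeff p (degree p) = 0" by (rule assms(3))
  then show False using p by simp
qed

text \<open>
  A vector in the kernel of the transposed matrix is the coefficient list of a polynomial of degree less than \<open>n\<close>
  with \<open>n\<close> distinct roots.
\<close>

lemma det_vandermonde_nonzero:
  fixes y :: "nat \<Rightarrow> complex"
  assumes "inj_on y {..<n}"
  shows "det (mat n n (\<lambda>(j, r). y r ^ j)) \<noteq> 0"
proof
  let ?V = "mat n n (\<lambda>(j, r). y r ^ j)"
  assume "det ?V = 0"
  then have "det (transpose_mat ?V) = 0" using det_transpose[of ?V n] by simp
  then obtain v where v: "v \<in> carrier_vec n" "v \<noteq> 0\<^sub>v n" "transpose_mat ?V *\<^sub>v v = 0\<^sub>v n"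
    using det_0_iff_vec_prod_zero_field[of "transpose_mat ?V" n] by auto
  define p where "p = (\<Sum>j<n. monom (v $ j) j)"
  have cp: "coeff p k = (if k < n then v $ k else 0)" for k
    unfolding p_def by (simp add: coeff_sum)
  have root: "poly p (y r) = 0" if "r < n" for r
  proof -
    have "(transpose_mat ?V *\<^sub>v v) $ r = (\<Sum>j<n. y r ^ j * v $ j)"
      using that v(1) by (simp add: scalar_prod_def atLeast0LessThan)
    then have "(\<Sum>j<n. y r ^ j * v $ j) = 0" using v(3) that by simp
    then show ?thesis unfolding p_def poly_sum poly_monom by (simp add: mult.commute)
  qed
  have "p = 0" by (rule poly_eq_0_of_many_roots[OF assms root]) (simp_all add: cp)
  then have "v $ k = 0" if "k < n" for k using cp[of k] that by simp
  then have "v = 0\<^sub>v n" using v(1) by (intro eq_vecI) auto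
  then show False using v(2) by simp
qed

text \<open>
  The form in which similarity arises here: as a change of frame \<open>P\<close> that intertwines two matrices.
\<close>

lemma char_poly_intertwined:
  fixes A B P :: "complex mat"
  assumes A: "A \<in> carrier_mat n n" and B: "B \<in> carrier_mat n n"
    and P: "P \<in> carrier_mat n n" "det P \<noteq> 0" and AP: "A * P = P * B"
  shows "char_poly A = char_poly B"
proof -
  define Q where "Q = (1 / det P) \<cdot>\<^sub>m adj_mat P"
  note adj = adj_mat[OF P(1)]
  have Q: "Q \<in> carrier_mat n n" using adj by (simp add: Q_def)
  have "(1 / det P) \<cdot>\<^sub>m (det P \<cdot>\<^sub>m 1\<^sub>m n) = (1\<^sub>m n :: complex mat)"
    using P(2) by (intro eq_matI) auto
  then have PQ: "P * Q = 1\<^sub>m n" "Q * P = 1\<^sub>m n"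
    unfolding Q_def using adj P
    by (simp_all add: mult_smult_distrib[OF P(1) adj(1)] mult_smult_assoc_mat[OF adj(1) P(1)])
  have "P * B * Q = A * P * Q" using AP by simp
  also have "\<dots> = A" using A P(1) Q PQ by (simp add: assoc_mult_mat[OF A P(1) Q])
  finally have Aeq: "A = P * B * Q" ..
  have "similar_mat_wit A B P Q"
    unfolding similar_mat_wit_def Let_def carrier_matD(1)[OF A]
  proof (intro conjI PQ)
    show "{A, B, P, Q} \<subseteq> carrier_mat n n" using A P(1) Q B by simp
    show "A = P * B * Q" by (rule Aeq)
  qed
  then have "similar_mat A B" unfolding similar_mat_def by (intro exI)
  then show ?thesis by (rule char_poly_similar)
qed

lemma char_poly_of_eigenbasis:
  fixes A P :: "complex mat" and y :: "nat \<Rightarrow> complex"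
  assumes A: "A \<in> carrier_mat n n" and P: "P \<in> carrier_mat n n" "det P \<noteq> 0"
    and eig: "\<And>r. r < n \<Longrightarrow> A *\<^sub>v col P r = y r \<cdot>\<^sub>v col P r"
  shows "char_poly A = (\<Prod>r<n. [:- y r, 1:])"
proof -
  let ?D = "mat n n (\<lambda>(i, j). if i = j then y i else 0)"
  have D: "?D \<in> carrier_mat n n" by simp
  have AP: "A * P = P * ?D"
  proof (rule eq_matI)
    fix i r assume "i < dim_row (P * ?D)" "r < dim_col (P * ?D)"
    then have ir: "i < n" "r < n" using P by auto
    have "(A * P) $$ (i, r) = (A *\<^sub>v col P r) $ i" using ir A P by simp
    also have "\<dots> = y r * P $$ (i, r)" using eig[OF ir(2)] ir P by simp
    also have "\<dots> = (\<Sum>j<n. P $$ (i, j) * (if j = r then y j else 0))" using ir by (simp add: if_distrib mult.commute cong: if_cong)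
    also have "\<dots> = (P * ?D) $$ (i, r)" using ir P by (auto simp: scalar_prod_def atLeast0LessThan intro!: sum.cong)
    finally show "(A * P) $$ (i, r) = (P * ?D) $$ (i, r)" .
  qed (use A P in auto)
  have "char_poly A = char_poly ?D" by (rule char_poly_intertwined[OF A D P AP])
  also have "\<dots> = (\<Prod>a\<leftarrow>diag_mat ?D. [:- a, 1:])"
    by (rule char_poly_upper_triangular[OF D]) auto
  also have "\<dots> = (\<Prod>r<n. [:- y r, 1:])"
  proof -
    have "map (\<lambda>a. [:- a, 1:]) (diag_mat ?D) = map (\<lambda>r. [:- y r, 1:]) [0..<n]"
      by (simp add: diag_mat_def)
    then have "(\<Prod>a\<leftarrow>diag_mat ?D. [:- a, 1:]) = prod_list (map (\<lambda>r. [:- y r, 1:]) [0..<n])"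
      by simp
    then show ?thesis
      by (simp add: prod.distinct_set_conv_list[symmetric] atLeast0LessThan)
  qed
  finally show ?thesis .
qed

section \<open>Coefficients as functions of the roots, and growth\<close>

text \<open>
  The leading coefficients of the eigenvalues in \<^const>\<open>irregular_part\<close>, indexed as there by \<open>{1..K}\<close>.
\<close>

definition unity_root :: "nat \<Rightarrow> nat \<Rightarrow> complex" where
  "unity_root K r = exp (2 * of_real pi * \<i> * of_nat r / of_nat K)"

lemma unity_root_power: "K \<ge> 1 \<Longrightarrow> unity_root K r ^ K = 1"
proof -
  assume K: "K \<ge> 1"
  have "unity_root K r ^ K = exp (of_nat K * (2 * of_real pi * \<i> * of_nat r / of_nat K))"
    unfolding unity_root_def by (rule exp_of_nat_mult[symmetric])
  also have "of_nat K * (2 * of_real pi * \<i> * of_nat r / of_nat K) = 2 * of_real pi * \<i> * of_nat r"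
    using K by simp
  also have "exp \<dots> = 1" using complex_root_unity_eq_1[of 1 r] by simp
  finally show ?thesis .
qed

lemma inj_unity_root: "K \<ge> 1 \<Longrightarrow> inj_on (\<lambda>r. unity_root K (Suc r)) {..<K}"
proof (rule inj_onI)
  fix r s assume K: "K \<ge> 1" and rs: "r \<in> {..<K}" "s \<in> {..<K}" "unity_root K (Suc r) = unity_root K (Suc s)"
  then have "Suc r mod K = Suc s mod K"
    unfolding unity_root_def using complex_root_unity_eq[OF K] by blast
  then show "r = s" using rs(1,2) by (auto simp: mod_Suc split: if_splits)
qed

lemma prod_unity_roots:
  assumes K: "K \<ge> 1"
  shows "(\<Prod>r<K. [:- unity_root K (Suc r), 1:]) = monom 1 K - 1"
proof -
  let ?P = "\<Prod>r<K. [:- unity_root K (Suc r), 1:]"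
  have deg: "degree ?P = K" by (subst degree_prod_eq_sum_degree) auto
  have lc: "lead_coeff ?P = 1" by (subst lead_coeff_prod) auto
  have "?P - (monom 1 K - 1) = 0"
  proof (rule poly_eq_0_of_many_roots[OF inj_unity_root[OF K]])
    show "poly (?P - (monom 1 K - 1)) (unity_root K (Suc r)) = 0" if "r < K" for r
      using that unity_root_power[OF K] by (auto simp: poly_prod poly_monom)
    fix k assume "k \<ge> K"
    then show "coeff (?P - (monom 1 K - 1)) k = 0"
      using deg lc K by (cases "k = K") (auto simp: coeff_eq_0)
  qed
  then show ?thesis by simp
qed

lemma coeff_linear_mult:
  "coeff ([:- a, 1:] * q) k = (if k = 0 then 0 else coeff q (k - 1)) - (a :: complex) * coeff q k"
  by (cases k) (simp_all add: coeff_pCons)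

text \<open>
  The coefficient at \<open>k\<close> is homogeneous of degree \<open>card I - k\<close> in the roots. The equation is stated without
  division, so that it also covers \<open>c = 0\<close>.
\<close>

lemma coeff_prod_scaled_roots:
  fixes c :: complex and y :: "'i \<Rightarrow> complex"
  assumes "finite I"
  shows "c ^ k * coeff (\<Prod>r\<in>I. [:- (c * y r), 1:]) k = c ^ card I * coeff (\<Prod>r\<in>I. [:- y r, 1:]) k"
  using assms
proof (induction I arbitrary: k rule: finite_induct)
  case empty
  then show ?case by (cases k) auto
next
  case (insert i I)
  define p where "p = (\<Prod>r\<in>I. [:- (c * y r), 1:])"
  define q where "q = (\<Prod>r\<in>I. [:- y r, 1:])"
  have IH: "c ^ k * coeff p k = c ^ card I * coeff q k" for k using insert.IH by (simp add: p_def q_def)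
  have "c ^ k * coeff ([:- (c * y i), 1:] * p) k = c ^ Suc (card I) * coeff ([:- y i, 1:] * q) k"
  proof (cases k)
    case 0
    then show ?thesis using IH[of 0] unfolding coeff_linear_mult by simp
  next
    case (Suc k')
    have "c ^ k * coeff ([:- (c * y i), 1:] * p) k
       = c * (c ^ k' * coeff p k') - c * y i * (c ^ k * coeff p k)"
      unfolding coeff_linear_mult Suc by (simp add: algebra_simps)
    also have "\<dots> = c ^ Suc (card I) * coeff ([:- y i, 1:] * q) k"
      unfolding IH coeff_linear_mult Suc by (simp add: algebra_simps)
    finally show ?thesis .
  qed
  then show ?case using insert.hyps by (simp add: p_def q_def)
qed

text \<open>
  Coefficients are polynomial in the roots, so moving the roots by multiples of \<open>u ^ M\<close> moves the coefficients by
  multiples of \<open>u ^ M\<close>.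
\<close>

lemma coeff_prod_perturbed_roots:
  fixes b :: "'i \<Rightarrow> complex \<Rightarrow> complex" and a :: "'i \<Rightarrow> complex"
  assumes "finite I" "\<And>r. r \<in> I \<Longrightarrow> b r holomorphic_on S"
  shows "\<exists>g. g holomorphic_on S \<and> (\<forall>u\<in>S. coeff (\<Prod>r\<in>I. [:- (a r + u ^ M * b r u), 1:]) k =
     coeff (\<Prod>r\<in>I. [:- a r, 1:]) k + u ^ M * g u)"
  using assms
proof (induction I arbitrary: k rule: finite_induct)
  case empty
  show ?case by (rule exI[of _ "\<lambda>_. 0"]) simp
next
  case (insert i I)
  define p where "p u = (\<Prod>r\<in>I. [:- (a r + u ^ M * b r u), 1:])" for u
  define q where "q = (\<Prod>r\<in>I. [:- a r, 1:])"
  have "\<exists>g. g holomorphic_on S \<and> (\<forall>u\<in>S. coeff (p u) k = coeff q k + u ^ M * g u)" for k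
    using insert by (simp add: p_def q_def)
  from this[of k] obtain g where "g holomorphic_on S \<and> (\<forall>u\<in>S. coeff (p u) k = coeff q k + u ^ M * g u)" ..
  then have g: "g holomorphic_on S" "\<forall>u\<in>S. coeff (p u) k = coeff q k + u ^ M * g u" by simp_all
  obtain g' where g': "g' holomorphic_on S"
    "\<forall>u\<in>S. (if k = 0 then 0 else coeff (p u) (k - 1)) = (if k = 0 then 0 else coeff q (k - 1)) + u ^ M * g' u"
  proof (cases "k = 0")
    case True
    then show ?thesis by (intro that[of "\<lambda>_. 0"]) auto
  next
    case False
    have "\<exists>g. g holomorphic_on S \<and> (\<forall>u\<in>S. coeff (p u) (k - 1) = coeff q (k - 1) + u ^ M * g u)"
      using insert by (simp add: p_def q_def)
    then obtain g' where "g' holomorphic_on S \<and>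
        (\<forall>u\<in>S. coeff (p u) (k - 1) = coeff q (k - 1) + u ^ M * g' u)" ..
    then show ?thesis using False by (intro that[of g']) simp_all
  qed
  define h where "h u = g' u - a i * g u - b i u * (coeff q k + u ^ M * g u)" for u
  have "h holomorphic_on S" unfolding h_def[abs_def]
    by (intro holomorphic_intros g g' insert.prems) simp
  moreover have "coeff ([:- (a i + u ^ M * b i u), 1:] * p u) k = coeff ([:- a i, 1:] * q) k + u ^ M * h u"
    if u: "u \<in> S" for u
    unfolding coeff_linear_mult bspec[OF g(2) u] bspec[OF g'(2) u] h_def by (simp add: algebra_simps)
  ultimately show ?case using insert.hyps by (intro exI[of _ h]) (simp add: p_def q_def)
qed

text \<open>
  An entire function of polynomial growth is a polynomial by Liouville's theorem. The sharp bound on its degree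
  comes from comparing the leading coefficient, which is the value at \<open>u = 0\<close> of the reflected polynomial in \<open>u ^ m\<close>, with
  the order of vanishing of \<open>u powi e * g u\<close>.
\<close>

lemma entire_of_polynomial_growth:
  fixes f g :: "complex \<Rightarrow> complex" and e :: int
  assumes f: "f holomorphic_on UNIV" and m: "m \<ge> 1" and \<epsilon>: "\<epsilon> > 0" and g: "g holomorphic_on ball 0 \<epsilon>"
    and eq: "\<And>u. u \<in> ball 0 \<epsilon> - {0} \<Longrightarrow> f (1 / u ^ m) = u powi e * g u"
  obtains p where "f = poly p" "p = 0 \<or> int m * int (degree p) \<le> - e"
proof -
  define \<delta> where "\<delta> = min (\<epsilon> / 2) 1"
  have \<delta>: "\<delta> > 0" "\<delta> \<le> 1" "\<delta> < \<epsilon>" using \<epsilon> by (auto simp: \<delta>_def)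
  have "compact (g ` cball 0 \<delta>)"
    by (intro compact_continuous_image holomorphic_on_imp_continuous_on holomorphic_on_subset[OF g])
      (use \<delta> in auto)
  then obtain B where B: "B > 0" "\<forall>u\<in>cball 0 \<delta>. cmod (g u) \<le> B"
    using compact_imp_bounded[of "g ` cball 0 \<delta>"] unfolding bounded_pos by auto
  define n where "n = nat (- e)"
  have bound: "cmod (f z) \<le> B * cmod z ^ n" if z: "(1 / \<delta>) ^ m \<le> cmod z" for z
  proof -
    have zp: "cmod z > 0" 
      by (rule less_le_trans[OF _ z]) (use \<delta> in simp)
    then have z0: "z \<noteq> 0" by auto
    \<comment> \<open>a preimage of \<open>z\<close> under the covering \<open>u \<mapsto> 1 / u ^ m\<close>\<close>
    define u where "u = inverse (z powr (1 / of_nat m))"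
    have "(z powr (1 / of_nat m)) ^ m = z"
      using z0 m by (simp add: powr_power)
    then have um': "u ^ m = 1 / z"
      unfolding u_def power_inverse by (simp only: inverse_eq_divide)
    then have um: "1 / u ^ m = z" by simp
    have u0: "u \<noteq> 0" using z0 by (auto simp: u_def)
    have cu: "cmod u ^ m = 1 / cmod z" 
      using um' by (simp add: norm_power[symmetric] norm_divide)
    also have "\<dots> \<le> \<delta> ^ m" using z zp \<delta> by (simp add: field_simps power_divide)
    finally have "cmod u ^ m \<le> \<delta> ^ m" .
    then have ud: "cmod u \<le> \<delta>" using \<delta> m by (subst (asm) power_mono_iff) auto
    have "cmod (f z) = cmod u powi e * cmod (g u)"
      using eq[of u] um u0 ud \<delta> by (simp add: norm_mult norm_power_int)
    also have "\<dots> \<le> cmod u powi e * B"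
      by (intro mult_left_mono) (use B ud in auto)
    also have "cmod u powi e \<le> cmod z ^ n"
    proof -
      have "cmod u powi e \<le> cmod u powi (- int (m * n))"
      proof (rule power_int_decreasing)
        have "- e \<le> int n" by (simp add: n_def)
        also have "int n \<le> int (m * n)" unfolding of_nat_le_iff using m by simp
        finally show "- int (m * n) \<le> e" by simp
      qed (use ud \<delta> u0 in auto)
      also have "\<dots> = inverse ((cmod u ^ m) ^ n)"
        unfolding power_int_minus power_int_of_nat power_mult ..
      also have "\<dots> = cmod z ^ n" unfolding cu by (simp add: power_divide)
      finally show ?thesis .
    qed
    finally show ?thesis using B(1) by (simp add: mult.commute mult_right_mono)
  qed
  define p where "p = (\<Sum>k\<le>n. monom ((deriv ^^ k) f 0 / fact k) k)"
  have fp: "f = poly p"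
  proof
    fix z show "f z = poly p z"
      using Liouville_polynomial[OF f bound, where \<xi> = z] by (simp add: p_def poly_sum poly_monom)
  qed
  have "int m * int (degree p) \<le> - e" if p: "p \<noteq> 0"
  proof (rule ccontr)
    assume "\<not> int m * int (degree p) \<le> - e"
    then have pos: "int m * int (degree p) + e \<ge> 1" by simp
    define N where "N = nat (int m * int (degree p) + e)"
    have N: "int N = int m * int (degree p) + e" "N \<ge> 1" using pos by (auto simp: N_def)
    have ev: "poly (reflect_poly p) (u ^ m) = u ^ N * g u" if "u \<in> ball 0 \<epsilon> - {0}" for u
    proof -
      have u0: "u \<noteq> 0" using that by auto
      have "poly (reflect_poly p) (u ^ m) = (u ^ m) ^ degree p * poly p (1 / u ^ m)"
        using poly_reflect_poly_nz[of "u ^ m" p] u0 by (simp add: inverse_eq_divide)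
      also have "\<dots> = u powi (int m * int (degree p)) * (u powi e * g u)"
        using eq[OF that] unfolding fp by (simp add: power_mult[symmetric] flip: of_nat_mult)
      also have "\<dots> = u powi (int N) * g u"
        unfolding N(1) using u0 by (simp add: power_int_add)
      finally show ?thesis by simp
    qed
    have "((\<lambda>u. u ^ N * g u) \<longlongrightarrow> 0 ^ N * g 0) (at 0)"
    proof -
      have "isCont g 0" using holomorphic_on_imp_continuous_on[OF g] \<epsilon> by (simp add: continuous_on_eq_continuous_at)
      then show ?thesis by (intro tendsto_intros) (auto simp: isCont_def)
    qed
    then have "((\<lambda>u. poly (reflect_poly p) (u ^ m)) \<longlongrightarrow> 0 ^ N * g 0) (at 0)"
    proof (rule Lim_transform_eventually)
      have "\<forall>\<^sub>F u in at 0. u \<in> ball 0 \<epsilon> - {0}"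
        using \<epsilon> by (intro eventually_at_in_open) auto
      then show "\<forall>\<^sub>F u in at 0. u ^ N * g u = poly (reflect_poly p) (u ^ m)"
        by eventually_elim (simp add: ev)
    qed
    moreover have "((\<lambda>u. poly (reflect_poly p) (u ^ m)) \<longlongrightarrow> poly (reflect_poly p) (0 ^ m)) (at 0)"
      by (intro tendsto_intros)
    ultimately have "poly (reflect_poly p) (0 ^ m) = 0 ^ N * g 0"
      by (rule tendsto_unique[OF trivial_limit_at, rotated])
    then have "lead_coeff p = 0" using m N(2) by (simp add: power_0_left)
    then show False using p by simp
  qed
  then show thesis using that fp by blast
qed

section \<open>The characteristic polynomial on the affine line\<close>

lemma locally_freeE:
  assumes "locally_free X R d m S" "p \<in> topspace (top_of X)"
  obtains U e where "openin (top_of X) U" "p \<in> U"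
    "\<forall>q\<in>U - {pt X}. e q \<in> carrier_mat d m"
    "\<forall>q\<in>U - {pt X}. \<forall>c\<in>carrier_vec m. e q *\<^sub>v c = 0\<^sub>v d \<longrightarrow> c = 0\<^sub>v m"
    "\<forall>V. openin (top_of X) V \<longrightarrow> V \<subseteq> U \<longrightarrow> S V = frame_span X m e (\<lambda>_. R) V"
proof -
  have "\<exists>U e. openin (top_of X) U \<and> p \<in> U \<and>
        (\<forall>q\<in>U - {pt X}. e q \<in> carrier_mat d m \<and>
           (\<forall>c\<in>carrier_vec m. e q *\<^sub>v c = 0\<^sub>v d \<longrightarrow> c = 0\<^sub>v m)) \<and>
        (\<forall>V. openin (top_of X) V \<longrightarrow> V \<subseteq> U \<longrightarrow> S V = frame_span X m e (\<lambda>_. R) V)"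
    using assms unfolding locally_free_def frame_span_def by simp
  then obtain U where "\<exists>e. openin (top_of X) U \<and> p \<in> U \<and>
        (\<forall>q\<in>U - {pt X}. e q \<in> carrier_mat d m \<and>
           (\<forall>c\<in>carrier_vec m. e q *\<^sub>v c = 0\<^sub>v d \<longrightarrow> c = 0\<^sub>v m)) \<and>
        (\<forall>V. openin (top_of X) V \<longrightarrow> V \<subseteq> U \<longrightarrow> S V = frame_span X m e (\<lambda>_. R) V)" ..
  then obtain e where e: "openin (top_of X) U \<and> p \<in> U \<and>
        (\<forall>q\<in>U - {pt X}. e q \<in> carrier_mat d m \<and>
           (\<forall>c\<in>carrier_vec m. e q *\<^sub>v c = 0\<^sub>v d \<longrightarrow> c = 0\<^sub>v m)) \<and>
        (\<forall>V. openin (top_of X) V \<longrightarrow> V \<subseteq> U \<longrightarrow> S V = frame_span X m e (\<lambda>_. R) V)" ..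
  show thesis by (rule that[of U e]) (use e in simp_all)
qed

lemma det_nonzero_of_injective:
  fixes A :: "complex mat"
  assumes "A \<in> carrier_mat n n" "\<forall>c\<in>carrier_vec n. A *\<^sub>v c = 0\<^sub>v n \<longrightarrow> c = 0\<^sub>v n"
  shows "det A \<noteq> 0"
  using det_0_iff_vec_prod_zero_field[OF assms(1)] assms(2) by blast

lemma unit_vec_eq_vec: "unit_vec n j = Matrix.vec n (\<lambda>i. if i = j then 1 else 0)"
  by (simp add: unit_vec_def)

lemma mat_eq_of_unit_columns:
  fixes A B :: "complex mat"
  assumes "A \<in> carrier_mat n m" "B \<in> carrier_mat n m"
    "\<And>j. j < m \<Longrightarrow> A *\<^sub>v unit_vec m j = B *\<^sub>v unit_vec m j"
  shows "A = B"
proof (rule eq_matI)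
  fix i j assume ij: "i < dim_row B" "j < dim_col B"
  have *: "(M *\<^sub>v unit_vec m j) $ i = M $$ (i, j)" if "M \<in> carrier_mat n m" for M :: "complex mat"
    using that ij assms(2) by (auto simp: scalar_prod_def unit_vec_def if_distrib cong: if_cong)
  have "(A *\<^sub>v unit_vec m j) $ i = (B *\<^sub>v unit_vec m j) $ i" using ij assms by simp
  then show "A $$ (i, j) = B $$ (i, j)" unfolding *[OF assms(1)] *[OF assms(2)] .
qed (use assms in auto)

lemma open_CP1_remove_infinity:
  assumes "openin (top_of CP1) U" shows "openin (top_of CP1) (U - {None})"
  using CP1.open_del[OF assms] by simp

text \<open>
  The entries of an endomorphism need not be holomorphic in the given fibre coordinates. In a local frame they
  are, and a change of frame does not affect the characteristic polynomial.
\<close>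

lemma char_higgs_entire:
  assumes lf: "locally_free CP1 (mero CP1) K K S"
    and car: "\<And>z. A (Some z) \<in> carrier_mat K K"
    and pres: "\<And>U s. openin (top_of CP1) U \<Longrightarrow> s \<in> S U \<Longrightarrow> (\<lambda>q. A q *\<^sub>v s q) \<in> S U"
  shows "(\<lambda>z. coeff (char_poly (A (Some z))) k) holomorphic_on UNIV"
proof -
  have "\<exists>V. open V \<and> z0 \<in> V \<and> (\<lambda>z. coeff (char_poly (A (Some z))) k) holomorphic_on V" for z0
  proof -
    have "Some z0 \<in> topspace (top_of CP1)" by simp
    then obtain U e where U: "openin (top_of CP1) U" "Some z0 \<in> U"
      and e: "\<forall>q\<in>U - {pt CP1}. e q \<in> carrier_mat K K"
        "\<forall>q\<in>U - {pt CP1}. \<forall>c\<in>carrier_vec K. e q *\<^sub>v c = 0\<^sub>v K \<longrightarrow> c = 0\<^sub>v K"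
      and S: "\<forall>V. openin (top_of CP1) V \<longrightarrow> V \<subseteq> U \<longrightarrow> S V = frame_span CP1 K e (\<lambda>_. mero CP1) V"
      by (rule locally_freeE[OF lf])
    define V where "V = U - {None}"
    have V: "openin (top_of CP1) V" "V \<subseteq> U" using open_CP1_remove_infinity[OF U(1)] by (auto simp: V_def)
    note SV = S[rule_format, OF V]
    have "\<forall>j\<in>{..<K}. \<exists>f. (\<forall>i<K. f i \<in> mero CP1 V) \<and>
        (\<forall>q\<in>V - {pt CP1}. A q *\<^sub>v (e q *\<^sub>v unit_vec K j) = e q *\<^sub>v Matrix.vec K (\<lambda>i. f i q))"
    proof
      fix j
      have "(\<lambda>q. e q *\<^sub>v unit_vec K j) \<in> S V" unfolding SV
        by (rule frame_spanI[where f = "\<lambda>i q. if i = j then 1 else 0"])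
          (simp_all add: CP1.mero_const[OF V(1)] unit_vec_eq_vec)
      from pres[OF V(1) this] show "\<exists>f. (\<forall>i<K. f i \<in> mero CP1 V) \<and>
        (\<forall>q\<in>V - {pt CP1}. A q *\<^sub>v (e q *\<^sub>v unit_vec K j) = e q *\<^sub>v Matrix.vec K (\<lambda>i. f i q))"
        unfolding SV frame_span_def by simp
    qed
    from bchoice[OF this] obtain f where f: "\<forall>j\<in>{..<K}. (\<forall>i<K. f j i \<in> mero CP1 V) \<and>
        (\<forall>q\<in>V - {pt CP1}. A q *\<^sub>v (e q *\<^sub>v unit_vec K j) = e q *\<^sub>v Matrix.vec K (\<lambda>i. f j i q))" ..
    define B where "B q = mat K K (\<lambda>(i, j). f j i q)" for q
    define W where "W = {z. Some z \<in> V}"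
    have W: "open W" "z0 \<in> W" unfolding W_def
      using openin_CP1_finite_part[OF V(1)] U(2) by (auto simp: V_def)
    have cp: "char_poly (A (Some z)) = char_poly (B (Some z))" if z: "z \<in> W" for z
    proof (rule char_poly_intertwined[OF car])
      have zU: "Some z \<in> U - {pt CP1}" using z V(2) by (auto simp: W_def)
      show ec: "e (Some z) \<in> carrier_mat K K" using e(1) zU by blast
      show "det (e (Some z)) \<noteq> 0" using det_nonzero_of_injective[OF ec] e(2) zU by blast
      show Bc: "B (Some z) \<in> carrier_mat K K" by (simp add: B_def)
      show "A (Some z) * e (Some z) = e (Some z) * B (Some z)"
      proof (rule mat_eq_of_unit_columns[of _ K K])
        fix j assume j: "j < K"
        have "(A (Some z) * e (Some z)) *\<^sub>v unit_vec K j = A (Some z) *\<^sub>v (e (Some z) *\<^sub>v unit_vec K j)"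
          by (rule assoc_mult_mat_vec[OF car ec]) simp
        also have "\<dots> = e (Some z) *\<^sub>v Matrix.vec K (\<lambda>i. f j i (Some z))"
          using f j z by (auto simp: W_def)
        also have "Matrix.vec K (\<lambda>i. f j i (Some z)) = B (Some z) *\<^sub>v unit_vec K j"
          using j by (intro eq_vecI) (auto simp: B_def)
        also have "e (Some z) *\<^sub>v (B (Some z) *\<^sub>v unit_vec K j) = (e (Some z) * B (Some z)) *\<^sub>v unit_vec K j"
          by (rule assoc_mult_mat_vec[OF ec Bc, symmetric]) simp
        finally show "(A (Some z) * e (Some z)) *\<^sub>v unit_vec K j = (e (Some z) * B (Some z)) *\<^sub>v unit_vec K j" .
      qed (use mult_carrier_mat[OF car ec] mult_carrier_mat[OF ec Bc] in simp_all)
    qed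
    have "(\<lambda>z. coeff (char_poly (B (Some z))) k) holomorphic_on W"
    proof (rule holomorphic_coeff_char_poly)
      show "B (Some z) \<in> carrier_mat K K" for z by (simp add: B_def)
      fix i j assume ij: "i < K" "j < K"
      then have "f j i \<in> mero CP1 V" using f by auto
      then have "f j i \<in> hol CP1 V" by (simp add: mero_def V_def)
      then have "(\<lambda>z. f j i (Some z)) holomorphic_on W" by (simp add: mem_hol_CP1 W_def)
      then show "(\<lambda>z. B (Some z) $$ (i, j)) holomorphic_on W" using ij by (simp add: B_def)
    qed
    then have "(\<lambda>z. coeff (char_poly (A (Some z))) k) holomorphic_on W"
      by (rule holomorphic_transform) (simp add: cp)
    then show ?thesis using W by (intro exI[of _ W]) simp
  qed
  then have "\<forall>z0. \<exists>V. open V \<and> z0 \<in> V \<and> (\<lambda>z. coeff (char_poly (A (Some z))) k) holomorphic_on V" ..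
  from choice[OF this] obtain V where V: "\<forall>z0. open (V z0) \<and> z0 \<in> V z0 \<and>
     (\<lambda>z. coeff (char_poly (A (Some z))) k) holomorphic_on V z0" ..
  have "(\<lambda>z. coeff (char_poly (A (Some z))) k) holomorphic_on (\<Union>z0\<in>UNIV. V z0)"
    by (rule holomorphic_on_UN_open) (use V in auto)
  moreover have "(\<Union>z0\<in>UNIV. V z0) = UNIV"
  proof (intro Set.set_eqI iffI UNIV_I)
    fix z show "z \<in> (\<Union>z0\<in>UNIV. V z0)" using V[rule_format, of z] by (intro UN_I[of z]) simp_all
  qed
  ultimately show ?thesis by simp
qed

section \<open>Eigenvalues at infinity\<close>

lemma deriv_pole:
  fixes u c :: complex
  assumes "u \<noteq> 0" shows "deriv (\<lambda>w. c / w ^ n) u = - of_nat n * c / u ^ Suc n" 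
proof (rule DERIV_imp_deriv)
  show "((\<lambda>w. c / w ^ n) has_field_derivative - of_nat n * c / u ^ Suc n) (at u)"
  proof (cases n)
    case (Suc k)
    have "((\<lambda>w. c / w ^ n) has_field_derivative
        (0 * u ^ n - c * (of_nat n * u ^ (n - 1))) / (u ^ n * u ^ n)) (at u)"
    proof (rule DERIV_divide)
      show "((\<lambda>w. w ^ n) has_field_derivative of_nat n * u ^ (n - 1)) (at u)"
        by (auto intro!: derivative_eq_intros)
    qed (use assms in auto)
    moreover have "(0 * u ^ n - c * (of_nat n * u ^ (n - 1))) / (u ^ n * u ^ n) = - of_nat n * c / u ^ Suc n"
      using assms by (simp add: Suc divide_simps algebra_simps)
    ultimately show ?thesis by simp
  qed simp
qed

lemma deriv_irregular_part:
  assumes "u \<noteq> 0" "K \<ge> 1"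
  shows "deriv (irregular_part K N r) u = - 2 * of_nat K * unity_root K r / u ^ (2 * N + 2 * K + 1)"
proof -
  define S :: complex where "S = of_nat (K + N)"
  have "S \<noteq> 0" using assms(2) unfolding S_def of_nat_eq_0_iff by simp
  moreover have "of_nat (2 * (N + K)) = 2 * S" by (simp add: S_def)
  ultimately have nz: "of_nat (2 * (N + K)) * (of_nat K / of_nat (K + N) * unity_root K r) =
      2 * of_nat K * unity_root K r"
    unfolding S_def[symmetric] by simp
  have "irregular_part K N r = (\<lambda>w. (of_nat K / of_nat (K + N) * unity_root K r) / w ^ (2 * (N + K)))"
    by (rule ext) (simp add: irregular_part_def unity_root_def)
  then have "deriv (irregular_part K N r) u =
     - of_nat (2 * (N + K)) * (of_nat K / of_nat (K + N) * unity_root K r) / u ^ Suc (2 * (N + K))"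
    by (simp only: deriv_pole[OF assms(1)])
  also have "- of_nat (2 * (N + K)) * (of_nat K / of_nat (K + N) * unity_root K r) =
     - 2 * of_nat K * unity_root K r"
    by (simp only: mult_minus_left nz)
  also have "Suc (2 * (N + K)) = 2 * N + 2 * K + 1" by simp
  finally show ?thesis .
qed

lemma pulled_back_higgs_nz:
  assumes "u \<noteq> 0"
  shows "pulled_back_higgs K H u = (- 2 * of_nat K / u ^ (2 * K + 1)) \<cdot>\<^sub>m higgs H (Some (1 / u ^ (2 * K)))"
  using assms deriv_pole[OF assms, of 1 "2 * K"] by (simp add: pulled_back_higgs_def cover_map_def)

lemma rank_one_frame:
  assumes "(e :: complex mat) \<in> carrier_mat d 1"
  shows "e *\<^sub>v Matrix.vec 1 (\<lambda>_. c) = c \<cdot>\<^sub>v (e *\<^sub>v Matrix.vec 1 (\<lambda>_. 1))"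
  using assms by (intro eq_vecI) (auto simp: scalar_prod_def)

lemma mem_rank_one_span:
  assumes e: "\<And>u. u \<in> V - {pt X} \<Longrightarrow> (e u :: complex mat) \<in> carrier_mat d 1"
  shows "s \<in> frame_span X 1 e (\<lambda>_. T) V \<longleftrightarrow>
    (\<exists>f. f \<in> T V \<and> (\<forall>u\<in>V - {pt X}. s u = f u \<cdot>\<^sub>v (e u *\<^sub>v Matrix.vec 1 (\<lambda>_. 1))))"
proof
  assume "s \<in> frame_span X 1 e (\<lambda>_. T) V"
  then obtain f where f: "\<forall>j<1. f j \<in> T V"
    "\<forall>u\<in>V - {pt X}. s u = e u *\<^sub>v Matrix.vec 1 (\<lambda>j. f j u)" by (rule frame_spanE)
  have "s u = f 0 u \<cdot>\<^sub>v (e u *\<^sub>v Matrix.vec 1 (\<lambda>_. 1))" if u: "u \<in> V - {pt X}" for u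
  proof -
    have "Matrix.vec 1 (\<lambda>j. f j u) = Matrix.vec 1 (\<lambda>_. f 0 u)" by (intro eq_vecI) auto
    then have "s u = e u *\<^sub>v Matrix.vec 1 (\<lambda>_. f 0 u)" using f(2) u by simp
    also have "\<dots> = f 0 u \<cdot>\<^sub>v (e u *\<^sub>v Matrix.vec 1 (\<lambda>_. 1))" by (rule rank_one_frame[OF e[OF u]])
    finally show ?thesis .
  qed
  then show "\<exists>f. f \<in> T V \<and> (\<forall>u\<in>V - {pt X}. s u = f u \<cdot>\<^sub>v (e u *\<^sub>v Matrix.vec 1 (\<lambda>_. 1)))"
    using f(1) by (intro exI[of _ "f 0"]) simp
next
  assume "\<exists>f. f \<in> T V \<and> (\<forall>u\<in>V - {pt X}. s u = f u \<cdot>\<^sub>v (e u *\<^sub>v Matrix.vec 1 (\<lambda>_. 1)))"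
  then obtain f where f: "f \<in> T V \<and> (\<forall>u\<in>V - {pt X}. s u = f u \<cdot>\<^sub>v (e u *\<^sub>v Matrix.vec 1 (\<lambda>_. 1)))" ..
  show "s \<in> frame_span X 1 e (\<lambda>_. T) V"
  proof (rule frame_spanI[where f = "\<lambda>_. f"])
    fix u assume u: "u \<in> V - {pt X}"
    then have "s u = f u \<cdot>\<^sub>v (e u *\<^sub>v Matrix.vec 1 (\<lambda>_. 1))" using f by blast
    also have "\<dots> = e u *\<^sub>v Matrix.vec 1 (\<lambda>_. f u)" by (rule rank_one_frame[OF e[OF u], symmetric])
    finally show "s u = e u *\<^sub>v Matrix.vec 1 (\<lambda>_. f u)" .
  qed (use f in blast)
qed

text \<open>
  The line bundle is equivalent to the pole-order filtration of an ordinary line bundle, so a local generator \<open>v\<close> of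
  the latter has order zero and is carried by \<open>\<Phi> - a\<close> into order one. Hence the eigenvalue
  differs from \<open>a\<close> by a function with at most a simple pole.
\<close>

lemma eigensection_at_infinity:
  assumes \<rho>: "\<rho> > 0" and M: "locally_free (disc \<rho>) (hol (disc \<rho>)) K 1 M"
    and L: "\<And>U. openin (top_of (disc \<rho>)) U \<Longrightarrow> sec L U = sec (pole_order_filtration M) U \<and>
              (\<forall>\<alpha>. fil L \<alpha> U = fil (pole_order_filtration M) \<alpha> U)"
    and shift: "\<And>U s. openin (top_of (disc \<rho>)) U \<Longrightarrow> s \<in> fil L 0 U \<Longrightarrow>
        (\<lambda>u. \<Phi> u *\<^sub>v s u - a u \<cdot>\<^sub>v s u) \<in> fil L 1 U"
    and \<Phi>: "\<And>u. u \<noteq> 0 \<Longrightarrow> \<Phi> u \<in> carrier_mat K K"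
  obtains \<epsilon> v h where "\<epsilon> > 0" "\<epsilon> \<le> \<rho>" "h holomorphic_on ball 0 \<epsilon>"
    "\<forall>u\<in>ball 0 \<epsilon> - {0}. v u \<in> carrier_vec K"
    "\<forall>u\<in>ball 0 \<epsilon> - {0}. \<Phi> u *\<^sub>v v u = (a u + h u / u) \<cdot>\<^sub>v v u"
    "\<forall>W s. open W \<longrightarrow> W \<subseteq> ball 0 \<epsilon> - {0} \<longrightarrow> s \<in> sec L W \<longrightarrow> (\<forall>u\<in>W. \<exists>c. s u = c \<cdot>\<^sub>v v u)"
proof -
  have "0 \<in> topspace (top_of (disc \<rho>))" using \<rho> by simp
  then obtain U e where U: "openin (top_of (disc \<rho>)) U" "0 \<in> U"
    and e: "\<forall>q\<in>U - {pt (disc \<rho>)}. e q \<in> carrier_mat K 1"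
      "\<forall>q\<in>U - {pt (disc \<rho>)}. \<forall>c\<in>carrier_vec 1. e q *\<^sub>v c = 0\<^sub>v K \<longrightarrow> c = 0\<^sub>v 1"
    and MV: "\<forall>V. openin (top_of (disc \<rho>)) V \<longrightarrow> V \<subseteq> U \<longrightarrow>
      M V = frame_span (disc \<rho>) 1 e (\<lambda>_. hol (disc \<rho>)) V"
    by (rule locally_freeE[OF M])
  have "open U" "U \<subseteq> ball 0 \<rho>" using U(1) by (auto simp: openin_disc)
  then obtain \<epsilon> where \<epsilon>: "\<epsilon> > 0" "ball 0 \<epsilon> \<subseteq> U" using U(2) open_contains_ball by blast
  have \<epsilon>\<rho>: "\<epsilon> \<le> \<rho>" using \<epsilon> \<open>U \<subseteq> ball 0 \<rho>\<close> ball_subset_ball_iff[of "0::complex" \<epsilon> 0 \<rho>] by auto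
  define v where "v u = e u *\<^sub>v Matrix.vec 1 (\<lambda>_. 1)" for u
  let ?B = "ball (0::complex) \<epsilon>"
  have B: "openin (top_of (disc \<rho>)) ?B" using \<epsilon>\<rho> by (auto simp: openin_disc)
  have ec: "e u \<in> carrier_mat K 1" if "u \<in> ?B - {0}" for u using e(1) \<epsilon>(2) that by auto
  have vc: "v u \<in> carrier_vec K" if "u \<in> ?B - {0}" for u using ec[OF that] by (simp add: v_def carrier_matD)
  have memM: "s \<in> M W \<longleftrightarrow> (\<exists>f. f holomorphic_on W \<and> (\<forall>u\<in>W - {0}. s u = f u \<cdot>\<^sub>v v u))"
    if "open W" "W \<subseteq> ?B" for W s
  proof -
    have "openin (top_of (disc \<rho>)) W" using that \<epsilon>\<rho> by (auto simp: openin_disc)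
    then have "M W = frame_span (disc \<rho>) 1 e (\<lambda>_. hol (disc \<rho>)) W" using MV that(2) \<epsilon>(2) by blast
    moreover have "e u \<in> carrier_mat K 1" if "u \<in> W - {pt (disc \<rho>)}" for u
      by (rule ec) (use that \<open>W \<subseteq> ?B\<close> in auto)
    note mem_rank_one_span[of W "disc \<rho>" e K s "hol (disc \<rho>)", OF this]
    ultimately show ?thesis unfolding v_def by (simp only: hol_disc pt_disc)
  qed
  have "v \<in> fil L 0 ?B"
  proof -
    have "(\<lambda>u. u powi \<lfloor>0::real\<rfloor> \<cdot>\<^sub>v v u) \<in> M ?B"
      unfolding memM[OF open_ball order_refl] by (rule exI[of _ "\<lambda>_. 1"]) simp
    then show ?thesis using L[OF B] by (simp add: pole_order_filtration_def)
  qed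
  from shift[OF B this] have "(\<lambda>u. u powi \<lfloor>1::real\<rfloor> \<cdot>\<^sub>v (\<Phi> u *\<^sub>v v u - a u \<cdot>\<^sub>v v u)) \<in> M ?B"
    using L[OF B] by (simp add: pole_order_filtration_def)
  then obtain h where h: "h holomorphic_on ?B \<and> (\<forall>u\<in>?B - {0}. u powi \<lfloor>1::real\<rfloor> \<cdot>\<^sub>v (\<Phi> u *\<^sub>v v u - a u \<cdot>\<^sub>v v u) = h u \<cdot>\<^sub>v v u)"
    unfolding memM[OF open_ball order_refl] ..
  show thesis
  proof (rule that[of \<epsilon> h v])
    show "\<forall>u\<in>?B - {0}. \<Phi> u *\<^sub>v v u = (a u + h u / u) \<cdot>\<^sub>v v u"
    proof
      fix u assume u: "u \<in> ?B - {0}"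
      then have u0: "u \<noteq> 0" by auto
      have E: "u \<cdot>\<^sub>v (\<Phi> u *\<^sub>v v u - a u \<cdot>\<^sub>v v u) = h u \<cdot>\<^sub>v v u" using h u by simp
      show "\<Phi> u *\<^sub>v v u = (a u + h u / u) \<cdot>\<^sub>v v u"
      proof (rule eq_vecI)
        fix i assume "i < dim_vec ((a u + h u / u) \<cdot>\<^sub>v v u)"
        then have i: "i < K" using vc[OF u] by simp
        have "u * ((\<Phi> u *\<^sub>v v u) $ i - a u * v u $ i) = h u * v u $ i"
          using arg_cong[OF E, of "\<lambda>x. vec_index x i"] i vc[OF u] \<Phi>[OF u0] by simp
        then have "(\<Phi> u *\<^sub>v v u) $ i = (a u + h u / u) * v u $ i" using u0 by (simp add: field_simps)
        then show "(\<Phi> u *\<^sub>v v u) $ i = ((a u + h u / u) \<cdot>\<^sub>v v u) $ i" using i vc[OF u] by simp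
      qed (use vc[OF u] \<Phi>[OF u0] in simp)
    qed
    show "\<forall>W s. open W \<longrightarrow> W \<subseteq> ?B - {0} \<longrightarrow> s \<in> sec L W \<longrightarrow> (\<forall>u\<in>W. \<exists>c. s u = c \<cdot>\<^sub>v v u)"
    proof (intro allI impI ballI)
      fix W s u assume W: "open W" "W \<subseteq> ?B - {0}" "s \<in> sec L W" "u \<in> W"
      have "openin (top_of (disc \<rho>)) W" using W \<epsilon>\<rho> by (auto simp: openin_disc)
      from L[OF this] W(3) obtain n where n: "(\<lambda>u. u ^ n \<cdot>\<^sub>v s u) \<in> M W"
        by (auto simp: pole_order_filtration_def)
      have "W \<subseteq> ?B" using W(2) by auto
      from n[unfolded memM[OF W(1) this]] obtain f where
        "f holomorphic_on W \<and> (\<forall>u\<in>W - {0}. u ^ n \<cdot>\<^sub>v s u = f u \<cdot>\<^sub>v v u)" ..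
      then have E: "u ^ n \<cdot>\<^sub>v s u = f u \<cdot>\<^sub>v v u" using W(2,4) by auto
      have u0: "u \<noteq> 0" using W by auto
      have "s u = inverse (u ^ n) \<cdot>\<^sub>v (u ^ n \<cdot>\<^sub>v s u)" using u0 by (simp add: smult_smult_assoc)
      also have "\<dots> = (inverse (u ^ n) * f u) \<cdot>\<^sub>v v u" unfolding E by (simp add: smult_smult_assoc)
      finally show "\<exists>c. s u = c \<cdot>\<^sub>v v u" ..
    qed
  qed (use \<epsilon> \<epsilon>\<rho> h vc in simp_all)
qed

lemma pullback_of_frame_section:
  assumes W: "openin (top_of Y) W" and V: "openin (top_of X) V" "\<psi> ` W \<subseteq> V" and t: "t \<in> sec E V"
    and one: "(\<lambda>_. 1) \<in> mero Y W"
    and dim: "\<And>q. q \<in> W - {pt Y} \<Longrightarrow> t (\<psi> q) \<in> carrier_vec d"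
  shows "(\<lambda>q. t (\<psi> q)) \<in> sec (pullback Y X \<psi> m d E) W"
proof -
  have "t (\<psi> q) = Matrix.vec d (\<lambda>j. \<Sum>i<(1::nat). 1 * (t (\<psi> q) $ j))" if "q \<in> W - {pt Y}" for q
    using dim[OF that] by (intro eq_vecI) auto
  then have *: "\<exists>(n::nat) f t'. (\<forall>i<n. f i \<in> mero Y W \<and> t' i \<in> sec E V) \<and>
                 (\<forall>q\<in>W - {pt Y}. t (\<psi> q) = Matrix.vec d (\<lambda>j. \<Sum>i<n. f i q * (t' i (\<psi> q) $ j)))"
    using one t by (intro exI[of _ 1] exI[of _ "\<lambda>_ _. 1"] exI[of _ "\<lambda>_. t"]) simp
  show ?thesis unfolding pullback_def filtered_sheaf.simps mem_Collect_eq
    by (intro ballI, rule exI[of _ W], rule exI[of _ V]) (use W V * in simp)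
qed

text \<open>
  If the columns of an invertible matrix lie in the span of \<open>n\<close> vectors, these vectors are independent.
\<close>

lemma independence_of_spanning:
  fixes P E :: "complex mat"
  assumes "P \<in> carrier_mat n n" "E \<in> carrier_mat n n" "det E \<noteq> 0"
    and "\<And>j. j < n \<Longrightarrow> \<exists>c\<in>carrier_vec n. E *\<^sub>v unit_vec n j = P *\<^sub>v c"
  shows "det P \<noteq> 0"
proof -
  have "\<forall>j\<in>{..<n}. \<exists>c. c \<in> carrier_vec n \<and> E *\<^sub>v unit_vec n j = P *\<^sub>v c" using assms(4) by blast
  from bchoice[OF this] obtain c where c: "\<forall>j\<in>{..<n}. c j \<in> carrier_vec n \<and> E *\<^sub>v unit_vec n j = P *\<^sub>v c j" ..
  define C where "C = mat n n (\<lambda>(i, j). c j $ i)"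
  have C: "C \<in> carrier_mat n n" by (simp add: C_def)
  have "E = P * C"
  proof (rule mat_eq_of_unit_columns[OF assms(2)])
    fix j assume j: "j < n"
    have "E *\<^sub>v unit_vec n j = P *\<^sub>v c j" using c j by simp
    also have "c j = C *\<^sub>v unit_vec n j"
      using c j by (intro eq_vecI) (auto simp: C_def)
    also have "P *\<^sub>v (C *\<^sub>v unit_vec n j) = (P * C) *\<^sub>v unit_vec n j"
      by (rule assoc_mult_mat_vec[OF assms(1) C, symmetric]) simp
    finally show "E *\<^sub>v unit_vec n j = (P * C) *\<^sub>v unit_vec n j" .
  qed (use mult_carrier_mat[OF assms(1) C] in simp)
  then have "det E = det P * det C" using det_mult[OF assms(1) C] by simp
  then show ?thesis using assms(3) by auto
qed

lemma smult_mat_mult_vec: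
  fixes A :: "complex mat"
  assumes "A \<in> carrier_mat n m" "x \<in> carrier_vec m"
  shows "(c \<cdot>\<^sub>m A) *\<^sub>v x = c \<cdot>\<^sub>v (A *\<^sub>v x)"
  using assms by (intro eq_vecI) (auto simp: scalar_prod_def sum_distrib_left mult.assoc)

lemma continuous_cover_preimage:
  assumes "open W" "0 \<notin> W" "open Z"
  shows "open {u\<in>W. 1 / u ^ n \<in> (Z :: complex set)}"
proof -
  have "open (W \<inter> (\<lambda>u. 1 / u ^ n) -` Z)"
    by (rule continuous_open_preimage) (use assms in \<open>auto intro!: continuous_intros\<close>)
  moreover have "W \<inter> (\<lambda>u. 1 / u ^ n) -` Z = {u\<in>W. 1 / u ^ n \<in> Z}" by auto
  ultimately show ?thesis by simp
qed

text \<open>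
  The generators of the \<open>K\<close> lines are independent in every fibre near the origin: a pulled-back frame of the bundle
  spans the fibre and is a sum of sections of the lines. They therefore diagonalize the Higgs field. Dividing the
  eigenvalues of its pullback by the derivative of \<open>u \<mapsto> u powi (- 2 * K)\<close> gives the leading terms \<open>unity_root K r / u ^ (2 * N)\<close>;
  the simple pole that is left over contributes at relative order \<open>2 * N + 2 * K\<close>.
\<close>

lemma eigenvalues_at_infinity:
  assumes K: "K \<ge> 1" and lf: "locally_free CP1 (mero CP1) K K (sec (underlying H))"
    and car: "\<And>z. higgs H (Some z) \<in> carrier_mat K K" and good: "good_at_infinity K N H"
  obtains \<epsilon> h where "\<epsilon> > 0" "\<forall>r<K. h r holomorphic_on ball 0 \<epsilon>"
    "\<forall>u\<in>ball 0 \<epsilon> - {0}. char_poly (higgs H (Some (1 / u ^ (2 * K)))) =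
       (\<Prod>r<K. [:- (inverse (u ^ (2 * N)) * (unity_root K (Suc r) + u ^ (2 * N + 2 * K) * h r u)), 1:])"
proof -
  obtain \<rho> L where \<rho>: "\<rho> > 0" and
    ds: "filtered_direct_sum (disc \<rho>) K {1..K} L
       (pullback (disc \<rho>) CP1 (cover_map K) (2 * K) K (underlying H))" and
    Lr: "\<forall>r\<in>{1..K}. filtered_bundle (disc \<rho>) K 1 (L r) \<and>
        (\<exists>M. locally_free (disc \<rho>) (hol (disc \<rho>)) K 1 M \<and>
           (\<forall>U. openin (top_of (disc \<rho>)) U \<longrightarrow>
              sec (L r) U = sec (pole_order_filtration M) U \<and>
              (\<forall>\<alpha>. fil (L r) \<alpha> U = fil (pole_order_filtration M) \<alpha> U))) \<and>
        (\<forall>U. openin (top_of (disc \<rho>)) U \<longrightarrow>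
           (\<forall>s\<in>sec (L r) U. (\<lambda>u. pulled_back_higgs K H u *\<^sub>v s u) \<in> sec (L r) U) \<and>
           (\<forall>\<alpha>. \<forall>s\<in>fil (L r) \<alpha> U.
              (\<lambda>u. pulled_back_higgs K H u *\<^sub>v s u - deriv (irregular_part K N r) u \<cdot>\<^sub>v s u)
                \<in> fil (L r) (\<alpha> + 1) U))"
    using good unfolding good_at_infinity_def by (elim exE conjE) (rule that)
  define \<Phi> where "\<Phi> = pulled_back_higgs K H"
  have \<Phi>: "\<Phi> u \<in> carrier_mat K K" if "u \<noteq> 0" for u
    unfolding \<Phi>_def pulled_back_higgs_nz[OF that] using car by simp
  define a where "a r = deriv (irregular_part K N r)" for r
  define Q where "Q r \<epsilon> v h \<longleftrightarrow> \<epsilon> > 0 \<and> \<epsilon> \<le> \<rho> \<and> h holomorphic_on ball 0 \<epsilon> \<and>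
    (\<forall>u\<in>ball 0 \<epsilon> - {0}. v u \<in> carrier_vec K) \<and>
    (\<forall>u\<in>ball 0 \<epsilon> - {0}. \<Phi> u *\<^sub>v v u = (a r u + h u / u) \<cdot>\<^sub>v v u) \<and>
    (\<forall>W s. open W \<longrightarrow> W \<subseteq> ball 0 \<epsilon> - {0} \<longrightarrow> s \<in> sec (L r) W \<longrightarrow> (\<forall>u\<in>W. \<exists>c. s u = c \<cdot>\<^sub>v v u))" for r \<epsilon> v h
  have "\<forall>r\<in>{1..K}. \<exists>\<epsilon> v h. Q r \<epsilon> v h"
  proof
    fix r assume r: "r \<in> {1..K}"
    from conjunct1[OF conjunct2[OF bspec[OF Lr r]]] obtain M where M: "locally_free (disc \<rho>) (hol (disc \<rho>)) K 1 M \<and>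
           (\<forall>U. openin (top_of (disc \<rho>)) U \<longrightarrow>
              sec (L r) U = sec (pole_order_filtration M) U \<and>
              (\<forall>\<alpha>. fil (L r) \<alpha> U = fil (pole_order_filtration M) \<alpha> U))" ..
    have shift: "(\<lambda>u. \<Phi> u *\<^sub>v s u - a r u \<cdot>\<^sub>v s u) \<in> fil (L r) 1 U"
      if "openin (top_of (disc \<rho>)) U" "s \<in> fil (L r) 0 U" for U s
    proof -
      have "(\<lambda>u. \<Phi> u *\<^sub>v s u - a r u \<cdot>\<^sub>v s u) \<in> fil (L r) (0 + 1) U"
        unfolding \<Phi>_def a_def 
        using conjunct2[OF conjunct2[OF bspec[OF Lr r]], rule_format, OF that(1), THEN conjunct2,
          rule_format, OF that(2)] .
      then show ?thesis by simp
    qed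
    obtain \<epsilon> v h where "\<epsilon> > 0" "\<epsilon> \<le> \<rho>" "h holomorphic_on ball 0 \<epsilon>"
      "\<forall>u\<in>ball 0 \<epsilon> - {0}. v u \<in> carrier_vec K"
      "\<forall>u\<in>ball 0 \<epsilon> - {0}. \<Phi> u *\<^sub>v v u = (a r u + h u / u) \<cdot>\<^sub>v v u"
      "\<forall>W s. open W \<longrightarrow> W \<subseteq> ball 0 \<epsilon> - {0} \<longrightarrow> s \<in> sec (L r) W \<longrightarrow> (\<forall>u\<in>W. \<exists>c. s u = c \<cdot>\<^sub>v v u)"
    proof (rule eigensection_at_infinity[OF \<rho>, of K M "L r" \<Phi> "a r"])
      show "locally_free (disc \<rho>) (hol (disc \<rho>)) K 1 M" using M ..
      show "sec (L r) U = sec (pole_order_filtration M) U \<and>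
          (\<forall>\<alpha>. fil (L r) \<alpha> U = fil (pole_order_filtration M) \<alpha> U)"
        if "openin (top_of (disc \<rho>)) U" for U by (rule conjunct2[OF M, rule_format, OF that])
      show "(\<lambda>u. \<Phi> u *\<^sub>v s u - a r u \<cdot>\<^sub>v s u) \<in> fil (L r) 1 U"
        if "openin (top_of (disc \<rho>)) U" "s \<in> fil (L r) 0 U" for U s by (rule shift[OF that])
      show "\<Phi> u \<in> carrier_mat K K" if "u \<noteq> 0" for u by (rule \<Phi>[OF that])
    qed (rule that)
    then have "Q r \<epsilon> v h" unfolding Q_def by (intro conjI)
    then show "\<exists>\<epsilon> v h. Q r \<epsilon> v h" by (intro exI)
  qed
  from bchoice[OF this] obtain \<epsilon> where "\<forall>r\<in>{1..K}. \<exists>v h. Q r (\<epsilon> r) v h" ..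
  from bchoice[OF this] obtain v where "\<forall>r\<in>{1..K}. \<exists>h. Q r (\<epsilon> r) (v r) h" ..
  from bchoice[OF this] obtain h where Q: "\<forall>r\<in>{1..K}. Q r (\<epsilon> r) (v r) (h r)" ..
  note Qr = bspec[OF Q, unfolded Q_def]
  note Qs = Qr[THEN conjunct1] Qr[THEN conjunct2, THEN conjunct1]
    Qr[THEN conjunct2, THEN conjunct2, THEN conjunct1]
    Qr[THEN conjunct2, THEN conjunct2, THEN conjunct2, THEN conjunct1]
    Qr[THEN conjunct2, THEN conjunct2, THEN conjunct2, THEN conjunct2, THEN conjunct1]
    Qr[THEN conjunct2, THEN conjunct2, THEN conjunct2, THEN conjunct2, THEN conjunct2]
  define \<epsilon>0 where "\<epsilon>0 = Min (\<epsilon> ` {1..K})"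
  have \<epsilon>0: "\<epsilon>0 > 0" unfolding \<epsilon>0_def
    by (subst Min_gr_iff) (use K Qs(1) in auto)
  have \<epsilon>0le: "\<epsilon>0 \<le> \<epsilon> r" if "r \<in> {1..K}" for r unfolding \<epsilon>0_def using that by (intro Min_le) auto
  have \<epsilon>0\<rho>: "\<epsilon>0 \<le> \<rho>" using \<epsilon>0le[of 1] Qs(2)[of 1] K by simp
  have sub: "u \<in> ball 0 (\<epsilon> r) - {0}" if "u \<in> ball 0 \<epsilon>0 - {0}" "r \<in> {1..K}" for u r
    using that \<epsilon>0le[OF that(2)] by auto
  have vc: "v r u \<in> carrier_vec K" if "u \<in> ball 0 \<epsilon>0 - {0}" "r \<in> {1..K}" for u r
    by (rule bspec[OF Qs(4)[OF that(2)] sub[OF that]])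
  define P where "P u = mat K K (\<lambda>(i, r). v (Suc r) u $ i)" for u
  have Pc: "P u \<in> carrier_mat K K" for u by (simp add: P_def)
  have colP: "col (P u) r = v (Suc r) u" if "u \<in> ball 0 \<epsilon>0 - {0}" "r < K" for u r
    using vc[OF that(1), of "Suc r"] that(2) by (intro eq_vecI) (auto simp: P_def)
  have detP: "det (P u0) \<noteq> 0" if u0: "u0 \<in> ball 0 \<epsilon>0 - {0}" for u0
  proof -
    have "Some (1 / u0 ^ (2 * K)) \<in> topspace (top_of CP1)" by simp
    then obtain U e where U: "openin (top_of CP1) U" "Some (1 / u0 ^ (2 * K)) \<in> U"
      and e: "\<forall>q\<in>U - {pt CP1}. e q \<in> carrier_mat K K"
        "\<forall>q\<in>U - {pt CP1}. \<forall>c\<in>carrier_vec K. e q *\<^sub>v c = 0\<^sub>v K \<longrightarrow> c = 0\<^sub>v K"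
      and S: "\<forall>V. openin (top_of CP1) V \<longrightarrow> V \<subseteq> U \<longrightarrow>
        sec (underlying H) V = frame_span CP1 K e (\<lambda>_. mero CP1) V"
      by (rule locally_freeE[OF lf])
    \<comment> \<open>on \<open>W\<close> both the frame of the bundle and the generators of the lines are available\<close>
    define W where "W = {u\<in>ball 0 \<epsilon>0 - {0}. 1 / u ^ (2 * K) \<in> {z. Some z \<in> U}}"
    have oW: "open W" unfolding W_def
      by (rule continuous_cover_preimage) (use openin_CP1_finite_part[OF U(1)] in auto)
    have Wsub: "W \<subseteq> ball 0 \<epsilon>0 - {0}" by (auto simp: W_def)
    have u0W: "u0 \<in> W" using u0 U(2) by (simp add: W_def)
    have W: "openin (top_of (disc \<rho>)) W" using oW Wsub \<epsilon>0\<rho> by (auto simp: openin_disc)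
    have \<psi>W: "cover_map K ` W \<subseteq> U" by (auto simp: W_def cover_map_def)
    have \<psi>u0: "cover_map K u0 = Some (1 / u0 ^ (2 * K))" using u0 by (simp add: cover_map_def)
    let ?E = "e (Some (1 / u0 ^ (2 * K)))"
    have Ec: "?E \<in> carrier_mat K K" using e(1) U(2) by auto
    have Edet: "det ?E \<noteq> 0" using det_nonzero_of_injective[OF Ec] e(2) U(2) by auto
    show ?thesis
    proof (rule independence_of_spanning[OF Pc Ec Edet])
      fix j assume j: "j < K"
      define t where "t q = e q *\<^sub>v unit_vec K j" for q
      have "t \<in> sec (underlying H) U" unfolding S[rule_format, OF U(1) order_refl]
        by (rule frame_spanI[where f = "\<lambda>i q. if i = j then 1 else 0"])
          (simp_all add: CP1.mero_const[OF U(1)] unit_vec_eq_vec t_def)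
      then have "(\<lambda>u. t (cover_map K u)) \<in> sec (pullback (disc \<rho>) CP1 (cover_map K) (2 * K) K (underlying H)) W"
      proof (rule pullback_of_frame_section[OF W U(1) \<psi>W])
        show "(\<lambda>_. 1) \<in> mero (disc \<rho>) W"
          by (rule coordinate_curve.mero_const[OF coordinate_curve_disc[OF \<rho>] W])
        fix u assume "u \<in> W - {pt (disc \<rho>)}"
        then have "cover_map K u \<in> U - {pt CP1}" using \<psi>W by (auto simp: cover_map_def)
        then have "e (cover_map K u) \<in> carrier_mat K K" using e(1) by blast
        then show "t (cover_map K u) \<in> carrier_vec K" unfolding t_def
          by (rule mult_mat_vec_carrier) simp
      qed
      then obtain s :: "nat \<Rightarrow> complex \<Rightarrow> complex vec" where s: "\<forall>r\<in>{1..K}. s r \<in> sec (L r) W"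
        "\<forall>u\<in>W - {0}. t (cover_map K u) = Matrix.vec K (\<lambda>i. \<Sum>r\<in>{1..K}. s r u $ i)"
        using ds[unfolded filtered_direct_sum_def, rule_format, OF W, THEN conjunct1] by auto
      have "\<forall>r\<in>{1..K}. \<exists>c. s r u0 = c \<cdot>\<^sub>v v r u0"
      proof
        fix r assume r: "r \<in> {1..K}"
        have "W \<subseteq> ball 0 (\<epsilon> r) - {0}" using Wsub sub[OF _ r] by blast
        then show "\<exists>c. s r u0 = c \<cdot>\<^sub>v v r u0" 
          using Qs(6)[OF r, rule_format, OF oW _ bspec[OF s(1) r] u0W] by blast
      qed
      from bchoice[OF this] obtain c where c: "\<forall>r\<in>{1..K}. s r u0 = c r \<cdot>\<^sub>v v r u0" ..
      have "?E *\<^sub>v unit_vec K j = P u0 *\<^sub>v Matrix.vec K (\<lambda>r. c (Suc r))"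
      proof (rule eq_vecI)
        fix i assume "i < dim_vec (P u0 *\<^sub>v Matrix.vec K (\<lambda>r. c (Suc r)))"
        then have i: "i < K" by (simp add: P_def)
        have "(?E *\<^sub>v unit_vec K j) = Matrix.vec K (\<lambda>i. \<Sum>r\<in>{1..K}. s r u0 $ i)"
          using bspec[OF s(2), of u0, unfolded t_def \<psi>u0] u0W u0 by simp
        then have "(?E *\<^sub>v unit_vec K j) $ i = (\<Sum>r\<in>{1..K}. s r u0 $ i)" using i by simp
        also have "\<dots> = (\<Sum>r\<in>{1..K}. c r * v r u0 $ i)"
        proof (rule sum.cong[OF refl])
          fix r assume r: "r \<in> {1..K}"
          show "s r u0 $ i = c r * v r u0 $ i" using bspec[OF c r] carrier_vecD[OF vc[OF u0 r]] i by simp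
        qed
        also have "\<dots> = (\<Sum>r<K. c (Suc r) * v (Suc r) u0 $ i)"
          by (simp add: sum.atLeast1_atMost_eq)
        also have "\<dots> = (P u0 *\<^sub>v Matrix.vec K (\<lambda>r. c (Suc r))) $ i"
          using i by (simp add: P_def scalar_prod_def atLeast0LessThan mult.commute)
        finally show "(?E *\<^sub>v unit_vec K j) $ i = (P u0 *\<^sub>v Matrix.vec K (\<lambda>r. c (Suc r))) $ i" .
      qed (use Ec in \<open>simp add: P_def\<close>)
      then show "\<exists>c\<in>carrier_vec K. ?E *\<^sub>v unit_vec K j = P u0 *\<^sub>v c" by (intro bexI) auto
    qed
  qed
  define h' where "h' r u = - h (Suc r) u / (2 * of_nat K)" for r u
  show thesis
  proof (rule that[OF \<epsilon>0, of h'])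
    show "\<forall>r<K. h' r holomorphic_on ball 0 \<epsilon>0"
    proof (intro allI impI)
      fix r assume "r < K"
      then have r: "Suc r \<in> {1..K}" by simp
      from Qs(3)[OF r] have "h (Suc r) holomorphic_on ball 0 \<epsilon>0"
        by (rule holomorphic_on_subset) (use \<epsilon>0le[OF r] in auto)
      then show "h' r holomorphic_on ball 0 \<epsilon>0" unfolding h'_def[abs_def]
        by (intro holomorphic_intros) (use K in auto)
    qed
    show "\<forall>u\<in>ball 0 \<epsilon>0 - {0}. char_poly (higgs H (Some (1 / u ^ (2 * K)))) =
       (\<Prod>r<K. [:- (inverse (u ^ (2 * N)) * (unity_root K (Suc r) + u ^ (2 * N + 2 * K) * h' r u)), 1:])"
    proof
      fix u :: complex assume u: "u \<in> ball 0 \<epsilon>0 - {0}"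
      then have u0: "u \<noteq> 0" by auto
      define A where "A = higgs H (Some (1 / u ^ (2 * K)))"
      define \<kappa> where "\<kappa> = - 2 * of_nat K / u ^ (2 * K + 1)"
      have \<kappa>: "\<kappa> \<noteq> 0" using K u0 by (simp add: \<kappa>_def)
      have A: "A \<in> carrier_mat K K" using car by (simp add: A_def)
      show "char_poly (higgs H (Some (1 / u ^ (2 * K)))) =
       (\<Prod>r<K. [:- (inverse (u ^ (2 * N)) * (unity_root K (Suc r) + u ^ (2 * N + 2 * K) * h' r u)), 1:])"
        unfolding A_def[symmetric]
      proof (rule char_poly_of_eigenbasis[OF A Pc detP[OF u]])
        fix r assume r: "r < K"
        then have r': "Suc r \<in> {1..K}" by simp
        define y where "y = inverse (u ^ (2 * N)) * (unity_root K (Suc r) + u ^ (2 * N + 2 * K) * h' r u)"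
        have "\<Phi> u *\<^sub>v v (Suc r) u = (a (Suc r) u + h (Suc r) u / u) \<cdot>\<^sub>v v (Suc r) u"
          by (rule bspec[OF Qs(5)[OF r'] sub[OF u r']])
        moreover have "a (Suc r) u + h (Suc r) u / u = \<kappa> * y"
        proof -
          have p: "u ^ (2 * N + 2 * K + 1) = u ^ (2 * N) * u ^ (2 * K + 1)"
            "u ^ (2 * N + 2 * K) = u ^ (2 * N) * u ^ (2 * K)" by (simp_all add: power_add)
          show ?thesis unfolding a_def deriv_irregular_part[OF u0 K] \<kappa>_def y_def h'_def p
            using u0 K by (simp add: field_simps)
        qed
        moreover have "\<Phi> u *\<^sub>v v (Suc r) u = \<kappa> \<cdot>\<^sub>v (A *\<^sub>v v (Suc r) u)"
          unfolding \<Phi>_def pulled_back_higgs_nz[OF u0] A_def \<kappa>_def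
          by (rule smult_mat_mult_vec[OF car vc[OF u r']])
        ultimately have E: "\<kappa> \<cdot>\<^sub>v (A *\<^sub>v v (Suc r) u) = (\<kappa> * y) \<cdot>\<^sub>v v (Suc r) u" by simp
        have "A *\<^sub>v v (Suc r) u = y \<cdot>\<^sub>v v (Suc r) u"
        proof (rule eq_vecI)
          fix i assume "i < dim_vec (y \<cdot>\<^sub>v v (Suc r) u)"
          then have i: "i < K" using vc[OF u r'] by simp
          have "\<kappa> * (A *\<^sub>v v (Suc r) u) $ i = \<kappa> * y * v (Suc r) u $ i"
            using arg_cong[OF E, of "\<lambda>x. vec_index x i"] i vc[OF u r'] A by simp
          then have "(A *\<^sub>v v (Suc r) u) $ i = y * v (Suc r) u $ i" using \<kappa> by simp
          then show "(A *\<^sub>v v (Suc r) u) $ i = (y \<cdot>\<^sub>v v (Suc r) u) $ i" using i vc[OF u r'] by simp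
        qed (use A vc[OF u r'] in simp)
        then show "A *\<^sub>v col (P u) r = (inverse (u ^ (2 * N)) *
            (unity_root K (Suc r) + u ^ (2 * N + 2 * K) * h' r u)) \<cdot>\<^sub>v col (P u) r"
          unfolding colP[OF u r] y_def .
      qed
    qed
  qed
qed

section \<open>Characteristic polynomials of objects\<close>

text \<open>
  The characteristic polynomials that form the Hitchin base.
\<close>

definition base_poly :: "nat \<Rightarrow> nat \<Rightarrow> (nat \<Rightarrow> complex poly) \<Rightarrow> complex \<Rightarrow> complex poly" where
  "base_poly K N P z = (monom 1 K - [:z ^ N:]) + (\<Sum>i=2..K. monom (poly (P i) z) (K - i))"

lemma coeff_base_poly:
  assumes "K \<ge> 2"
  shows "coeff (base_poly K N P z) n = (if n = K then 1 else 0) - (if n = 0 then z ^ N else 0)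
     + (if n + 2 \<le> K then poly (P (K - n)) z else 0)"
proof -
  have "coeff (\<Sum>i=2..K. monom (poly (P i) z) (K - i)) n = (\<Sum>i=2..K. if i = K - n then (if n \<le> K then poly (P i) z else 0) else 0)"
    unfolding coeff_sum by (intro sum.cong) auto
  also have "\<dots> = (if n + 2 \<le> K then poly (P (K - n)) z else 0)"
    by (subst sum.delta) auto
  finally show ?thesis unfolding base_poly_def
    by (simp add: coeff_pCons split: nat.split)
qed

text \<open>
  The elementary symmetric functions of the roots of unity vanish except for the constant term, which gives \<open>z ^ N\<close>. The
  remaining part of the coefficient of \<open>\<lambda> ^ (K - i)\<close> is therefore \<open>u ^ (2 * N + 2 * K - 2 * N * i)\<close> times a holomorphic
  function, and with \<open>z = 1 / u ^ (2 * K)\<close> this growth is the stated bound on the degree. For \<open>i = 1\<close> the bound is negative.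
\<close>

lemma char_higgs_in_base:
  assumes K: "K \<ge> 2" and H: "H \<in> C_objects K N"
  shows "\<exists>P. (\<forall>i\<in>{2..K}. P i = 0 \<or> real (degree (P i)) \<le> real N * (real i - 1) / real K - 1) \<and>
     char_higgs H = base_poly K N P"
proof -
  have K1: "K \<ge> 1" using K by simp
  have S: "filtered_SL_Higgs_bundle K H" and good: "good_at_infinity K N H"
    using H by (simp_all add: C_objects_def)
  have fb: "filtered_bundle CP1 K K (underlying H)"
    and car0: "\<forall>z. higgs H (Some z) \<in> carrier_mat K K \<and> (\<Sum>i<K. higgs H (Some z) $$ (i, i)) = 0"
    and pres: "\<forall>U. openin (top_of CP1) U \<longrightarrow> (\<forall>s\<in>sec (underlying H) U.
        (\<lambda>q. higgs H q *\<^sub>v s q) \<in> sec (underlying H) U)"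
    using S unfolding filtered_SL_Higgs_bundle_def by simp_all
  have lf: "locally_free CP1 (mero CP1) K K (sec (underlying H))"
    using fb unfolding filtered_bundle_def by (rule conjunct1)
  have car: "higgs H (Some z) \<in> carrier_mat K K" for z using car0 by simp
  have ent: "(\<lambda>z. coeff (char_higgs H z) k) holomorphic_on UNIV" for k
    unfolding char_higgs_def
    by (rule char_higgs_entire[OF lf, where A = "higgs H"]) (use car pres in simp_all)
  obtain \<epsilon> h where \<epsilon>: "\<epsilon> > 0" and h: "\<forall>r<K. h r holomorphic_on ball 0 \<epsilon>"
    and cp: "\<forall>u\<in>ball 0 \<epsilon> - {0}. char_poly (higgs H (Some (1 / u ^ (2 * K)))) =
       (\<Prod>r<K. [:- (inverse (u ^ (2 * N)) * (unity_root K (Suc r) + u ^ (2 * N + 2 * K) * h r u)), 1:])"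
    by (rule eigenvalues_at_infinity[OF K1 lf car good])
  define D where "D i z = coeff (char_higgs H z) (K - i) + (if i = K then z ^ N else 0)" for i z
  have D: "\<exists>p. D i = poly p \<and> (p = 0 \<or> int (2 * K) * int (degree p) \<le> int (2 * N * i) - int (2 * N + 2 * K))"
    if i: "i \<in> {1..K}" for i
  proof -
    let ?M = "2 * N + 2 * K"
    have "\<exists>g. g holomorphic_on ball 0 \<epsilon> \<and> (\<forall>u\<in>ball 0 \<epsilon>.
        coeff (\<Prod>r<K. [:- (unity_root K (Suc r) + u ^ ?M * h r u), 1:]) (K - i) =
        coeff (\<Prod>r<K. [:- unity_root K (Suc r), 1:]) (K - i) + u ^ ?M * g u)"
      by (rule coeff_prod_perturbed_roots) (use h in auto)
    then obtain g where g: "g holomorphic_on ball 0 \<epsilon> \<and> (\<forall>u\<in>ball 0 \<epsilon>.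
        coeff (\<Prod>r<K. [:- (unity_root K (Suc r) + u ^ ?M * h r u), 1:]) (K - i) =
        coeff (\<Prod>r<K. [:- unity_root K (Suc r), 1:]) (K - i) + u ^ ?M * g u)" ..
    have unity: "coeff (\<Prod>r<K. [:- unity_root K (Suc r), 1:]) (K - i) = - (if i = K then 1 else 0)"
      unfolding prod_unity_roots[OF K1] using i by auto
    have eq: "D i (1 / u ^ (2 * K)) = u powi (int ?M - int (2 * N * i)) * g u"
      if u: "u \<in> ball 0 \<epsilon> - {0}" for u
    proof -
      have u0: "u \<noteq> 0" using u by auto
      define c where "c = inverse (u ^ (2 * N))"
      define w where "w r = unity_root K (Suc r) + u ^ ?M * h r u" for r
      have c0: "c \<noteq> 0" using u0 by (simp add: c_def)
      have "c ^ (K - i) * coeff (\<Prod>r<K. [:- (c * w r), 1:]) (K - i) =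
          c ^ K * coeff (\<Prod>r<K. [:- w r, 1:]) (K - i)"
        using coeff_prod_scaled_roots[of "{..<K}" c "K - i" w] by simp
      also have "c ^ K = c ^ (K - i) * c ^ i" using i by (simp add: power_add[symmetric])
      finally have "coeff (\<Prod>r<K. [:- (c * w r), 1:]) (K - i) = c ^ i * coeff (\<Prod>r<K. [:- w r, 1:]) (K - i)"
        using c0 by simp
      moreover have "char_higgs H (1 / u ^ (2 * K)) = (\<Prod>r<K. [:- (c * w r), 1:])"
        using bspec[OF cp u] by (simp add: char_higgs_def c_def w_def)
      moreover have "coeff (\<Prod>r<K. [:- w r, 1:]) (K - i) = - (if i = K then 1 else 0) + u ^ ?M * g u"
        unfolding w_def using g u unity by auto
      moreover have "(1 / u ^ (2 * K)) ^ N = c ^ K"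
        by (simp add: c_def power_inverse inverse_eq_divide power_one_over power_mult[symmetric] mult_ac)
      ultimately have "D i (1 / u ^ (2 * K)) = c ^ i * u ^ ?M * g u"
        unfolding D_def by (auto simp: algebra_simps)
      also have "c ^ i * u ^ ?M = u powi (int ?M - int (2 * N * i))"
      proof -
        have "c ^ i = inverse (u ^ (2 * N * i))" unfolding c_def power_inverse power_mult ..
        moreover have "u powi (int ?M - int (2 * N * i)) = u ^ ?M / u ^ (2 * N * i)"
          unfolding power_int_of_nat[symmetric] by (rule power_int_diff) (use u0 in simp)
        ultimately show ?thesis by (simp only: divide_inverse mult.commute[of "inverse _"])
      qed
      finally show ?thesis by (simp add: mult.assoc)
    qed
    have Dh: "D i holomorphic_on UNIV" unfolding D_def[abs_def]
      by (cases "i = K") (auto intro!: holomorphic_intros ent)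
    have m: "2 * K \<ge> 1" using K by simp
    obtain p where "D i = poly p"
      "p = 0 \<or> int (2 * K) * int (degree p) \<le> - (int ?M - int (2 * N * i))"
      by (rule entire_of_polynomial_growth[OF Dh m \<epsilon> conjunct1[OF g] eq])
    then show ?thesis by (intro exI[of _ p]) simp
  qed
  then have "\<forall>i\<in>{1..K}. \<exists>p. D i = poly p \<and> (p = 0 \<or> int (2 * K) * int (degree p) \<le> int (2 * N * i) - int (2 * N + 2 * K))"
    by blast
  from bchoice[OF this] obtain P where
    P: "\<forall>i\<in>{1..K}. D i = poly (P i) \<and> (P i = 0 \<or> int (2 * K) * int (degree (P i)) \<le> int (2 * N * i) - int (2 * N + 2 * K))" ..
  have P1: "D 1 z = 0" for z
  proof -
    have "P 1 = 0"
    proof (rule ccontr)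
      assume "P 1 \<noteq> 0"
      then have "int (2 * K) * int (degree (P 1)) \<le> int (2 * N * 1) - int (2 * N + 2 * K)" using P K by auto
      then have "int (2 * K) * int (degree (P 1)) < 0" using K by simp
      then show False by (simp add: mult_less_0_iff)
    qed
    then show ?thesis using P K by auto
  qed
  have deg: "real (degree (P i)) \<le> real N * (real i - 1) / real K - 1" if i: "i \<in> {2..K}" "P i \<noteq> 0" for i
  proof -
    have "int (2 * K) * int (degree (P i)) \<le> int (2 * N * i) - int (2 * N + 2 * K)" using P i by auto
    then have "real_of_int (int (2 * K) * int (degree (P i))) \<le> real_of_int (int (2 * N * i) - int (2 * N + 2 * K))"
      by (simp only: of_int_le_iff)
    then have "real K * real (degree (P i)) \<le> real N * (real i - 1) - real K" by (simp add: algebra_simps)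
    then show ?thesis using K by (simp add: field_simps)
  qed
  have "char_higgs H = base_poly K N P"
  proof (rule ext, rule poly_eqI)
    fix z n
    have mon: "degree (char_higgs H z) = K" "coeff (char_higgs H z) K = 1"
      using degree_monic_char_poly[OF car] by (simp_all add: char_higgs_def)
    consider "n > K" | "n = K" | "n = K - 1" "n \<noteq> K" | "n + 2 \<le> K" by linarith
    then show "coeff (char_higgs H z) n = coeff (base_poly K N P z) n"
    proof cases
      case 1
      then show ?thesis using mon K by (simp add: coeff_base_poly coeff_eq_0)
    next
      case 2
      then show ?thesis using mon K by (simp add: coeff_base_poly)
    next
      case 3
      then show ?thesis using P1[of z] K by (simp add: coeff_base_poly D_def)
    next
      case 4
      then have i: "K - n \<in> {1..K}" "K - (K - n) = n" "K - n = K \<longleftrightarrow> n = 0" using K by auto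
      have "D (K - n) z = poly (P (K - n)) z" using P i(1) by simp
      then show ?thesis using 4 K unfolding D_def i(2,3) by (auto simp: coeff_base_poly algebra_simps)
    qed
  qed
  moreover have "\<forall>i\<in>{2..K}. P i = 0 \<or> real (degree (P i)) \<le> real N * (real i - 1) / real K - 1"
    using deg by blast
  ultimately show ?thesis by (intro exI[of _ P] conjI)
qed

section \<open>The companion object\<close>

lemma (in coordinate_curve) mem_standard_span:
  assumes U: "openin (top_of X) U"
    and cong: "\<And>j f g. f \<in> T j U \<Longrightarrow> (\<And>q. q \<in> U - {pt X} \<Longrightarrow> g q = f q) \<Longrightarrow> g \<in> T j U"
  shows "s \<in> frame_span X d (\<lambda>_. 1\<^sub>m d) T U \<longleftrightarrow>
    (\<forall>q\<in>U - {pt X}. s q \<in> carrier_vec d) \<and> (\<forall>j<d. (\<lambda>q. s q $ j) \<in> T j U)"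
proof
  assume "s \<in> frame_span X d (\<lambda>_. 1\<^sub>m d) T U"
  then obtain f where f: "\<forall>j<d. f j \<in> T j U"
    "\<forall>q\<in>U - {pt X}. s q = 1\<^sub>m d *\<^sub>v Matrix.vec d (\<lambda>j. f j q)" by (rule frame_spanE)
  have s: "s q = Matrix.vec d (\<lambda>j. f j q)" if "q \<in> U - {pt X}" for q
    using bspec[OF f(2) that] by simp
  have "(\<lambda>q. s q $ j) \<in> T j U" if j: "j < d" for j
    by (rule cong[OF f(1)[rule_format, OF j]]) (simp add: s j)
  then show "(\<forall>q\<in>U - {pt X}. s q \<in> carrier_vec d) \<and> (\<forall>j<d. (\<lambda>q. s q $ j) \<in> T j U)"
    by (simp add: s)
next
  assume a: "(\<forall>q\<in>U - {pt X}. s q \<in> carrier_vec d) \<and> (\<forall>j<d. (\<lambda>q. s q $ j) \<in> T j U)"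
  show "s \<in> frame_span X d (\<lambda>_. 1\<^sub>m d) T U"
  proof (rule frame_spanI[where f = "\<lambda>j q. s q $ j"])
    fix q assume "q \<in> U - {pt X}"
    then have "s q \<in> carrier_vec d" using a by blast
    then show "s q = 1\<^sub>m d *\<^sub>v Matrix.vec d (\<lambda>j. s q $ j)" by (intro eq_vecI) auto
  qed (use a in simp)
qed

lemma (in coordinate_curve) framed_curve_standard:
  "pt X \<in> topspace (top_of X) \<Longrightarrow> framed_curve X U0 d d (\<lambda>_. 1\<^sub>m d)"
  by unfold_locales auto

lemma (in coordinate_curve) mem_sec_standard:
  assumes "openin (top_of X) U"
  shows "s \<in> sec (framed_sheaf X d (\<lambda>_. 1\<^sub>m d) a) U \<longleftrightarrow>
    (\<forall>q\<in>U - {pt X}. s q \<in> carrier_vec d) \<and> (\<forall>j<d. (\<lambda>q. s q $ j) \<in> mero X U)"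
  unfolding framed_sheaf_def filtered_sheaf.simps
  by (rule mem_standard_span[OF assms]) (rule mero_cong[OF assms])

lemma (in coordinate_curve) mem_fil_standard:
  assumes "openin (top_of X) U"
  shows "s \<in> fil (framed_sheaf X d (\<lambda>_. 1\<^sub>m d) a) \<alpha> U \<longleftrightarrow>
    (\<forall>q\<in>U - {pt X}. s q \<in> carrier_vec d) \<and> (\<forall>j<d. (\<lambda>q. s q $ j) \<in> pole_le X \<lfloor>\<alpha> - a j\<rfloor> U)"
  unfolding framed_sheaf_def filtered_sheaf.simps
  by (rule mem_standard_span[OF assms]) (rule pole_le_cong[OF assms])

lemma poly_mero_CP1:
  assumes U: "openin (top_of CP1) U"
  shows "(\<lambda>q. case q of None \<Rightarrow> 0 | Some z \<Rightarrow> poly p z) \<in> mero CP1 U" (is "?f \<in> _")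
  unfolding mero_def mem_Collect_eq
proof (intro conjI impI)
  show "?f \<in> hol CP1 (U - {pt CP1})" by (auto simp: mem_hol_CP1 intro!: holomorphic_intros)
  assume "pt CP1 \<in> U"
  define V where "V = U \<inter> (UNIV - {Some 0})"
  define g where "g q = poly (reflect_poly p) (coord CP1 q)" for q
  have g: "g \<in> hol CP1 V"
  proof -
    have "(\<lambda>z. g (Some z)) = (\<lambda>z. poly (reflect_poly p) (1 / z))" by (simp add: g_def)
    moreover have "(\<lambda>z. poly (reflect_poly p) (1 / z)) holomorphic_on {z. Some z \<in> V}"
      by (intro holomorphic_intros) (auto simp: V_def)
    moreover have "(\<lambda>x. g (if x = 0 then None else Some (1 / x))) = poly (reflect_poly p)"
      by (auto simp: g_def)
    moreover have "poly (reflect_poly p) analytic_on {0}"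
      by (rule analytic_on_subset[of _ UNIV])
        (auto simp: analytic_on_open intro!: holomorphic_intros)
    ultimately show ?thesis unfolding mem_hol_CP1 by simp
  qed
  have V: "openin (top_of CP1) V" "pt CP1 \<in> V" "V \<subseteq> U"
    using U openin_CP1_delete[of 0] \<open>pt CP1 \<in> U\<close> by (auto simp: V_def)
  have "g q = coord CP1 q ^ degree p * ?f q" if q: "q \<in> V - {pt CP1}" for q
  proof -
    obtain z where z: "q = Some z" using q by (cases q) auto
    then have "z \<noteq> 0" using q by (auto simp: V_def)
    with z show ?thesis using poly_reflect_poly_nz[of "1 / z" p] by (simp add: g_def)
  qed
  then show "\<exists>V n. \<exists>g\<in>hol CP1 V. CP1.opn V \<and> pt CP1 \<in> V \<and> V \<subseteq> U \<and>
     (\<forall>q\<in>V - {pt CP1}. g q = coord CP1 q ^ n * ?f q)"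
    by (intro exI[of _ V] exI[of _ "degree p"] bexI[OF _ g]) (use V in simp)
qed

text \<open>
  The vector \<open>(1, y, ..., y ^ (K - 1))\<close> with \<open>y = w / u ^ (2 * N)\<close>, multiplied by \<open>u powi (N * (K - 1))\<close>, has the entries
  \<open>u powi weight K N j * w ^ j\<close>. Hence the lattice spanned by the eigenvectors at infinity is spanned by the
  standard basis vectors times \<open>u powi weight K N j\<close>. The power of \<open>u\<close> in front makes the weights add up to zero, so that
  the standard volume form has order zero.
\<close>

definition weight :: "nat \<Rightarrow> nat \<Rightarrow> nat \<Rightarrow> int" where
  "weight K N j = int N * (int K - 1 - 2 * int j)"

text \<open>
  The division by \<open>2 * K\<close> converts orders in \<open>u\<close> into orders in the coordinate at infinity.
\<close>

definition model_sheaf :: "nat \<Rightarrow> nat \<Rightarrow> complex option filtered_sheaf" where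
  "model_sheaf K N = framed_sheaf CP1 K (\<lambda>_. 1\<^sub>m K) (\<lambda>j. of_int (weight K N j) / (2 * real K))"

text \<open>
  The standard volume form in components: the sign of \<open>js\<close> as a permutation, or zero.
\<close>

definition model_vol :: "nat \<Rightarrow> complex option \<Rightarrow> nat list \<Rightarrow> complex" where
  "model_vol K q js = det (mat K K (\<lambda>(i, j). if js ! i = j then 1 else 0))"

definition model_higgs :: "nat \<Rightarrow> (complex \<Rightarrow> complex poly) \<Rightarrow> complex option \<Rightarrow> complex mat" where
  "model_higgs K F q = (case q of None \<Rightarrow> 0\<^sub>m K K | Some z \<Rightarrow> companion K (coeff (F z)))"

definition model :: "nat \<Rightarrow> nat \<Rightarrow> (complex \<Rightarrow> complex poly) \<Rightarrow> higgs_bundle" where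
  "model K N F = \<lparr>underlying = model_sheaf K N, vol = model_vol K, higgs = model_higgs K F\<rparr>"

lemma sum_weight: "(\<Sum>j<K. weight K N j) = 0"
proof -
  have "(\<Sum>j<n. int K - 1 - 2 * int j) = int n * (int K - int n)" for n
    by (induction n) (simp_all add: algebra_simps)
  from this[of K] show ?thesis unfolding weight_def by (simp add: sum_distrib_left[symmetric])
qed

lemma filtered_bundle_model: "filtered_bundle CP1 K K (model_sheaf K N)"
proof -
  interpret framed_curve CP1 "UNIV - {Some 0}" K K "\<lambda>_. 1\<^sub>m K"
    by (rule CP1.framed_curve_standard) simp
  show ?thesis unfolding model_sheaf_def by (rule framed_sheaf_filtered_bundle)
qed

lemma model_vol_permute:
  assumes "\<pi> permutes {..<K}" "js \<in> indices K"
  shows "model_vol K q (permute_list \<pi> js) = of_int (sign \<pi>) * model_vol K q js"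
proof -
  let ?A = "mat K K (\<lambda>(i, j). if js ! i = j then 1 else 0) :: complex mat"
  have \<pi>: "\<pi> permutes {0..<K}" using assms(1) by (simp add: atLeast0LessThan)
  have len: "length js = K" using assms(2) by (simp add: indices_def)
  have "mat K K (\<lambda>(i, j). if permute_list \<pi> js ! i = j then 1 else 0) =
      mat K K (\<lambda>(i, j). ?A $$ (\<pi> i, j))"
  proof (rule eq_matI)
    fix i j assume "i < dim_row (mat K K (\<lambda>(i, j). ?A $$ (\<pi> i, j)))" "j < dim_col (mat K K (\<lambda>(i, j). ?A $$ (\<pi> i, j)))"
    then have ij: "i < K" "j < K" by auto
    have "\<pi> i < K" using permutes_in_image[OF \<pi>, of i] ij by simp
    then show "mat K K (\<lambda>(i, j). if permute_list \<pi> js ! i = j then 1 else 0) $$ (i, j) =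
        mat K K (\<lambda>(i, j). ?A $$ (\<pi> i, j)) $$ (i, j)"
      using ij permute_list_nth[of \<pi> js i] assms(1) len by simp
  qed auto
  then show ?thesis unfolding model_vol_def using det_permute_rows[of ?A K \<pi>] \<pi> by simp
qed

text \<open>
  The Leibniz expansion of the determinant is a sum of pure tensors of basis vectors. In each of them every basis
  vector occurs once, so its order is the sum of all weights.
\<close>

lemma model_vol_tensor:
  assumes K: "K \<ge> 1" and U: "openin (top_of CP1) U"
  shows "model_vol K \<in> tensor_fil CP1 K (model_sheaf K N) 0 U"
    and "model_vol K \<in> tensor_sec CP1 K (model_sheaf K N) U"
proof -
  let ?P = "{p. p permutes {0..<K}}"
  let ?a = "\<lambda>j. of_int (weight K N j) / (2 * real K)"
  have fin: "finite ?P" by (rule finite_permutations) simp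
  obtain p where p: "bij_betw p {0..<card ?P} ?P" using ex_bij_betw_nat_finite[OF fin] by blast
  have pP: "p k permutes {0..<K}" if "k < card ?P" for k
    using bij_betwE[OF p] that by auto
  \<comment> \<open>the sign of the permutation is carried by the first tensor factor\<close>
  define s where "s k j = (\<lambda>q :: complex option. (if j = 0 then of_int (sign (p k)) else 1) \<cdot>\<^sub>v unit_vec K (p k j) :: complex vec)" for k j
  define \<beta> where "\<beta> k j = ?a (p k j)" for k j
  have pj: "p k j < K" if "k < card ?P" "j < K" for k j
    using permutes_in_image[OF pP[OF that(1)], of j] that(2) by simp
  have sfil: "s k j \<in> fil (model_sheaf K N) (\<beta> k j) U" if k: "k < card ?P" and j: "j < K" for k j
    unfolding model_sheaf_def CP1.mem_fil_standard[OF U]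
  proof (intro conjI ballI allI impI)
    fix i assume i: "i < K"
    show "(\<lambda>q. s k j q $ i) \<in> pole_le CP1 \<lfloor>\<beta> k j - ?a i\<rfloor> U"
    proof (cases "i = p k j")
      case True
      then show ?thesis using CP1.pole_le_const[OF U] i by (simp add: s_def \<beta>_def)
    next
      case False
      then show ?thesis using CP1.pole_le_zero[OF U] i pj[OF k j] by (simp add: s_def)
    qed
  qed (simp add: s_def)
  have sum\<beta>: "(\<Sum>j<K. \<beta> k j) = 0" if "k < card ?P" for k
  proof -
    have "(\<Sum>j<K. \<beta> k j) = (\<Sum>j<K. ?a j)" unfolding \<beta>_def
      using sum.permute[OF pP[OF that], of ?a] by (simp add: atLeast0LessThan comp_def)
    also have "\<dots> = of_int (\<Sum>j<K. weight K N j) / (2 * real K)" by (simp add: sum_divide_distrib)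
    finally show ?thesis by (simp add: sum_weight)
  qed
  have expand: "model_vol K q js = (\<Sum>k<card ?P. \<Prod>j<K. s k j q $ (js ! j))" if js: "js \<in> indices K" for q js
  proof -
    have jsK: "js ! j < K" if "j < K" for j
    proof -
      have "js ! j \<in> set js" using js that by (intro nth_mem) (simp add: indices_def)
      then show ?thesis using js by (auto simp: indices_def)
    qed
    have "model_vol K q js = (\<Sum>\<sigma>\<in>?P. of_int (sign \<sigma>) * (\<Prod>j = 0..<K. if js ! j = \<sigma> j then 1 else 0))"
    proof -
      let ?A = "mat K K (\<lambda>(i, j). if js ! i = j then 1 else 0) :: complex mat"
      have "?A $$ (j, \<sigma> j) = (if js ! j = \<sigma> j then 1 else 0)" if "\<sigma> \<in> ?P" "j \<in> {0..<K}" for \<sigma> j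
        using permutes_in_image[of \<sigma> "{0..<K}" j] that by simp
      then have e: "(\<Prod>j = 0..<K. ?A $$ (j, \<sigma> j)) = (\<Prod>j = 0..<K. if js ! j = \<sigma> j then 1 else 0)"
        if "\<sigma> \<in> ?P" for \<sigma>
        using that by (intro prod.cong) auto
      have "det ?A = (\<Sum>\<sigma>\<in>?P. of_int (sign \<sigma>) * (\<Prod>j = 0..<K. ?A $$ (j, \<sigma> j)))"
        by (rule det_def') simp
      also have "\<dots> = (\<Sum>\<sigma>\<in>?P. of_int (sign \<sigma>) * (\<Prod>j = 0..<K. if js ! j = \<sigma> j then 1 else 0))"
        by (rule sum.cong[OF refl]) (simp only: e)
      finally show ?thesis unfolding model_vol_def .
    qed
    also have "\<dots> = (\<Sum>k<card ?P. of_int (sign (p k)) * (\<Prod>j = 0..<K. if js ! j = p k j then 1 else 0))"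
      using sum.reindex_bij_betw[OF p, symmetric] by (simp add: atLeast0LessThan)
    also have "\<dots> = (\<Sum>k<card ?P. \<Prod>j<K. s k j q $ (js ! j))"
    proof (rule sum.cong[OF refl])
      fix k assume "k \<in> {..<card ?P}"
      then have k: "k < card ?P" by simp
      have "(\<Prod>j<K. s k j q $ (js ! j)) =
         (\<Prod>j<K. (if j = 0 then of_int (sign (p k)) else 1) * (if js ! j = p k j then 1 else 0))"
        by (rule prod.cong[OF refl]) (use jsK pj[OF k] in \<open>auto simp: s_def\<close>)
      also have "\<dots> = (\<Prod>j<K. if j = 0 then of_int (sign (p k)) else 1) * (\<Prod>j<K. if js ! j = p k j then 1 else 0)"
        by (rule prod.distrib)
      also have "(\<Prod>j<K. if j = 0 then of_int (sign (p k)) else (1::complex)) = of_int (sign (p k))"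
        using K by (subst prod.delta) auto
      finally show "of_int (sign (p k)) * (\<Prod>j = 0..<K. if js ! j = p k j then 1 else 0) = (\<Prod>j<K. s k j q $ (js ! j))"
        by (simp add: atLeast0LessThan)
    qed
    finally show ?thesis .
  qed
  show "model_vol K \<in> tensor_fil CP1 K (model_sheaf K N) 0 U"
    unfolding tensor_fil_def mem_Collect_eq
  proof (intro ballI, rule exI[of _ U], intro conjI)
    show "\<exists>(n::nat) s \<beta>. (\<forall>k<n. (\<Sum>j<K. \<beta> k j) = 0 \<and> (\<forall>j<K. s k j \<in> fil (model_sheaf K N) (\<beta> k j) U)) \<and>
       (\<forall>q\<in>U - {pt CP1}. \<forall>js\<in>indices K. model_vol K q js = (\<Sum>k<n. \<Prod>j<K. s k j q $ (js ! j)))"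
    proof (rule exI[of _ "card ?P"], rule exI[of _ s], rule exI[of _ \<beta>], intro conjI allI impI ballI)
      show "(\<Sum>j<K. \<beta> k j) = 0" if "k < card ?P" for k by (rule sum\<beta>[OF that])
      show "s k j \<in> fil (model_sheaf K N) (\<beta> k j) U" if "k < card ?P" "j < K" for k j
        by (rule sfil[OF that])
      show "model_vol K q js = (\<Sum>k<card ?P. \<Prod>j<K. s k j q $ (js ! j))" if "js \<in> indices K" for q js
        by (rule expand[OF that])
    qed
  qed (use U in simp_all)
  have "fil (model_sheaf K N) \<alpha> U \<subseteq> sec (model_sheaf K N) U" for \<alpha>
    by (rule filtered_bundle_model[of K N, unfolded filtered_bundle_def, THEN conjunct2, THEN conjunct2,
          THEN conjunct1, rule_format, OF U])
  then have ssec: "s k j \<in> sec (model_sheaf K N) U" if "k < card ?P" "j < K" for k j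
    using sfil[OF that] by blast
  show "model_vol K \<in> tensor_sec CP1 K (model_sheaf K N) U"
    unfolding tensor_sec_def mem_Collect_eq
  proof (intro ballI, rule exI[of _ U], intro conjI)
    show "\<exists>(n::nat) s. (\<forall>k<n. \<forall>j<K. s k j \<in> sec (model_sheaf K N) U) \<and>
       (\<forall>q\<in>U - {pt CP1}. \<forall>js\<in>indices K. model_vol K q js = (\<Sum>k<n. \<Prod>j<K. s k j q $ (js ! j)))"
    proof (rule exI[of _ "card ?P"], rule exI[of _ s], intro conjI allI impI ballI)
      show "s k j \<in> sec (model_sheaf K N) U" if "k < card ?P" "j < K" for k j
        by (rule ssec[OF that])
      show "model_vol K q js = (\<Sum>k<card ?P. \<Prod>j<K. s k j q $ (js ! j))" if "js \<in> indices K" for q js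
        by (rule expand[OF that])
    qed
  qed (use U in simp_all)
qed

lemma one_not_pole_le_minus_one:
  assumes "openin (top_of CP1) V" "None \<in> V"
  shows "(\<lambda>_. 1) \<notin> pole_le CP1 (- 1) V"
proof
  assume a: "(\<lambda>_. 1) \<in> pole_le CP1 (- 1) V"
  have "pt CP1 \<in> V" using assms(2) by simp
  obtain W g where W: "CP1.opn W" "pt CP1 \<in> W" "W \<subseteq> V" "W \<subseteq> UNIV - {Some 0}" "g \<in> hol CP1 W"
    "\<forall>q\<in>W - {pt CP1}. g q = coord CP1 q powi (- 1) * 1"
    by (rule CP1.pole_le_nearE[OF a \<open>pt CP1 \<in> V\<close> assms(1)])
  define G where "G x = g (if x = 0 then None else Some (1 / x))" for x :: complex
  have "G analytic_on {0}" using W(2,5) unfolding G_def mem_hol_CP1 by simp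
  then have "isCont G 0" by (rule analytic_at_imp_isCont)
  then have lim: "((\<lambda>x. x * G x) \<longlongrightarrow> 0 * G 0) (at 0)"
    by (intro tendsto_intros) (simp add: isCont_def)
  have "None \<in> W" using W(2) by simp
  from openin_CP1_at_infinity[OF W(1) this] obtain r where r: "r > 0"
    "\<forall>x. x \<noteq> 0 \<longrightarrow> cmod x < r \<longrightarrow> Some (1 / x) \<in> W" .
  have ev: "\<forall>\<^sub>F x in at 0. x \<in> ball (0 :: complex) r - {0}"
    by (rule eventually_at_in_open) (use r in auto)
  have "\<forall>\<^sub>F x in at 0. x * G x = 1"
    using ev
  proof eventually_elim
    case (elim x)
    then have x: "x \<noteq> 0" "Some (1 / x) \<in> W" using r(2) by auto
    then have "g (Some (1 / x)) = coord CP1 (Some (1 / x)) powi (- 1) * 1" using W(6) by simp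
    then show ?case using x by (simp add: G_def)
  qed
  then have "((\<lambda>x. 1) \<longlongrightarrow> 0 * G 0) (at (0 :: complex))" by (rule Lim_transform_eventually[OF lim])
  from tendsto_unique[OF trivial_limit_at tendsto_const this] show False by simp
qed

text \<open>
  A representation of order \<open>\<alpha> < 0\<close> would write the diagonal component of the volume form, which is the constant \<open>1\<close>, as
  a sum of products of functions whose pole orders add up to less than zero, so that it would vanish at
  infinity.
\<close>

lemma ext_order_model_vol:
  assumes K: "K \<ge> 1"
  shows "ext_order CP1 K (model_sheaf K N) (model_vol K) = 0"
proof -
  let ?a = "\<lambda>j. of_int (weight K N j) / (2 * real K)"
  let ?S = "{ereal \<alpha> |\<alpha>. \<exists>U. openin (top_of CP1) U \<and> pt CP1 \<in> U \<and>
      model_vol K \<in> ext_fil CP1 K (model_sheaf K N) \<alpha> U}"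
  have "(0 :: ereal) \<in> ?S"
  proof -
    have UN: "openin (top_of CP1) UNIV" using openin_topspace[of "top_of CP1"] by simp
    have "model_vol K \<in> ext_fil CP1 K (model_sheaf K N) 0 UNIV"
      unfolding ext_fil_def mem_Collect_eq antisymmetric_def
      by (intro conjI ballI allI impI model_vol_permute model_vol_tensor(1)[OF K UN])
    then have "\<exists>U. openin (top_of CP1) U \<and> pt CP1 \<in> U \<and> model_vol K \<in> ext_fil CP1 K (model_sheaf K N) 0 U"
      using UN by (intro exI[of _ UNIV] conjI) simp_all
    then show ?thesis unfolding zero_ereal_def by (intro CollectI exI[of _ 0] conjI refl)
  qed
  moreover have "0 \<le> x" if "x \<in> ?S" for x
  proof -
    obtain \<alpha> U where x: "x = ereal \<alpha>" and U: "openin (top_of CP1) U" "pt CP1 \<in> U"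
      and "model_vol K \<in> ext_fil CP1 K (model_sheaf K N) \<alpha> U"
      using \<open>x \<in> ?S\<close> unfolding mem_Collect_eq by (elim exE conjE)
    then have vol: "model_vol K \<in> tensor_fil CP1 K (model_sheaf K N) \<alpha> U" by (simp add: ext_fil_def)
    have "\<alpha> \<ge> 0"
    proof (rule ccontr)
      assume neg: "\<not> \<alpha> \<ge> 0"
      obtain V and n :: nat and s :: "nat \<Rightarrow> nat \<Rightarrow> complex option \<Rightarrow> complex vec"
        and \<beta> :: "nat \<Rightarrow> nat \<Rightarrow> real" where V: "openin (top_of CP1) V" "pt CP1 \<in> V"
        and s: "\<forall>k<n. (\<Sum>j<K. \<beta> k j) = \<alpha> \<and> (\<forall>j<K. s k j \<in> fil (model_sheaf K N) (\<beta> k j) V)"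
        and e: "\<forall>q\<in>V - {pt CP1}. \<forall>js\<in>indices K. model_vol K q js = (\<Sum>k<n. \<Prod>j<K. s k j q $ (js ! j))"
      proof -
        have "\<forall>p\<in>U. \<exists>V. openin (top_of CP1) V \<and> p \<in> V \<and> V \<subseteq> U \<and>
           (\<exists>(n::nat) s \<beta>. (\<forall>k<n. (\<Sum>j<K. \<beta> k j) = \<alpha> \<and> (\<forall>j<K. s k j \<in> fil (model_sheaf K N) (\<beta> k j) V)) \<and>
              (\<forall>q\<in>V - {pt CP1}. \<forall>js\<in>indices K. model_vol K q js = (\<Sum>k<n. \<Prod>j<K. s k j q $ (js ! j))))"
          using vol unfolding tensor_fil_def mem_Collect_eq .
        from bspec[OF this U(2)] show thesis by (elim exE conjE) (rule that)
      qed
      have id: "[0..<K] \<in> indices K" by (auto simp: indices_def)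
      have "mat K K (\<lambda>(i, j). if [0..<K] ! i = j then 1 else 0) = (1\<^sub>m K :: complex mat)"
        by (intro eq_matI) auto
      then have one: "model_vol K q [0..<K] = 1" for q by (simp add: model_vol_def)
      have "(\<lambda>q. \<Sum>k<n. \<Prod>j<K. s k j q $ j) \<in> pole_le CP1 (- 1) V"
      proof (rule CP1.pole_le_sum[OF V(1)])
        fix k assume "k \<in> {..<n}"
        then have k: "(\<Sum>j<K. \<beta> k j) = \<alpha>" "\<forall>j<K. s k j \<in> fil (model_sheaf K N) (\<beta> k j) V" using s by auto
        have "(\<lambda>q. \<Prod>j<K. s k j q $ j) \<in> pole_le CP1 (\<Sum>j<K. \<lfloor>\<beta> k j - ?a j\<rfloor>) V"
        proof (rule CP1.pole_le_prod[OF V(1)])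
          fix j assume "j \<in> {..<K}"
          then show "(\<lambda>q. s k j q $ j) \<in> pole_le CP1 \<lfloor>\<beta> k j - ?a j\<rfloor> V"
            using k(2) unfolding model_sheaf_def CP1.mem_fil_standard[OF V(1)] by simp
        qed
        moreover have "(\<Sum>j<K. \<lfloor>\<beta> k j - ?a j\<rfloor>) \<le> - 1"
        proof -
          have "real_of_int (\<Sum>j<K. \<lfloor>\<beta> k j - ?a j\<rfloor>) \<le> (\<Sum>j<K. \<beta> k j - ?a j)"
            unfolding of_int_sum by (intro sum_mono) simp
          also have "\<dots> = \<alpha> - of_int (\<Sum>j<K. weight K N j) / (2 * real K)"
            by (simp add: sum_subtractf k(1) sum_divide_distrib)
          also have "\<dots> < 0" using neg by (simp add: sum_weight)
          finally have "(\<Sum>j<K. \<lfloor>\<beta> k j - ?a j\<rfloor>) < 0" by (simp only: of_int_less_0_iff)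
          then show ?thesis by linarith
        qed
        ultimately show "(\<lambda>q. \<Prod>j<K. s k j q $ j) \<in> pole_le CP1 (- 1) V"
          by (rule CP1.pole_le_mono[OF V(1)])
      qed
      then have "(\<lambda>_. 1) \<in> pole_le CP1 (- 1) V"
      proof (rule CP1.pole_le_cong[OF V(1)])
        fix q assume q: "q \<in> V - {pt CP1}"
        have "1 = (\<Sum>k<n. \<Prod>j<K. s k j q $ ([0..<K] ! j))" using bspec[OF bspec[OF e q] id] one by simp
        also have "\<dots> = (\<Sum>k<n. \<Prod>j<K. s k j q $ j)" by (intro sum.cong prod.cong) auto
        finally show "1 = (\<Sum>k<n. \<Prod>j<K. s k j q $ j)" .
      qed
      then show False using one_not_pole_le_minus_one[OF V(1)] V(2) by simp
    qed
    then show ?thesis unfolding x by simp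
  qed
  ultimately show ?thesis unfolding ext_order_def by (intro antisym Inf_lower Inf_greatest)
qed

lemma SL_structure_model:
  assumes K: "K \<ge> 1" shows "SL_structure CP1 K (model_sheaf K N) (model_vol K)"
  unfolding SL_structure_def
proof (intro conjI ballI)
  show "model_vol K \<in> ext_sec CP1 K (model_sheaf K N) (topspace (top_of CP1))"
    unfolding ext_sec_def mem_Collect_eq antisymmetric_def
    by (intro conjI ballI allI impI model_vol_permute model_vol_tensor(2)[OF K openin_topspace])
  fix q
  have "mat K K (\<lambda>(i, j). if [0..<K] ! i = j then 1 else 0) = (1\<^sub>m K :: complex mat)"
    by (intro eq_matI) auto
  then have "model_vol K q [0..<K] \<noteq> 0" by (simp add: model_vol_def)
  moreover have "[0..<K] \<in> indices K" by (auto simp: indices_def)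
  ultimately show "\<exists>js\<in>indices K. model_vol K q js \<noteq> 0" by (intro bexI)
qed (rule ext_order_model_vol[OF K])

lemma filtered_SL_Higgs_bundle_model:
  assumes K: "K \<ge> 2"
  shows "filtered_SL_Higgs_bundle K (model K N (base_poly K N P))"
  unfolding filtered_SL_Higgs_bundle_def model_def higgs_bundle.simps
proof (intro conjI allI impI ballI filtered_bundle_model)
  let ?F = "base_poly K N P"
  show "SL_structure CP1 K (model_sheaf K N) (model_vol K)" by (rule SL_structure_model) (use K in simp)
  show car: "model_higgs K ?F (Some z) \<in> carrier_mat K K" for z by (simp add: model_higgs_def)
  show "(\<Sum>i<K. model_higgs K ?F (Some z) $$ (i, i)) = 0" for z
  proof -
    have "(\<Sum>i<K. model_higgs K ?F (Some z) $$ (i, i)) = (\<Sum>i<K. if i = K - 1 then - coeff (?F z) (K - 1) else 0)"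
      by (intro sum.cong) (auto simp: model_higgs_def companion_def)
    also have "\<dots> = - coeff (?F z) (K - 1)" using K by (subst sum.delta) auto
    also have "\<dots> = 0" using K by (simp add: coeff_base_poly)
    finally show ?thesis .
  qed
  fix U s assume U: "openin (top_of CP1) U" and s: "s \<in> sec (model_sheaf K N) U"
  have sc: "\<forall>q\<in>U - {pt CP1}. s q \<in> carrier_vec K" and sm: "\<forall>j<K. (\<lambda>q. s q $ j) \<in> mero CP1 U"
    using s unfolding model_sheaf_def CP1.mem_sec_standard[OF U] by simp_all
  show "(\<lambda>q. model_higgs K ?F q *\<^sub>v s q) \<in> sec (model_sheaf K N) U"
    unfolding model_sheaf_def CP1.mem_sec_standard[OF U]
  proof (intro conjI ballI allI impI)
    show "model_higgs K ?F q *\<^sub>v s q \<in> carrier_vec K" if q: "q \<in> U - {pt CP1}" for q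
    proof (rule mult_mat_vec_carrier[OF _ bspec[OF sc q]])
      show "model_higgs K ?F q \<in> carrier_mat K K" using q car by (cases q) auto
    qed
    fix i assume i: "i < K"
    have ent: "\<exists>p. \<forall>z. model_higgs K ?F (Some z) $$ (i, j) = poly p z" if j: "j < K" for j
    proof -
      define p where "p = (if i = K - 1 then - ((if j = K then 1 else 0) - (if j = 0 then monom 1 N else 0)
          + (if j + 2 \<le> K then P (K - j) else 0)) else if j = Suc i then 1 else 0)"
      have "model_higgs K ?F (Some z) $$ (i, j) = poly p z" for z
        using i j K by (simp add: model_higgs_def companion_def coeff_base_poly p_def poly_monom)
      then show ?thesis by blast
    qed
    then have "\<forall>j\<in>{..<K}. \<exists>p. \<forall>z. model_higgs K ?F (Some z) $$ (i, j) = poly p z" by blast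
    from bchoice[OF this] obtain p where p: "\<forall>j\<in>{..<K}. \<forall>z. model_higgs K ?F (Some z) $$ (i, j) = poly (p j) z" ..
    have m: "(\<lambda>q. \<Sum>j<K. (case q of None \<Rightarrow> 0 | Some z \<Rightarrow> poly (p j) z) * s q $ j) \<in> mero CP1 U"
      by (intro CP1.mero_sum[OF U] CP1.mero_mult[OF U] poly_mero_CP1[OF U]) (use sm in simp)
    show "(\<lambda>q. (model_higgs K ?F q *\<^sub>v s q) $ i) \<in> mero CP1 U"
    proof (rule CP1.mero_cong[OF U m])
      fix q assume q: "q \<in> U - {pt CP1}"
      then obtain z where z: "q = Some z" by (cases q) auto
      have "(model_higgs K ?F q *\<^sub>v s q) $ i = (\<Sum>j<K. model_higgs K ?F q $$ (i, j) * s q $ j)"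
        using car[of z] bspec[OF sc q] i by (simp add: z scalar_prod_def atLeast0LessThan)
      also have "\<dots> = (\<Sum>j<K. (case q of None \<Rightarrow> 0 | Some z \<Rightarrow> poly (p j) z) * s q $ j)"
        by (rule sum.cong) (use p in \<open>simp_all add: z\<close>)
      finally show "(model_higgs K ?F q *\<^sub>v s q) $ i =
        (\<Sum>j<K. (case q of None \<Rightarrow> 0 | Some z \<Rightarrow> poly (p j) z) * s q $ j)" .
    qed
  qed
qed

lemma char_higgs_model:
  assumes K: "K \<ge> 2"
  shows "char_higgs (model K N (base_poly K N P)) = base_poly K N P"
proof (rule ext, rule poly_eqI)
  fix z n
  have "char_higgs (model K N (base_poly K N P)) z =
      monom 1 K + (\<Sum>j<K. monom (coeff (base_poly K N P z) j) j)"
    using char_poly_companion[of K "coeff (base_poly K N P z)"] K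
    by (simp add: char_higgs_def model_def model_higgs_def)
  moreover have "coeff (\<Sum>j<K. monom (coeff (base_poly K N P z) j) j) n =
      (if n < K then coeff (base_poly K N P z) n else 0)"
    by (simp add: coeff_sum)
  ultimately show "coeff (char_higgs (model K N (base_poly K N P)) z) n = coeff (base_poly K N P z) n"
    using K by (auto simp: coeff_base_poly)
qed

section \<open>The companion object at infinity\<close>

text \<open>
  The roots are distinct at the origin and therefore on a common smaller disc.
\<close>

lemma perturbed_unity_roots:
  fixes h :: "nat \<Rightarrow> complex \<Rightarrow> complex"
  assumes h: "\<And>i. h i holomorphic_on UNIV" and K: "K \<ge> 1" and M: "M \<ge> 1"
  obtains \<rho> w g where "\<rho> > 0" "\<forall>r\<in>{1..K}. w r holomorphic_on ball 0 \<rho>"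
    "\<forall>r\<in>{1..K}. g r holomorphic_on ball 0 \<rho>"
    "\<forall>r\<in>{1..K}. \<forall>u\<in>ball 0 \<rho>. w r u ^ K - 1 + (\<Sum>i=2..K. u ^ M * h i u * w r u ^ (K - i)) = 0"
    "\<forall>r\<in>{1..K}. \<forall>u\<in>ball 0 \<rho>. w r u = unity_root K r + u ^ M * g r u"
    "\<forall>u\<in>ball 0 \<rho>. inj_on (\<lambda>r. w r u) {1..K}"
proof -
  define Q where "Q r \<rho> w g \<longleftrightarrow> \<rho> > 0 \<and> w holomorphic_on ball 0 \<rho> \<and> g holomorphic_on ball 0 \<rho> \<and>
    (\<forall>u\<in>ball 0 \<rho>. w u ^ K - 1 + (\<Sum>i=2..K. u ^ M * h i u * w u ^ (K - i)) = 0 \<and>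
      w u = unity_root K r + u ^ M * g u)" for r \<rho> w g
  have "\<forall>r\<in>{1..K}. \<exists>\<rho> w g. Q r \<rho> w g"
  proof
    fix r
    from perturbed_unity_root[of h, OF h unity_root_power[OF K, of r] K M]
    show "\<exists>\<rho> w g. Q r \<rho> w g" unfolding Q_def by (elim exE conjE) (intro exI conjI)
  qed
  from bchoice[OF this] obtain \<rho> where "\<forall>r\<in>{1..K}. \<exists>w g. Q r (\<rho> r) w g" ..
  from bchoice[OF this] obtain w where "\<forall>r\<in>{1..K}. \<exists>g. Q r (\<rho> r) (w r) g" ..
  from bchoice[OF this] obtain g where Q: "\<forall>r\<in>{1..K}. Q r (\<rho> r) (w r) (g r)" ..
  note Qr = bspec[OF Q, unfolded Q_def]
  note Qs = Qr[THEN conjunct1] Qr[THEN conjunct2, THEN conjunct1]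
    Qr[THEN conjunct2, THEN conjunct2, THEN conjunct1]
    Qr[THEN conjunct2, THEN conjunct2, THEN conjunct2]
  have "\<forall>\<^sub>F u in nhds 0. w r u \<noteq> w s u" if rs: "r \<in> {1..K}" "s \<in> {1..K}" "r \<noteq> s" for r s
  proof -
    have cont: "isCont (w t) 0" if "t \<in> {1..K}" for t
      using holomorphic_on_imp_continuous_on[OF Qs(2)[OF that]] Qs(1)[OF that]
      by (simp add: continuous_on_eq_continuous_at)
    have at0: "w t 0 = unity_root K t" if "t \<in> {1..K}" for t
    proof -
      have "0 \<in> ball (0::complex) (\<rho> t)" using Qs(1)[OF that] by simp
      from bspec[OF Qs(4)[OF that] this] show ?thesis using M by (simp add: power_0_left)
    qed
    have "unity_root K r \<noteq> unity_root K s"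
    proof
      assume eq: "unity_root K r = unity_root K s"
      have i: "r - 1 \<in> {..<K}" "s - 1 \<in> {..<K}" "Suc (r - 1) = r" "Suc (s - 1) = s"
        using rs by auto
      have "r - 1 = s - 1"
        by (rule inj_onD[OF inj_unity_root[OF K] _ i(1,2)]) (simp only: i(3,4) eq)
      with i(3,4) rs(3) show False by metis
    qed
    then have "w r 0 - w s 0 \<noteq> 0" using at0 rs by simp
    moreover have "isCont (\<lambda>u. w r u - w s u) 0" by (intro continuous_intros cont rs)
    ultimately obtain e where "e > 0" "\<forall>u. dist 0 u < e \<longrightarrow> w r u - w s u \<noteq> 0"
      using continuous_at_avoid[of 0 "\<lambda>u. w r u - w s u" 0] by auto
    then show ?thesis unfolding eventually_nhds_metric by (intro exI[of _ e]) (auto simp: dist_commute)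
  qed
  then have "\<forall>\<^sub>F u in nhds 0. \<forall>r\<in>{1..K}. \<forall>s\<in>{1..K} - {r}. w r u \<noteq> w s u"
    by (intro eventually_ball_finite ballI) auto
  moreover have "\<forall>\<^sub>F u in nhds 0. \<forall>r\<in>{1..K}. u \<in> ball 0 (\<rho> r)"
    by (intro eventually_ball_finite ballI eventually_nhds_in_open) (use Qs(1) in auto)
  ultimately have "\<forall>\<^sub>F u in nhds 0. (\<forall>r\<in>{1..K}. \<forall>s\<in>{1..K} - {r}. w r u \<noteq> w s u) \<and> (\<forall>r\<in>{1..K}. u \<in> ball 0 (\<rho> r))"
    by (rule eventually_conj)
  then obtain \<sigma> where \<sigma>: "\<sigma> > 0" "\<forall>u. dist u 0 < \<sigma> \<longrightarrow>
      (\<forall>r\<in>{1..K}. \<forall>s\<in>{1..K} - {r}. w r u \<noteq> w s u) \<and> (\<forall>r\<in>{1..K}. u \<in> ball 0 (\<rho> r))"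
    unfolding eventually_nhds_metric by (elim exE conjE)
  have sub: "ball 0 \<sigma> \<subseteq> ball (0 :: complex) (\<rho> r)" if "r \<in> {1..K}" for r
  proof (rule subsetI)
    fix u :: complex assume "u \<in> ball 0 \<sigma>"
    then have "dist u 0 < \<sigma>" by (simp add: dist_commute)
    then show "u \<in> ball 0 (\<rho> r)" using \<sigma>(2) that by blast
  qed
  show thesis
  proof (rule that[OF \<sigma>(1), of w g])
    show "\<forall>r\<in>{1..K}. w r holomorphic_on ball 0 \<sigma>" using Qs(2) sub holomorphic_on_subset by blast
    show "\<forall>r\<in>{1..K}. g r holomorphic_on ball 0 \<sigma>" using Qs(3) sub holomorphic_on_subset by blast
    show "\<forall>r\<in>{1..K}. \<forall>u\<in>ball 0 \<sigma>. w r u ^ K - 1 + (\<Sum>i=2..K. u ^ M * h i u * w r u ^ (K - i)) = 0"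
      using Qs(4) sub by blast
    show "\<forall>r\<in>{1..K}. \<forall>u\<in>ball 0 \<sigma>. w r u = unity_root K r + u ^ M * g r u"
      using Qs(4) sub by blast
    show "\<forall>u\<in>ball 0 \<sigma>. inj_on (\<lambda>r. w r u) {1..K}"
    proof
      fix u :: complex assume "u \<in> ball 0 \<sigma>"
      then have "dist u 0 < \<sigma>" by (simp add: dist_commute)
      then have "\<forall>r\<in>{1..K}. \<forall>s\<in>{1..K} - {r}. w r u \<noteq> w s u" using \<sigma>(2) by blast
      then show "inj_on (\<lambda>r. w r u) {1..K}" by (intro inj_onI) blast
    qed
  qed
qed

text \<open>
  Substituting \<open>y = w / u ^ (2 * N)\<close> and clearing the factor \<open>u ^ (2 * N * K)\<close> turns the characteristic equation into
  \<open>w ^ K - 1 + (\<Sum>i. u ^ (2 * N * i) * P i (1 / u ^ (2 * K)) * w ^ (K - i)) = 0\<close>. The bound on the degree of \<open>P i\<close> says exactly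
  that its coefficient is divisible by \<open>u ^ (2 * N + 2 * K)\<close>.
\<close>

lemma base_poly_roots_at_infinity:
  assumes K: "K \<ge> 2"
    and deg: "\<forall>i\<in>{2..K}. P i = 0 \<or> real (degree (P i)) \<le> real N * (real i - 1) / real K - 1"
  obtains \<rho> w g where "\<rho> > 0" "\<forall>r\<in>{1..K}. w r holomorphic_on ball 0 \<rho>"
    "\<forall>r\<in>{1..K}. g r holomorphic_on ball 0 \<rho>"
    "\<forall>r\<in>{1..K}. \<forall>u\<in>ball 0 \<rho> - {0}. poly (base_poly K N P (1 / u ^ (2 * K))) (inverse (u ^ (2 * N)) * w r u) = 0"
    "\<forall>r\<in>{1..K}. \<forall>u\<in>ball 0 \<rho>. w r u = unity_root K r + u ^ (2 * N + 2 * K) * g r u"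
    "\<forall>u\<in>ball 0 \<rho>. inj_on (\<lambda>r. w r u) {1..K}"
proof -
  let ?M = "2 * N + 2 * K"
  define h where "h i u = u ^ (2 * N * i - ?M - 2 * K * degree (P i)) * poly (reflect_poly (P i)) (u ^ (2 * K))" for i u
  have hP: "u ^ ?M * h i u = u ^ (2 * N * i) * poly (P i) (1 / u ^ (2 * K))"
    if i: "i \<in> {2..K}" and u: "u \<noteq> 0" for i u
  proof (cases "P i = 0")
    case True
    then show ?thesis by (simp add: h_def)
  next
    case False
    then have "real (degree (P i)) \<le> real N * (real i - 1) / real K - 1" using deg i by blast
    then have "real (degree (P i)) * real K \<le> real N * (real i - 1) - real K"
      using K by (simp add: field_simps)
    then have "real (?M + 2 * K * degree (P i)) \<le> real (2 * N * i)" by (simp add: algebra_simps)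
    then have le: "?M + 2 * K * degree (P i) \<le> 2 * N * i" by (simp only: of_nat_le_iff)
    have "poly (reflect_poly (P i)) (u ^ (2 * K)) = (u ^ (2 * K)) ^ degree (P i) * poly (P i) (1 / u ^ (2 * K))"
      using poly_reflect_poly_nz[of "u ^ (2 * K)" "P i"] u by (simp add: inverse_eq_divide)
    then have "u ^ ?M * h i u = (u ^ ?M * u ^ (2 * N * i - ?M - 2 * K * degree (P i)) * (u ^ (2 * K)) ^ degree (P i))
        * poly (P i) (1 / u ^ (2 * K))" by (simp only: h_def mult.assoc)
    also have "u ^ ?M * u ^ (2 * N * i - ?M - 2 * K * degree (P i)) * (u ^ (2 * K)) ^ degree (P i) = u ^ (2 * N * i)"
      unfolding power_mult[symmetric] power_add[symmetric] using le by (intro arg_cong[where f = "power u"]) linarith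
    finally show ?thesis .
  qed
  have hh: "h i holomorphic_on UNIV" for i unfolding h_def[abs_def] by (intro holomorphic_intros)
  obtain \<rho> w g where \<rho>: "\<rho> > 0" and w: "\<forall>r\<in>{1..K}. w r holomorphic_on ball 0 \<rho>"
    and g: "\<forall>r\<in>{1..K}. g r holomorphic_on ball 0 \<rho>"
    and root: "\<forall>r\<in>{1..K}. \<forall>u\<in>ball 0 \<rho>. w r u ^ K - 1 + (\<Sum>i=2..K. u ^ ?M * h i u * w r u ^ (K - i)) = 0"
    and wg: "\<forall>r\<in>{1..K}. \<forall>u\<in>ball 0 \<rho>. w r u = unity_root K r + u ^ ?M * g r u"
    and inj: "\<forall>u\<in>ball 0 \<rho>. inj_on (\<lambda>r. w r u) {1..K}"
    by (rule perturbed_unity_roots[of h K ?M, OF hh]) (use K in simp_all)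
  have "poly (base_poly K N P (1 / u ^ (2 * K))) (inverse (u ^ (2 * N)) * w r u) = 0"
    if r: "r \<in> {1..K}" and u: "u \<in> ball 0 \<rho> - {0}" for r u
  proof -
    have u0: "u \<noteq> 0" and uB: "u \<in> ball 0 \<rho>" using u by auto
    define c where "c = inverse (u ^ (2 * N))"
    have cu: "c ^ K = (1 / u ^ (2 * K)) ^ N"
      by (simp add: c_def power_inverse inverse_eq_divide power_one_over power_mult[symmetric] mult_ac)
    have cj: "c ^ (K - i) = c ^ K * u ^ (2 * N * i)" if "i \<in> {2..K}" for i
    proof -
      have "c ^ K = c ^ (K - i) * c ^ i" using that by (simp add: power_add[symmetric])
      moreover have "c ^ i * u ^ (2 * N * i) = 1"
        unfolding c_def power_inverse power_mult using u0 by simp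
      ultimately show ?thesis by (simp add: mult.assoc)
    qed
    have "poly (base_poly K N P (1 / u ^ (2 * K))) (c * w r u) =
        (c * w r u) ^ K - c ^ K + (\<Sum>i=2..K. poly (P i) (1 / u ^ (2 * K)) * (c * w r u) ^ (K - i))"
      unfolding base_poly_def by (simp add: poly_monom poly_sum cu)
    also have "(\<Sum>i=2..K. poly (P i) (1 / u ^ (2 * K)) * (c * w r u) ^ (K - i)) =
        c ^ K * (\<Sum>i=2..K. u ^ ?M * h i u * w r u ^ (K - i))"
      unfolding sum_distrib_left
    proof (rule sum.cong[OF refl])
      fix i assume i: "i \<in> {2..K}"
      show "poly (P i) (1 / u ^ (2 * K)) * (c * w r u) ^ (K - i) = c ^ K * (u ^ ?M * h i u * w r u ^ (K - i))"
        unfolding hP[OF i u0] power_mult_distrib cj[OF i] by (simp only: mult_ac)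
    qed
    also have "(c * w r u) ^ K - c ^ K + c ^ K * (\<Sum>i=2..K. u ^ ?M * h i u * w r u ^ (K - i)) =
        c ^ K * (w r u ^ K - 1 + (\<Sum>i=2..K. u ^ ?M * h i u * w r u ^ (K - i)))"
      by (simp add: power_mult_distrib algebra_simps)
    also have "\<dots> = 0" using bspec[OF bspec[OF root r] uB] by (simp only: mult_zero_right)
    finally show ?thesis by (simp only: c_def)
  qed
  then show thesis using that[OF \<rho> w g _ wg inj] by blast
qed

lemma model_higgs_eigenvector:
  assumes K: "K \<ge> 2" and root: "poly (base_poly K N P z) y = 0"
  shows "model_higgs K (base_poly K N P) (Some z) *\<^sub>v Matrix.vec K (\<lambda>j. y ^ j) = y \<cdot>\<^sub>v Matrix.vec K (\<lambda>j. y ^ j)"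
proof -
  let ?F = "base_poly K N P z"
  have "degree ?F = K"
  proof (rule antisym)
    show "degree ?F \<le> K" by (rule degree_le) (use K in \<open>auto simp: coeff_base_poly\<close>)
    show "K \<le> degree ?F" by (rule le_degree) (use K in \<open>simp add: coeff_base_poly\<close>)
  qed
  then have "poly ?F y = (\<Sum>j\<le>K. coeff ?F j * y ^ j)" using poly_altdef[of ?F y] by simp
  also have "\<dots> = y ^ K + (\<Sum>j<K. coeff ?F j * y ^ j)"
    using K by (simp add: lessThan_Suc_atMost[symmetric] coeff_base_poly)
  finally have "y ^ K + (\<Sum>j<K. coeff ?F j * y ^ j) = 0" using root by simp
  then show ?thesis unfolding model_higgs_def option.case
    by (intro companion_eigenvector) (use K in simp_all)
qed

text \<open>
  The coordinate at infinity pulls back to \<open>u ^ (2 * K)\<close>, so pole orders are multiplied by the ramification index.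
\<close>

lemma pole_le_cover_map:
  assumes f: "f \<in> pole_le CP1 k V" and V: "openin (top_of CP1) V"
    and W: "openin (top_of (disc \<rho>)) W" "cover_map K ` W \<subseteq> V" and K: "K \<ge> 1" and \<rho>: "\<rho> > 0"
  shows "(\<lambda>u. f (cover_map K u)) \<in> pole_le (disc \<rho>) (2 * int K * k) W"
proof -
  have oW: "open W" using W(1) by (simp add: openin_disc)
  have off: "(\<lambda>u. f (cover_map K u)) holomorphic_on (W - {0})"
  proof -
    have "f \<in> hol CP1 (V - {None})" using f by (simp add: pole_le_def)
    then have fh: "(\<lambda>z. f (Some z)) holomorphic_on {z. Some z \<in> V}" by (simp add: mem_hol_CP1)
    have "((\<lambda>z. f (Some z)) \<circ> (\<lambda>u. 1 / u ^ (2 * K))) holomorphic_on (W - {0})"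
    proof (rule holomorphic_on_compose_gen[OF _ fh])
      show "(\<lambda>u. 1 / u ^ (2 * K)) ` (W - {0}) \<subseteq> {z. Some z \<in> V}"
        using W(2) by (auto simp: cover_map_def image_subset_iff split: if_splits)
    qed (auto intro!: holomorphic_intros)
    then show ?thesis by (rule holomorphic_transform) (simp add: cover_map_def)
  qed
  show ?thesis unfolding pole_le_def mem_Collect_eq
  proof (intro conjI impI)
    show "(\<lambda>u. f (cover_map K u)) \<in> hol (disc \<rho>) (W - {pt (disc \<rho>)})" using off by simp
    assume "pt (disc \<rho>) \<in> W"
    then have "0 \<in> W" by simp
    then have pV: "pt CP1 \<in> V" using W(2) by (auto simp: cover_map_def image_subset_iff split: if_splits)
    obtain V1 g where V1: "CP1.opn V1" "pt CP1 \<in> V1" "V1 \<subseteq> V" "V1 \<subseteq> UNIV - {Some 0}" "g \<in> hol CP1 V1"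
      "\<forall>q\<in>V1 - {pt CP1}. g q = coord CP1 q powi k * f q"
      by (rule CP1.pole_le_nearE[OF f pV V])
    define G where "G x = g (if x = 0 then None else Some (1 / x))" for x :: complex
    have "G analytic_on {0}" using V1(2,5) unfolding G_def mem_hol_CP1 by simp
    then obtain d where d: "d > 0" "G holomorphic_on ball 0 d" unfolding analytic_on_def by auto
    have "None \<in> V1" using V1(2) by simp
    from openin_CP1_at_infinity[OF V1(1) this] obtain r where r: "r > 0"
      "\<forall>x. x \<noteq> 0 \<longrightarrow> cmod x < r \<longrightarrow> Some (1 / x) \<in> V1" .
    define m where "m = min d r"
    have m: "m > 0" using d r by (simp add: m_def)
    define W1 where "W1 = W \<inter> (\<lambda>u. u ^ (2 * K)) -` ball 0 m"
    have oW1: "open W1" unfolding W1_def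
      by (rule continuous_open_preimage[OF _ oW]) (auto intro!: continuous_intros)
    have hol: "(G \<circ> (\<lambda>u. u ^ (2 * K))) holomorphic_on W1"
      by (rule holomorphic_on_compose_gen[OF _ d(2)]) (auto simp: W1_def m_def intro!: holomorphic_intros)
    have eq: "(G \<circ> (\<lambda>u. u ^ (2 * K))) u = u powi (2 * int K * k) * f (cover_map K u)"
      if u: "u \<in> W1 - {0}" for u
    proof -
      have u0: "u \<noteq> 0" "u ^ (2 * K) \<noteq> 0" using u by auto
      have "cmod (u ^ (2 * K)) < r" using u by (simp add: W1_def m_def)
      then have V1u: "Some (1 / u ^ (2 * K)) \<in> V1" using r(2) u0(2) by blast
      have "(G \<circ> (\<lambda>u. u ^ (2 * K))) u = g (Some (1 / u ^ (2 * K)))" using u0 by (simp add: G_def)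
      also have "\<dots> = coord CP1 (Some (1 / u ^ (2 * K))) powi k * f (Some (1 / u ^ (2 * K)))"
        using V1(6) V1u by simp
      also have "coord CP1 (Some (1 / u ^ (2 * K))) powi k = u powi (2 * int K * k)"
      proof -
        have "u powi (int (2 * K) * k) = (u ^ (2 * K)) powi k" unfolding power_int_mult power_int_of_nat ..
        then have "(u ^ (2 * K)) powi k = u powi (2 * int K * k)" by (simp only: of_nat_mult of_nat_numeral)
        then show "coord CP1 (Some (1 / u ^ (2 * K))) powi k = u powi (2 * int K * k)" by (simp only: coord_CP1) simp
      qed
      finally show ?thesis using u0 by (simp add: cover_map_def)
    qed
    have "openin (top_of (disc \<rho>)) W1" "0 \<in> W1" "W1 \<subseteq> W"
      using oW1 W(1) \<open>0 \<in> W\<close> m K by (auto simp: openin_disc W1_def power_0_left)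
    then show "\<exists>V. \<exists>g\<in>hol (disc \<rho>) V. openin (top_of (disc \<rho>)) V \<and> pt (disc \<rho>) \<in> V \<and> V \<subseteq> W \<and>
        (\<forall>q\<in>V - {pt (disc \<rho>)}. g q = coord (disc \<rho>) q powi (2 * int K * k) * f (cover_map K q))"
      by (intro exI[of _ W1] bexI[of _ "G \<circ> (\<lambda>u. u ^ (2 * K))"]) (use hol eq in simp_all)
  qed
qed

lemma (in coordinate_curve) pole_le_local:
  assumes "\<And>p. p \<in> U \<Longrightarrow> \<exists>W. opn W \<and> p \<in> W \<and> W \<subseteq> U \<and> f \<in> pole_le X k W"
  shows "f \<in> pole_le X k U"
proof -
  have "f \<in> pole_le X k (\<Union>{W. opn W \<and> W \<subseteq> U \<and> f \<in> pole_le X k W})"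
    by (rule pole_le_Union) simp
  moreover have "\<Union>{W. opn W \<and> W \<subseteq> U \<and> f \<in> pole_le X k W} = U"
  proof (intro Set.equalityI Set.subsetI)
    fix p assume "p \<in> U"
    from assms[OF this] obtain W where "opn W \<and> p \<in> W \<and> W \<subseteq> U \<and> f \<in> pole_le X k W" ..
    then show "p \<in> \<Union>{W. opn W \<and> W \<subseteq> U \<and> f \<in> pole_le X k W}" by (intro UnionI[of W]) simp_all
  qed auto
  ultimately show ?thesis by (simp only:)
qed

lemma (in coordinate_curve) mero_local:
  assumes "\<And>p. p \<in> U \<Longrightarrow> \<exists>W. opn W \<and> p \<in> W \<and> W \<subseteq> U \<and> f \<in> mero X W"
  shows "f \<in> mero X U"
proof -
  have "f \<in> mero X (\<Union>{W. opn W \<and> W \<subseteq> U \<and> f \<in> mero X W})"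
    by (rule mero_Union) simp
  moreover have "\<Union>{W. opn W \<and> W \<subseteq> U \<and> f \<in> mero X W} = U"
  proof (intro Set.equalityI Set.subsetI)
    fix p assume "p \<in> U"
    from assms[OF this] obtain W where "opn W \<and> p \<in> W \<and> W \<subseteq> U \<and> f \<in> mero X W" ..
    then show "p \<in> \<Union>{W. opn W \<and> W \<subseteq> U \<and> f \<in> mero X W}" by (intro UnionI[of W]) simp_all
  qed auto
  ultimately show ?thesis by (simp only:)
qed

lemma mem_sec_pullback_model:
  assumes K: "K \<ge> 1" and \<rho>: "\<rho> > 0" and W: "openin (top_of (disc \<rho>)) W"
  shows "s \<in> sec (pullback (disc \<rho>) CP1 (cover_map K) (2 * K) K (model_sheaf K N)) W \<longleftrightarrow>
    (\<forall>q\<in>W - {0}. s q \<in> carrier_vec K) \<and> (\<forall>j<K. (\<lambda>q. s q $ j) \<in> mero (disc \<rho>) W)" (is "?L \<longleftrightarrow> ?R")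
proof -
  interpret Y: coordinate_curve "disc \<rho>" "ball 0 \<rho>" by (rule coordinate_curve_disc[OF \<rho>])
  have def: "?L \<longleftrightarrow> (\<forall>p\<in>W. \<exists>W' V. Y.opn W' \<and> p \<in> W' \<and> W' \<subseteq> W \<and> CP1.opn V \<and> cover_map K ` W' \<subseteq> V \<and>
      (\<exists>(n::nat) f t. (\<forall>i<n. f i \<in> mero (disc \<rho>) W' \<and> t i \<in> sec (model_sheaf K N) V) \<and>
         (\<forall>q\<in>W' - {pt (disc \<rho>)}. s q = Matrix.vec K (\<lambda>j. \<Sum>i<n. f i q * (t i (cover_map K q) $ j)))))"
    unfolding pullback_def filtered_sheaf.simps mem_Collect_eq ..
  show ?thesis
  proof
    assume L: ?L
    have loc: "\<exists>W'. Y.opn W' \<and> p \<in> W' \<and> W' \<subseteq> W \<and> (\<forall>q\<in>W' - {0}. s q \<in> carrier_vec K) \<and>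
        (\<forall>j<K. (\<lambda>q. s q $ j) \<in> mero (disc \<rho>) W')" if p: "p \<in> W" for p
    proof -
      obtain W' V and n :: nat and f and t :: "nat \<Rightarrow> complex option \<Rightarrow> complex vec" where W': "Y.opn W'" "p \<in> W'" "W' \<subseteq> W" and V: "CP1.opn V" "cover_map K ` W' \<subseteq> V"
        and ft: "\<forall>i<n. f i \<in> mero (disc \<rho>) W' \<and> t i \<in> sec (model_sheaf K N) V"
        and s: "\<forall>q\<in>W' - {pt (disc \<rho>)}. s q = Matrix.vec K (\<lambda>j. \<Sum>i<n. f i q * (t i (cover_map K q) $ j))"
      proof -
        from bspec[OF L[unfolded def] p] show thesis by (elim exE conjE) (rule that)
      qed
      have "(\<lambda>q. s q $ j) \<in> mero (disc \<rho>) W'" if j: "j < K" for j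
      proof (rule Y.mero_cong[OF W'(1)])
        show "(\<lambda>q. \<Sum>i<n. f i q * (t i (cover_map K q) $ j)) \<in> mero (disc \<rho>) W'"
        proof (rule Y.mero_sum[OF W'(1)], rule Y.mero_mult[OF W'(1)])
          fix i assume "i \<in> {..<n}"
          then show "f i \<in> mero (disc \<rho>) W'" using ft by simp
          have "t i \<in> sec (model_sheaf K N) V" using ft \<open>i \<in> {..<n}\<close> by simp
          then have "(\<lambda>q. t i q $ j) \<in> mero CP1 V"
            using j unfolding model_sheaf_def CP1.mem_sec_standard[OF V(1)] by simp
          from CP1.mero_iff[OF V(1), THEN iffD1, OF this] obtain k where
            k: "(\<lambda>q. t i q $ j) \<in> pole_le CP1 k V" ..
          show "(\<lambda>q. t i (cover_map K q) $ j) \<in> mero (disc \<rho>) W'"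
            by (rule Y.pole_le_mero[OF W'(1) pole_le_cover_map[OF k V(1) W'(1) V(2) K \<rho>]])
        qed
        fix q assume "q \<in> W' - {pt (disc \<rho>)}"
        from bspec[OF s this] j show "s q $ j = (\<Sum>i<n. f i q * (t i (cover_map K q) $ j))" by simp
      qed
      then show ?thesis using W' s by (intro exI[of _ W']) simp
    qed
    show ?R
    proof (intro conjI ballI allI impI)
      fix q assume q: "q \<in> W - {0}"
      then show "s q \<in> carrier_vec K" using loc[of q] by blast
    next
      fix j assume j: "j < K"
      show "(\<lambda>q. s q $ j) \<in> mero (disc \<rho>) W"
      proof (rule Y.mero_local)
        fix p assume "p \<in> W"
        from loc[OF this] j show "\<exists>W'. Y.opn W' \<and> p \<in> W' \<and> W' \<subseteq> W \<and> (\<lambda>q. s q $ j) \<in> mero (disc \<rho>) W'"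
          by (elim exE conjE) (rule exI, intro conjI, assumption+, simp)
      qed
    qed
  next
    assume R: ?R
    have UN: "CP1.opn UNIV" using openin_topspace[of "top_of CP1"] by simp
    have t: "(\<lambda>_. unit_vec K i) \<in> sec (model_sheaf K N) UNIV" for i
      unfolding model_sheaf_def CP1.mem_sec_standard[OF UN] by (simp add: CP1.mero_const[OF UN])
    show ?L unfolding def
    proof (rule ballI, rule exI[of _ W], rule exI[of _ UNIV], intro conjI W UN)
      show "\<exists>(n::nat) f t. (\<forall>i<n. f i \<in> mero (disc \<rho>) W \<and> t i \<in> sec (model_sheaf K N) UNIV) \<and>
         (\<forall>q\<in>W - {pt (disc \<rho>)}. s q = Matrix.vec K (\<lambda>j. \<Sum>i<n. f i q * (t i (cover_map K q) $ j)))"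
      proof (rule exI[of _ K], rule exI[of _ "\<lambda>i q. s q $ i"], rule exI[of _ "\<lambda>i _. unit_vec K i"], intro conjI allI impI ballI)
        fix q assume "q \<in> W - {pt (disc \<rho>)}"
        then have sc: "s q \<in> carrier_vec K" using R by simp
        show "s q = Matrix.vec K (\<lambda>j. \<Sum>i<K. s q $ i * (unit_vec K i $ j))"
        proof (rule eq_vecI)
          fix j assume "j < dim_vec (Matrix.vec K (\<lambda>j. \<Sum>i<K. s q $ i * (unit_vec K i $ j)))"
          then have j: "j < K" by simp
          have "(\<Sum>i<K. s q $ i * (unit_vec K i $ j)) = (\<Sum>i<K. if i = j then s q $ i else 0)"
            using j by (intro sum.cong) auto
          then show "s q $ j = Matrix.vec K (\<lambda>j. \<Sum>i<K. s q $ i * (unit_vec K i $ j)) $ j" using j by simp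
        qed (use sc in simp)
      qed (use R t in simp_all)
    qed simp_all
  qed
qed

text \<open>
  Because \<open>2 * K\<close> times the order of each basis vector is an integer, the pullback filtration is again given by pole
  orders of the components, and it depends on \<open>\<alpha>\<close> only through its floor.
\<close>

lemma mem_fil_pullback_model:
  assumes K: "K \<ge> 1" and \<rho>: "\<rho> > 0" and W: "openin (top_of (disc \<rho>)) W"
  shows "s \<in> fil (pullback (disc \<rho>) CP1 (cover_map K) (2 * K) K (model_sheaf K N)) \<alpha> W \<longleftrightarrow>
    (\<forall>q\<in>W - {0}. s q \<in> carrier_vec K) \<and>
    (\<forall>j<K. (\<lambda>q. s q $ j) \<in> pole_le (disc \<rho>) (\<lfloor>\<alpha>\<rfloor> - weight K N j) W)" (is "?L \<longleftrightarrow> ?R")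
proof -
  interpret Y: coordinate_curve "disc \<rho>" "ball 0 \<rho>" by (rule coordinate_curve_disc[OF \<rho>])
  let ?a = "\<lambda>j. of_int (weight K N j) / (2 * real K)"
  have a: "2 * real K * ?a j = of_int (weight K N j)" for j using K by simp
  have def: "?L \<longleftrightarrow> (\<forall>p\<in>W. \<exists>W' V. Y.opn W' \<and> p \<in> W' \<and> W' \<subseteq> W \<and> CP1.opn V \<and> cover_map K ` W' \<subseteq> V \<and>
      (\<exists>(n::nat) f t (k :: nat \<Rightarrow> int) \<beta>. (\<forall>i<n. f i \<in> hol (disc \<rho>) W' \<and> t i \<in> fil (model_sheaf K N) (\<beta> i) V \<and>
           of_int (k i) + real (2 * K) * \<beta> i \<le> \<alpha>) \<and>
         (\<forall>q\<in>W' - {pt (disc \<rho>)}. s q = Matrix.vec K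
            (\<lambda>j. \<Sum>i<n. f i q * coord (disc \<rho>) q powi (- k i) * (t i (cover_map K q) $ j)))))"
    unfolding pullback_def filtered_sheaf.simps mem_Collect_eq ..
  show ?thesis
  proof
    assume L: ?L
    have loc: "\<exists>W'. Y.opn W' \<and> p \<in> W' \<and> W' \<subseteq> W \<and> (\<forall>q\<in>W' - {0}. s q \<in> carrier_vec K) \<and>
        (\<forall>j<K. (\<lambda>q. s q $ j) \<in> pole_le (disc \<rho>) (\<lfloor>\<alpha>\<rfloor> - weight K N j) W')" if p: "p \<in> W" for p
    proof -
      obtain W' V and n :: nat and f and t :: "nat \<Rightarrow> complex option \<Rightarrow> complex vec" and k :: "nat \<Rightarrow> int" and \<beta>
        where W': "Y.opn W'" "p \<in> W'" "W' \<subseteq> W" and V: "CP1.opn V" "cover_map K ` W' \<subseteq> V"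
        and ft: "\<forall>i<n. f i \<in> hol (disc \<rho>) W' \<and> t i \<in> fil (model_sheaf K N) (\<beta> i) V \<and>
           of_int (k i) + real (2 * K) * \<beta> i \<le> \<alpha>"
        and s: "\<forall>q\<in>W' - {pt (disc \<rho>)}. s q = Matrix.vec K
            (\<lambda>j. \<Sum>i<n. f i q * coord (disc \<rho>) q powi (- k i) * (t i (cover_map K q) $ j))"
      proof -
        from bspec[OF L[unfolded def] p] show thesis by (elim exE conjE) (rule that)
      qed
      have W'b: "W' \<subseteq> ball 0 \<rho>" using W'(1) by (simp add: openin_disc)
      have "(\<lambda>q. s q $ j) \<in> pole_le (disc \<rho>) (\<lfloor>\<alpha>\<rfloor> - weight K N j) W'" if j: "j < K" for j
      proof (rule Y.pole_le_cong[OF W'(1)])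
        show "(\<lambda>q. \<Sum>i<n. f i q * coord (disc \<rho>) q powi (- k i) * (t i (cover_map K q) $ j))
           \<in> pole_le (disc \<rho>) (\<lfloor>\<alpha>\<rfloor> - weight K N j) W'"
        proof (rule Y.pole_le_sum[OF W'(1)])
          fix i assume "i \<in> {..<n}"
          then have fi: "f i \<in> hol (disc \<rho>) W'" and ti: "t i \<in> fil (model_sheaf K N) (\<beta> i) V"
            and ki: "of_int (k i) + real (2 * K) * \<beta> i \<le> \<alpha>" using ft by simp_all
          have tp: "(\<lambda>q. t i q $ j) \<in> pole_le CP1 \<lfloor>\<beta> i - ?a j\<rfloor> V"
            using j ti unfolding model_sheaf_def CP1.mem_fil_standard[OF V(1)] by simp
          have "(\<lambda>q. f i q * coord (disc \<rho>) q powi (- k i) * (t i (cover_map K q) $ j))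
            \<in> pole_le (disc \<rho>) (0 + k i + 2 * int K * \<lfloor>\<beta> i - ?a j\<rfloor>) W'"
            by (intro Y.pole_le_mult[OF W'(1)] Y.hol_pole_le[OF W'(1) fi]
                Y.pole_le_coord_powi[OF W'(1) W'b] pole_le_cover_map[OF tp V(1) W'(1) V(2) K \<rho>])
          moreover have "0 + k i + 2 * int K * \<lfloor>\<beta> i - ?a j\<rfloor> \<le> \<lfloor>\<alpha>\<rfloor> - weight K N j"
          proof -
            have "2 * real K * of_int \<lfloor>\<beta> i - ?a j\<rfloor> \<le> 2 * real K * (\<beta> i - ?a j)"
              by (intro mult_left_mono) simp_all
            also have "\<dots> = real (2 * K) * \<beta> i - of_int (weight K N j)"
              unfolding right_diff_distrib a by simp
            finally have "of_int (0 + k i + 2 * int K * \<lfloor>\<beta> i - ?a j\<rfloor> + weight K N j) \<le> \<alpha>"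
              using ki by simp
            then show ?thesis by (simp only: le_floor_iff[symmetric] le_diff_eq)
          qed
          ultimately show "(\<lambda>q. f i q * coord (disc \<rho>) q powi (- k i) * (t i (cover_map K q) $ j))
            \<in> pole_le (disc \<rho>) (\<lfloor>\<alpha>\<rfloor> - weight K N j) W'" by (rule Y.pole_le_mono[OF W'(1)])
        qed
        fix q assume "q \<in> W' - {pt (disc \<rho>)}"
        from bspec[OF s this] j show "s q $ j =
          (\<Sum>i<n. f i q * coord (disc \<rho>) q powi (- k i) * (t i (cover_map K q) $ j))" by simp
      qed
      then show ?thesis using W' s by (intro exI[of _ W']) simp
    qed
    show ?R
    proof (intro conjI ballI allI impI)
      fix q assume q: "q \<in> W - {0}"
      then show "s q \<in> carrier_vec K" using loc[of q] by blast
    next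
      fix j assume j: "j < K"
      show "(\<lambda>q. s q $ j) \<in> pole_le (disc \<rho>) (\<lfloor>\<alpha>\<rfloor> - weight K N j) W"
      proof (rule Y.pole_le_local)
        fix p assume "p \<in> W"
        from loc[OF this] j show "\<exists>W'. Y.opn W' \<and> p \<in> W' \<and> W' \<subseteq> W \<and>
            (\<lambda>q. s q $ j) \<in> pole_le (disc \<rho>) (\<lfloor>\<alpha>\<rfloor> - weight K N j) W'"
          by (elim exE conjE) (rule exI, intro conjI, assumption+, simp)
      qed
    qed
  next
    assume R: ?R
    have UN: "CP1.opn UNIV" using openin_topspace[of "top_of CP1"] by simp
    have Wb: "W \<subseteq> ball 0 \<rho>" using W by (simp add: openin_disc)
    have t: "(\<lambda>_. unit_vec K i) \<in> fil (model_sheaf K N) (?a i) UNIV" if "i < K" for i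
      unfolding model_sheaf_def CP1.mem_fil_standard[OF UN]
    proof (intro conjI ballI allI impI)
      fix j assume j: "j < K"
      show "(\<lambda>q. unit_vec K i $ j) \<in> pole_le CP1 \<lfloor>?a i - ?a j\<rfloor> UNIV"
        by (cases "i = j") (use j that CP1.pole_le_const[OF UN, of 1] CP1.pole_le_zero[OF UN] in simp_all)
    qed simp
    let ?k = "\<lambda>i. \<lfloor>\<alpha>\<rfloor> - weight K N i"
    have "\<forall>i\<in>{..<K}. \<exists>g. g \<in> hol (disc \<rho>) W \<and> (\<forall>q\<in>W - {pt (disc \<rho>)}. s q $ i = coord (disc \<rho>) q powi (- ?k i) * g q)"
    proof
      fix i assume "i \<in> {..<K}"
      then have "(\<lambda>q. s q $ i) \<in> pole_le (disc \<rho>) (?k i) W" using R by simp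
      from iffD1[OF Y.pole_le_iff_hol[OF W Wb] this]
      show "\<exists>g. g \<in> hol (disc \<rho>) W \<and> (\<forall>q\<in>W - {pt (disc \<rho>)}. s q $ i = coord (disc \<rho>) q powi (- ?k i) * g q)"
        unfolding Bex_def .
    qed
    from bchoice[OF this] obtain g where g: "\<forall>i\<in>{..<K}. g i \<in> hol (disc \<rho>) W \<and>
      (\<forall>q\<in>W - {pt (disc \<rho>)}. s q $ i = coord (disc \<rho>) q powi (- ?k i) * g i q)" ..
    show ?L unfolding def
    proof (rule ballI, rule exI[of _ W], rule exI[of _ UNIV], intro conjI W UN)
      show "\<exists>(n::nat) f t (k :: nat \<Rightarrow> int) \<beta>. (\<forall>i<n. f i \<in> hol (disc \<rho>) W \<and> t i \<in> fil (model_sheaf K N) (\<beta> i) UNIV \<and>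
           of_int (k i) + real (2 * K) * \<beta> i \<le> \<alpha>) \<and>
         (\<forall>q\<in>W - {pt (disc \<rho>)}. s q = Matrix.vec K
            (\<lambda>j. \<Sum>i<n. f i q * coord (disc \<rho>) q powi (- k i) * (t i (cover_map K q) $ j)))"
      proof (rule exI[of _ K], rule exI[of _ g], rule exI[of _ "\<lambda>i _. unit_vec K i"], rule exI[of _ ?k],
          rule exI[of _ ?a], intro conjI allI impI ballI)
        fix q assume q: "q \<in> W - {pt (disc \<rho>)}"
        then have sc: "s q \<in> carrier_vec K" using R by simp
        show "s q = Matrix.vec K (\<lambda>j. \<Sum>i<K. g i q * coord (disc \<rho>) q powi (- ?k i) * (unit_vec K i $ j))"
        proof (rule eq_vecI)
          fix j assume "j < dim_vec (Matrix.vec K (\<lambda>j. \<Sum>i<K. g i q * coord (disc \<rho>) q powi (- ?k i) * (unit_vec K i $ j)))"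
          then have j: "j < K" by simp
          have "(\<Sum>i<K. g i q * coord (disc \<rho>) q powi (- ?k i) * (unit_vec K i $ j)) =
              (\<Sum>i<K. if i = j then g i q * coord (disc \<rho>) q powi (- ?k i) else 0)"
            using j by (intro sum.cong) auto
          also have "\<dots> = g j q * coord (disc \<rho>) q powi (- ?k j)" using j by simp
          also have "\<dots> = s q $ j" using bspec[OF conjunct2[OF bspec[OF g, of j]] q] j by (simp add: mult.commute)
          finally show "s q $ j = Matrix.vec K (\<lambda>j. \<Sum>i<K. g i q * coord (disc \<rho>) q powi (- ?k i) * (unit_vec K i $ j)) $ j"
            using j by simp
        qed (use sc in simp)
      next
        fix i assume i: "i < K"
        show "g i \<in> hol (disc \<rho>) W" using g i by simp
        show "(\<lambda>_. unit_vec K i) \<in> fil (model_sheaf K N) (?a i) UNIV" by (rule t[OF i])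
        have "of_int (?k i) + real (2 * K) * ?a i = of_int \<lfloor>\<alpha>\<rfloor>" using a[of i] by simp
        also have "\<dots> \<le> \<alpha>" by simp
        finally show "of_int (?k i) + real (2 * K) * ?a i \<le> \<alpha>" .
      qed
    qed simp_all
  qed
qed

text \<open>
  The line spanned by a nowhere vanishing vector function, filtered by the pole order of the coefficient.
\<close>

definition line_sheaf :: "real \<Rightarrow> nat \<Rightarrow> (complex \<Rightarrow> complex vec) \<Rightarrow> complex filtered_sheaf" where
  "line_sheaf \<rho> d v = framed_sheaf (disc \<rho>) 1 (\<lambda>u. mat d 1 (\<lambda>(j, _). v u $ j)) (\<lambda>_. 0)"

lemma line_frame_mult:
  assumes "v \<in> carrier_vec d"
  shows "mat d 1 (\<lambda>(j, _). v $ j) *\<^sub>v Matrix.vec 1 (\<lambda>_. 1) = (v :: complex vec)"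
  using assms by (intro eq_vecI) (auto simp: scalar_prod_def)

locale line_frame =
  fixes \<rho> :: real and d :: nat and v :: "complex \<Rightarrow> complex vec"
  assumes \<rho>: "\<rho> > 0"
    and v_carrier: "\<And>u. u \<in> ball 0 \<rho> - {0} \<Longrightarrow> v u \<in> carrier_vec d"
    and v_nonzero: "\<And>u. u \<in> ball 0 \<rho> - {0} \<Longrightarrow> v u \<noteq> 0\<^sub>v d"
begin

abbreviation "e u \<equiv> mat d 1 (\<lambda>(j, _). v u $ j)"

sublocale framed_curve "disc \<rho>" "ball 0 \<rho>" d 1 e
proof -
  interpret coordinate_curve "disc \<rho>" "ball 0 \<rho>" by (rule coordinate_curve_disc[OF \<rho>])
  show "framed_curve (disc \<rho>) (ball 0 \<rho>) d 1 e"
  proof unfold_locales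
    show "pt (disc \<rho>) \<in> topspace (top_of (disc \<rho>))" using \<rho> by simp
    show "e q \<in> carrier_mat d 1" for q by simp
    fix q and c :: "complex vec"
    assume q: "q \<in> topspace (top_of (disc \<rho>)) - {pt (disc \<rho>)}" and c: "c \<in> carrier_vec 1"
      and z: "e q *\<^sub>v c = 0\<^sub>v d"
    have q': "q \<in> ball 0 \<rho> - {0}" using q by simp
    have "c = Matrix.vec 1 (\<lambda>_. c $ 0)" using c by (intro eq_vecI) auto
    then have "e q *\<^sub>v c = (c $ 0) \<cdot>\<^sub>v v q"
      using rank_one_frame[of "e q" d "c $ 0"] line_frame_mult[OF v_carrier[OF q']] by simp
    with z have z': "(c $ 0) \<cdot>\<^sub>v v q = 0\<^sub>v d" by simp
    obtain j where j: "j < d" "v q $ j \<noteq> 0"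
      using v_nonzero[OF q'] v_carrier[OF q'] by (metis carrier_vecD eq_vecI index_zero_vec(1,2))
    have "((c $ 0) \<cdot>\<^sub>v v q) $ j = 0" using z' j by simp
    then have "c $ 0 = 0" using j v_carrier[OF q'] by simp
    then show "c = 0\<^sub>v 1" using c by (intro eq_vecI) auto
  qed
qed

lemma mem_line_span:
  assumes "openin (top_of (disc \<rho>)) U"
  shows "s \<in> frame_span (disc \<rho>) 1 e (\<lambda>_. T) U \<longleftrightarrow>
    (\<exists>f. f \<in> T U \<and> (\<forall>u\<in>U - {0}. s u = f u \<cdot>\<^sub>v v u))"
proof -
  have "s \<in> frame_span (disc \<rho>) 1 e (\<lambda>_. T) U \<longleftrightarrow> (\<exists>f. f \<in> T U \<and>
      (\<forall>u\<in>U - {pt (disc \<rho>)}. s u = f u \<cdot>\<^sub>v (e u *\<^sub>v Matrix.vec 1 (\<lambda>_. 1))))"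
    by (rule mem_rank_one_span[where d = d]) simp
  moreover have "e u *\<^sub>v Matrix.vec 1 (\<lambda>_. 1) = v u" if "u \<in> U - {0}" for u
    by (rule line_frame_mult[OF v_carrier]) (use that assms in \<open>auto simp: openin_disc\<close>)
  ultimately show ?thesis by simp
qed

lemma mem_sec_line:
  assumes "openin (top_of (disc \<rho>)) U"
  shows "s \<in> sec (line_sheaf \<rho> d v) U \<longleftrightarrow>
    (\<exists>f. f \<in> mero (disc \<rho>) U \<and> (\<forall>u\<in>U - {0}. s u = f u \<cdot>\<^sub>v v u))"
  unfolding line_sheaf_def framed_sheaf_def filtered_sheaf.simps by (rule mem_line_span[OF assms])

lemma mem_fil_line:
  assumes "openin (top_of (disc \<rho>)) U"
  shows "s \<in> fil (line_sheaf \<rho> d v) \<alpha> U \<longleftrightarrow>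
    (\<exists>f. f \<in> pole_le (disc \<rho>) \<lfloor>\<alpha>\<rfloor> U \<and> (\<forall>u\<in>U - {0}. s u = f u \<cdot>\<^sub>v v u))"
  unfolding line_sheaf_def framed_sheaf_def filtered_sheaf.simps diff_zero by (rule mem_line_span[OF assms])

lemma line_pole_shift:
  assumes U: "openin (top_of (disc \<rho>)) U"
  shows "(\<exists>f. f \<in> pole_le (disc \<rho>) 0 U \<and> (\<forall>u\<in>U - {0}. u powi k \<cdot>\<^sub>v s u = f u \<cdot>\<^sub>v v u)) \<longleftrightarrow>
    (\<exists>f. f \<in> pole_le (disc \<rho>) k U \<and> (\<forall>u\<in>U - {0}. s u = f u \<cdot>\<^sub>v v u))" (is "?L \<longleftrightarrow> ?R")
proof -
  have Ub: "U \<subseteq> ball 0 \<rho>" using U by (simp add: openin_disc)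
  have inv: "u powi (- k) * u powi k = 1" if "u \<in> U - {0}" for u :: complex
    using that by (subst power_int_add[symmetric]) auto
  show ?thesis
  proof
    assume ?L
    then obtain f where f: "f \<in> pole_le (disc \<rho>) 0 U \<and> (\<forall>u\<in>U - {0}. u powi k \<cdot>\<^sub>v s u = f u \<cdot>\<^sub>v v u)" ..
    have "(\<lambda>u. u powi (- k) * f u) \<in> pole_le (disc \<rho>) k U"
      using pole_le_mult[OF U pole_le_coord_powi[OF U Ub, of k] conjunct1[OF f]] by simp
    moreover have "s u = (u powi (- k) * f u) \<cdot>\<^sub>v v u" if u: "u \<in> U - {0}" for u
    proof -
      have "s u = (u powi (- k) * u powi k) \<cdot>\<^sub>v s u" unfolding inv[OF u] by simp
      also have "\<dots> = u powi (- k) \<cdot>\<^sub>v (u powi k \<cdot>\<^sub>v s u)" by (rule smult_smult_assoc[symmetric])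
      also have "\<dots> = (u powi (- k) * f u) \<cdot>\<^sub>v v u"
        unfolding bspec[OF conjunct2[OF f] u] by (rule smult_smult_assoc)
      finally show ?thesis .
    qed
    ultimately show ?R by (intro exI[of _ "\<lambda>u. u powi (- k) * f u"] conjI ballI)
  next
    assume ?R
    then obtain f where f: "f \<in> pole_le (disc \<rho>) k U \<and> (\<forall>u\<in>U - {0}. s u = f u \<cdot>\<^sub>v v u)" ..
    have "(\<lambda>u. u powi k * f u) \<in> pole_le (disc \<rho>) 0 U"
      using pole_le_mult[OF U pole_le_coord_powi[OF U Ub, of "- k"] conjunct1[OF f]] by simp
    moreover have "u powi k \<cdot>\<^sub>v s u = (u powi k * f u) \<cdot>\<^sub>v v u" if u: "u \<in> U - {0}" for u
      unfolding bspec[OF conjunct2[OF f] u] by (rule smult_smult_assoc)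
    ultimately show ?L by (intro exI[of _ "\<lambda>u. u powi k * f u"] conjI ballI)
  qed
qed

lemma filtered_bundle_line: "filtered_bundle (disc \<rho>) d 1 (line_sheaf \<rho> d v)"
  unfolding line_sheaf_def by (rule framed_sheaf_filtered_bundle)

lemma line_sheaf_pole_order:
  "\<exists>M. locally_free (disc \<rho>) (hol (disc \<rho>)) d 1 M \<and>
     (\<forall>U. openin (top_of (disc \<rho>)) U \<longrightarrow>
        sec (line_sheaf \<rho> d v) U = sec (pole_order_filtration M) U \<and>
        (\<forall>\<alpha>. fil (line_sheaf \<rho> d v) \<alpha> U = fil (pole_order_filtration M) \<alpha> U))"
proof -
  define M where "M = frame_span (disc \<rho>) 1 e (\<lambda>_. pole_le (disc \<rho>) 0)"
  have lf: "locally_free (disc \<rho>) (hol (disc \<rho>)) d 1 M"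
    unfolding M_def by (rule locally_free_hol)
  have shift: "(\<lambda>u. u powi k \<cdot>\<^sub>v s u) \<in> M U \<longleftrightarrow>
      (\<exists>f. f \<in> pole_le (disc \<rho>) k U \<and> (\<forall>u\<in>U - {0}. s u = f u \<cdot>\<^sub>v v u))"
    if "openin (top_of (disc \<rho>)) U" for U s k
    unfolding M_def mem_line_span[OF that] by (rule line_pole_shift[OF that])
  have f: "fil (line_sheaf \<rho> d v) \<alpha> U = fil (pole_order_filtration M) \<alpha> U"
    if U: "openin (top_of (disc \<rho>)) U" for U \<alpha>
  proof (rule Set.set_eqI)
    fix s show "s \<in> fil (line_sheaf \<rho> d v) \<alpha> U \<longleftrightarrow> s \<in> fil (pole_order_filtration M) \<alpha> U"
      unfolding mem_fil_line[OF U] pole_order_filtration_def filtered_sheaf.simps mem_Collect_eq shift[OF U] ..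
  qed
  have s: "sec (line_sheaf \<rho> d v) U = sec (pole_order_filtration M) U"
    if U: "openin (top_of (disc \<rho>)) U" for U
  proof (rule Set.set_eqI)
    fix s
    have "s \<in> sec (pole_order_filtration M) U \<longleftrightarrow> (\<exists>n::nat. (\<lambda>u. u powi (int n) \<cdot>\<^sub>v s u) \<in> M U)"
      unfolding pole_order_filtration_def filtered_sheaf.simps mem_Collect_eq power_int_of_nat ..
    also have "\<dots> \<longleftrightarrow> (\<exists>n::nat. \<exists>f. f \<in> pole_le (disc \<rho>) (int n) U \<and> (\<forall>u\<in>U - {0}. s u = f u \<cdot>\<^sub>v v u))"
      unfolding shift[OF U] ..
    also have "\<dots> \<longleftrightarrow> (\<exists>f. f \<in> mero (disc \<rho>) U \<and> (\<forall>u\<in>U - {0}. s u = f u \<cdot>\<^sub>v v u))"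
      unfolding mero_iff_nat[OF U] by blast
    finally show "s \<in> sec (line_sheaf \<rho> d v) U \<longleftrightarrow> s \<in> sec (pole_order_filtration M) U"
      unfolding mem_sec_line[OF U] ..
  qed
  show ?thesis using lf f s by (intro exI[of _ M]) simp
qed

text \<open>
  On a line of eigenvectors an operator acts by multiplication with its eigenvalue, and a simple pole of \<open>l - a\<close>
  raises the filtration by one.
\<close>

lemma line_sheaf_operator:
  assumes U: "openin (top_of (disc \<rho>)) U"
    and \<Phi>: "\<And>u. u \<in> ball 0 \<rho> - {0} \<Longrightarrow> \<Phi> u \<in> carrier_mat d d \<and> \<Phi> u *\<^sub>v v u = l u \<cdot>\<^sub>v v u"
    and l: "\<And>U. openin (top_of (disc \<rho>)) U \<Longrightarrow> l \<in> mero (disc \<rho>) U"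
    and la: "\<And>U. openin (top_of (disc \<rho>)) U \<Longrightarrow> (\<lambda>u. l u - a u) \<in> pole_le (disc \<rho>) 1 U"
  shows "s \<in> sec (line_sheaf \<rho> d v) U \<Longrightarrow> (\<lambda>u. \<Phi> u *\<^sub>v s u) \<in> sec (line_sheaf \<rho> d v) U"
    and "s \<in> fil (line_sheaf \<rho> d v) \<alpha> U \<Longrightarrow>
      (\<lambda>u. \<Phi> u *\<^sub>v s u - a u \<cdot>\<^sub>v s u) \<in> fil (line_sheaf \<rho> d v) (\<alpha> + 1) U"
proof -
  have act: "\<Phi> u *\<^sub>v (c \<cdot>\<^sub>v v u) = (l u * c) \<cdot>\<^sub>v v u" if u: "u \<in> U - {0}" for u c
  proof -
    have u': "u \<in> ball 0 \<rho> - {0}" using u U by (auto simp: openin_disc)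
    have "\<Phi> u *\<^sub>v (c \<cdot>\<^sub>v v u) = c \<cdot>\<^sub>v (\<Phi> u *\<^sub>v v u)"
      by (rule mult_mat_vec[OF conjunct1[OF \<Phi>[OF u']] v_carrier[OF u']])
    also have "\<dots> = (l u * c) \<cdot>\<^sub>v v u"
      unfolding conjunct2[OF \<Phi>[OF u']] smult_smult_assoc by (simp only: mult.commute)
    finally show ?thesis .
  qed
  show "(\<lambda>u. \<Phi> u *\<^sub>v s u) \<in> sec (line_sheaf \<rho> d v) U" if s: "s \<in> sec (line_sheaf \<rho> d v) U"
  proof -
    from s[unfolded mem_sec_line[OF U]] obtain f where
      f: "f \<in> mero (disc \<rho>) U \<and> (\<forall>u\<in>U - {0}. s u = f u \<cdot>\<^sub>v v u)" ..
    have "(\<lambda>u. l u * f u) \<in> mero (disc \<rho>) U" by (rule mero_mult[OF U l[OF U] conjunct1[OF f]])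
    moreover have "\<Phi> u *\<^sub>v s u = (l u * f u) \<cdot>\<^sub>v v u" if "u \<in> U - {0}" for u
      unfolding bspec[OF conjunct2[OF f] that] by (rule act[OF that])
    ultimately show ?thesis unfolding mem_sec_line[OF U]
      by (intro exI[of _ "\<lambda>u. l u * f u"] conjI ballI)
  qed
  show "(\<lambda>u. \<Phi> u *\<^sub>v s u - a u \<cdot>\<^sub>v s u) \<in> fil (line_sheaf \<rho> d v) (\<alpha> + 1) U"
    if s: "s \<in> fil (line_sheaf \<rho> d v) \<alpha> U"
  proof -
    from s[unfolded mem_fil_line[OF U]] obtain f where
      f: "f \<in> pole_le (disc \<rho>) \<lfloor>\<alpha>\<rfloor> U \<and> (\<forall>u\<in>U - {0}. s u = f u \<cdot>\<^sub>v v u)" ..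
    have "(\<lambda>u. (l u - a u) * f u) \<in> pole_le (disc \<rho>) (1 + \<lfloor>\<alpha>\<rfloor>) U"
      by (rule pole_le_mult[OF U la[OF U] conjunct1[OF f]])
    then have "(\<lambda>u. (l u - a u) * f u) \<in> pole_le (disc \<rho>) \<lfloor>\<alpha> + 1\<rfloor> U" by (simp add: add.commute)
    moreover have "\<Phi> u *\<^sub>v s u - a u \<cdot>\<^sub>v s u = ((l u - a u) * f u) \<cdot>\<^sub>v v u" if "u \<in> U - {0}" for u
      unfolding bspec[OF conjunct2[OF f] that] act[OF that]
      by (intro eq_vecI) (simp_all add: algebra_simps)
    ultimately show ?thesis unfolding mem_fil_line[OF U]
      by (intro exI[of _ "\<lambda>u. (l u - a u) * f u"] conjI ballI)
  qed
qed

end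

lemma inverse_matrix_sum:
  fixes A B :: "complex mat"
  assumes "A \<in> carrier_mat n n" "B \<in> carrier_mat n n" "A * B = 1\<^sub>m n" "i < n" "k < n"
  shows "(\<Sum>j<n. A $$ (i, j) * B $$ (j, k)) = (if i = k then 1 else 0)"
proof -
  have "(A * B) $$ (i, k) = (\<Sum>j<n. A $$ (i, j) * B $$ (j, k))"
    using assms(1,2,4,5) by (simp add: scalar_prod_def atLeast0LessThan)
  then show ?thesis using assms(3,4,5) by simp
qed

text \<open>
  Up to the diagonal matrix of powers \<open>u powi weight K N j\<close>, the matrix of eigenvectors is the Vandermonde matrix of the
  rescaled roots \<open>w\<close>. The latter is holomorphic and invertible at the origin, as these roots stay distinct, so
  passing between components and eigenvector coefficients respects the filtrations. The difference between
  eigenvalue and irregular part has a simple pole because \<open>w\<close> differs from the root of unity by a multiple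
  of \<open>u ^ (2 * N + 2 * K)\<close>.
\<close>

lemma good_at_infinity_model:
  assumes K: "K \<ge> 2"
    and deg: "\<forall>i\<in>{2..K}. P i = 0 \<or> real (degree (P i)) \<le> real N * (real i - 1) / real K - 1"
  shows "good_at_infinity K N (model K N (base_poly K N P))"
proof -
  have K1: "K \<ge> 1" using K by simp
  obtain \<rho> w g where \<rho>: "\<rho> > 0" and w: "\<forall>r\<in>{1..K}. w r holomorphic_on ball 0 \<rho>"
    and g: "\<forall>r\<in>{1..K}. g r holomorphic_on ball 0 \<rho>"
    and root: "\<forall>r\<in>{1..K}. \<forall>u\<in>ball 0 \<rho> - {0}.
      poly (base_poly K N P (1 / u ^ (2 * K))) (inverse (u ^ (2 * N)) * w r u) = 0"
    and wg: "\<forall>r\<in>{1..K}. \<forall>u\<in>ball 0 \<rho>. w r u = unity_root K r + u ^ (2 * N + 2 * K) * g r u"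
    and inj: "\<forall>u\<in>ball 0 \<rho>. inj_on (\<lambda>r. w r u) {1..K}"
    by (rule base_poly_roots_at_infinity[OF K deg])
  let ?D = "disc \<rho>"
  let ?b = "weight K N"
  interpret Y: coordinate_curve ?D "ball 0 \<rho>" by (rule coordinate_curve_disc[OF \<rho>])
  have Ub: "U \<subseteq> ball 0 \<rho>" if "Y.opn U" for U using that by (simp add: openin_disc)
  define v where "v r u = Matrix.vec K (\<lambda>j. u powi ?b j * w r u ^ j)" for r u
  define L where "L r = line_sheaf \<rho> K (v r)" for r
  have line: "line_frame \<rho> K (v r)" for r
  proof
    fix u :: complex assume u: "u \<in> ball 0 \<rho> - {0}"
    show "v r u \<in> carrier_vec K" by (simp add: v_def)
    show "v r u \<noteq> 0\<^sub>v K"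
    proof
      assume "v r u = 0\<^sub>v K"
      then have "v r u $ 0 = (0\<^sub>v K :: complex vec) $ 0" by simp
      then show False using K u by (simp add: v_def)
    qed
  qed (rule \<rho>)
  note mem_sec = line_frame.mem_sec_line[OF line, folded L_def]
  note mem_fil = line_frame.mem_fil_line[OF line, folded L_def]
  define G where "G u = mat K K (\<lambda>(j, r). w (Suc r) u ^ j)" for u
  have Gc: "G u \<in> carrier_mat K K" for u by (simp add: G_def)
  have Gdet: "det (G u) \<noteq> 0" if u: "u \<in> ball 0 \<rho>" for u
    unfolding G_def
  proof (rule det_vandermonde_nonzero[of "\<lambda>r. w (Suc r) u"])
    show "inj_on (\<lambda>r. w (Suc r) u) {..<K}"
    proof (rule inj_onI)
      fix r s assume rs: "r \<in> {..<K}" "s \<in> {..<K}" "w (Suc r) u = w (Suc s) u"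
      have "Suc r = Suc s" by (rule inj_onD[OF bspec[OF inj u] rs(3)]) (use rs in simp_all)
      then show "r = s" by simp
    qed
  qed
  have Ghol: "(\<lambda>u. G u $$ (i, j)) holomorphic_on ball 0 \<rho>" if "i < K" "j < K" for i j
  proof -
    have "w (Suc j) holomorphic_on ball 0 \<rho>" using w that by simp
    then show ?thesis using that by (simp add: G_def holomorphic_on_power)
  qed
  obtain B where B: "\<forall>u\<in>ball 0 \<rho>. B u \<in> carrier_mat K K \<and> G u * B u = 1\<^sub>m K \<and> B u * G u = 1\<^sub>m K"
    and Bhol: "\<forall>i<K. \<forall>j<K. (\<lambda>u. B u $$ (i, j)) holomorphic_on ball 0 \<rho>"
  proof (rule holomorphic_inverse_matrix[of "ball 0 \<rho>" G K])
    show "G u \<in> carrier_mat K K" for u by (rule Gc)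
    show "(\<lambda>u. G u $$ (i, j)) holomorphic_on ball 0 \<rho>" if "i < K" "j < K" for i j by (rule Ghol[OF that])
    show "det (G u) \<noteq> 0" if "u \<in> ball 0 \<rho>" for u by (rule Gdet[OF that])
  qed (rule that)
  have pw: "u powi ?b j * u powi (- ?b j) = 1" if "u \<noteq> 0" for u :: complex and j
    using that by (subst power_int_add[symmetric]) auto
  have reindex: "(\<Sum>r\<in>{1..K}. F r) = (\<Sum>r<K. F (Suc r))" for F :: "nat \<Rightarrow> complex"
    by (simp add: sum.atLeast1_atMost_eq)
  \<comment> \<open>the coefficients of a vector in the eigenbasis, by inverting \<open>diag (u ^ weight j) * G u\<close>\<close>
  define c where "c s r u = (\<Sum>j<K. B u $$ (r - 1, j) * (u powi (- ?b j) * s u $ j))"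
    for s :: "complex \<Rightarrow> complex vec" and r u
  have expand: "s u = Matrix.vec K (\<lambda>j. \<Sum>r\<in>{1..K}. (c s r u \<cdot>\<^sub>v v r u) $ j)"
    if s: "s u \<in> carrier_vec K" and u: "u \<in> ball 0 \<rho> - {0}" for s u
  proof (rule eq_vecI)
    fix j assume "j < dim_vec (Matrix.vec K (\<lambda>j. \<Sum>r\<in>{1..K}. (c s r u \<cdot>\<^sub>v v r u) $ j))"
    then have j: "j < K" by simp
    have u': "u \<in> ball 0 \<rho>" "u \<noteq> 0" using u by auto
    have "(\<Sum>r\<in>{1..K}. (c s r u \<cdot>\<^sub>v v r u) $ j) =
        (\<Sum>r<K. \<Sum>j'<K. u powi ?b j * (G u $$ (j, r) * B u $$ (r, j')) * (u powi (- ?b j') * s u $ j'))"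
      unfolding reindex using j
      by (intro sum.cong) (simp_all add: c_def v_def G_def sum_distrib_right sum_distrib_left mult_ac)
    also have "\<dots> = (\<Sum>j'<K. u powi ?b j * (\<Sum>r<K. G u $$ (j, r) * B u $$ (r, j')) * (u powi (- ?b j') * s u $ j'))"
      by (subst sum.swap) (simp add: sum_distrib_left sum_distrib_right)
    also have "\<dots> = (\<Sum>j'<K. if j' = j then u powi ?b j * (u powi (- ?b j') * s u $ j') else 0)"
      using B u' j inverse_matrix_sum[OF Gc, of "B u" u j] by (intro sum.cong) auto
    also have "\<dots> = s u $ j" using j pw[OF u'(2), of j] by (simp add: mult.assoc[symmetric])
    finally show "s u $ j = Matrix.vec K (\<lambda>j. \<Sum>r\<in>{1..K}. (c s r u \<cdot>\<^sub>v v r u) $ j) $ j" using j by simp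
  qed (use s in simp)
  have unique: "f r = 0"
    if z: "Matrix.vec K (\<lambda>j. \<Sum>r\<in>{1..K}. (f r \<cdot>\<^sub>v v r u) $ j) = 0\<^sub>v K" and u: "u \<in> ball 0 \<rho> - {0}"
      and r: "r \<in> {1..K}" for f u r
  proof -
    have u': "u \<in> ball 0 \<rho>" "u \<noteq> 0" using u by auto
    have G0: "(\<Sum>i<K. G u $$ (j, i) * f (Suc i)) = 0" if j: "j < K" for j
    proof -
      have "Matrix.vec K (\<lambda>j. \<Sum>r\<in>{1..K}. (f r \<cdot>\<^sub>v v r u) $ j) $ j = (0\<^sub>v K :: complex vec) $ j"
        unfolding z ..
      then have "(\<Sum>i<K. (f (Suc i) \<cdot>\<^sub>v v (Suc i) u) $ j) = 0" using j by (simp only: reindex index_vec index_zero_vec)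
      moreover have "(\<Sum>i<K. (f (Suc i) \<cdot>\<^sub>v v (Suc i) u) $ j) = u powi ?b j * (\<Sum>i<K. G u $$ (j, i) * f (Suc i))"
        using j unfolding sum_distrib_left by (intro sum.cong) (simp_all add: v_def G_def mult_ac)
      ultimately show ?thesis using u'(2) by simp
    qed
    have r': "r - 1 < K" "Suc (r - 1) = r" using r by auto
    have "0 = (\<Sum>j<K. B u $$ (r - 1, j) * (\<Sum>i<K. G u $$ (j, i) * f (Suc i)))" using G0 by simp
    also have "\<dots> = (\<Sum>i<K. (\<Sum>j<K. B u $$ (r - 1, j) * G u $$ (j, i)) * f (Suc i))"
      unfolding sum_distrib_left sum_distrib_right by (subst sum.swap) (simp add: mult.assoc)
    also have "\<dots> = (\<Sum>i<K. if i = r - 1 then f (Suc i) else 0)"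
      using B u' r' inverse_matrix_sum[OF _ Gc, of "B u" u "r - 1"] by (intro sum.cong) auto
    also have "\<dots> = f r" using r' by simp
    finally show ?thesis by simp
  qed
  have wpole: "(\<lambda>u. u powi ?b j * w r u ^ j) \<in> pole_le ?D (- ?b j) U"
    if U: "Y.opn U" and r: "r \<in> {1..K}" for U r j
  proof -
    have "w r holomorphic_on U" using w r holomorphic_on_subset[OF _ Ub[OF U]] by blast
    then have "(\<lambda>u. w r u ^ j) \<in> hol ?D U" by (simp add: holomorphic_on_power)
    from Y.pole_le_mult[OF U Y.pole_le_coord_powi[OF U Ub[OF U], of "- ?b j"] Y.hol_pole_le[OF U this]]
    show ?thesis by simp
  qed
  have cpole: "c s r \<in> pole_le ?D n U"
    if U: "Y.opn U" and r: "r \<in> {1..K}" and s: "\<forall>j<K. (\<lambda>q. s q $ j) \<in> pole_le ?D (n - ?b j) U"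
    for U r n and s :: "complex \<Rightarrow> complex vec"
    unfolding c_def
  proof (rule Y.pole_le_sum[OF U])
    fix j assume j: "j \<in> {..<K}"
    have "r - 1 < K" "j < K" using r j by auto
    then have "(\<lambda>u. B u $$ (r - 1, j)) holomorphic_on U"
      by (intro holomorphic_on_subset[OF Bhol[rule_format] Ub[OF U]])
    then have "(\<lambda>u. B u $$ (r - 1, j)) \<in> hol ?D U" by simp
    moreover have "(\<lambda>q. s q $ j) \<in> pole_le ?D (n - ?b j) U" using s j by simp
    ultimately have "(\<lambda>u. B u $$ (r - 1, j) * (coord ?D u powi (- ?b j) * s u $ j)) \<in>
        pole_le ?D (0 + (?b j + (n - ?b j))) U"
      by (intro Y.pole_le_mult[OF U] Y.hol_pole_le[OF U] Y.pole_le_coord_powi[OF U Ub[OF U]])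
    then show "(\<lambda>u. B u $$ (r - 1, j) * (u powi (- ?b j) * s u $ j)) \<in> pole_le ?D n U" by simp
  qed
  have cmero: "c s r \<in> mero ?D U"
    if U: "Y.opn U" and r: "r \<in> {1..K}" and s: "\<forall>j<K. (\<lambda>q. s q $ j) \<in> mero ?D U"
    for U r and s :: "complex \<Rightarrow> complex vec"
  proof -
    have "\<forall>j\<in>{..<K}. \<exists>k. (\<lambda>q. s q $ j) \<in> pole_le ?D k U" using s Y.mero_iff[OF U] by simp
    from bchoice[OF this] obtain k where k: "\<forall>j\<in>{..<K}. (\<lambda>q. s q $ j) \<in> pole_le ?D (k j) U" ..
    define n where "n = Max ((\<lambda>j. k j + ?b j) ` {..<K})"
    have "\<forall>j<K. (\<lambda>q. s q $ j) \<in> pole_le ?D (n - ?b j) U"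
    proof (intro allI impI)
      fix j assume j: "j < K"
      have "k j + ?b j \<le> n" unfolding n_def using j by (intro Max_ge) auto
      then show "(\<lambda>q. s q $ j) \<in> pole_le ?D (n - ?b j) U"
        by (intro Y.pole_le_mono[OF U bspec[OF k]]) (use j in simp_all)
    qed
    from cpole[OF U r this] show ?thesis by (rule Y.pole_le_mero[OF U])
  qed
  have ds: "filtered_direct_sum ?D K {1..K} L (pullback ?D CP1 (cover_map K) (2 * K) K (model_sheaf K N))"
    unfolding filtered_direct_sum_def pt_disc
  proof (intro allI impI conjI ballI)
    fix U assume U: "Y.opn U"
    have cL: "(\<lambda>u. c s r u \<cdot>\<^sub>v v r u) \<in> sec (L r) U" if "c s r \<in> mero ?D U" for s r
      unfolding mem_sec[OF U] using that by (intro exI[of _ "c s r"]) simp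
    have cF: "(\<lambda>u. c s r u \<cdot>\<^sub>v v r u) \<in> fil (L r) \<alpha> U" if "c s r \<in> pole_le ?D \<lfloor>\<alpha>\<rfloor> U" for s r \<alpha>
      unfolding mem_fil[OF U] using that by (intro exI[of _ "c s r"]) simp
    have comb: "s u = Matrix.vec K (\<lambda>j. \<Sum>r\<in>{1..K}. ((\<lambda>u. c s r u \<cdot>\<^sub>v v r u) u) $ j)"
      if "\<forall>q\<in>U - {0}. s q \<in> carrier_vec K" "u \<in> U - {0}" for u and s :: "complex \<Rightarrow> complex vec"
      by (rule expand[of s u]) (use that Ub[OF U] in blast)+
    have tj: "(\<Sum>r\<in>{1..K}. t r u $ j) = (\<Sum>r\<in>{1..K}. f r u * (u powi ?b j * w r u ^ j))"
      if "\<forall>r\<in>{1..K}. \<forall>u\<in>U - {0}. t r u = f r u \<cdot>\<^sub>v v r u" "u \<in> U - {0}" "j < K"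
      for f u j and t :: "nat \<Rightarrow> complex \<Rightarrow> complex vec"
      using that by (intro sum.cong) (simp_all add: v_def)
    show "sec (pullback ?D CP1 (cover_map K) (2 * K) K (model_sheaf K N)) U =
        {s. \<exists>t. (\<forall>r\<in>{1..K}. t r \<in> sec (L r) U) \<and>
           (\<forall>q\<in>U - {0}. s q = Matrix.vec K (\<lambda>j. \<Sum>r\<in>{1..K}. t r q $ j))}"
    proof (rule Set.set_eqI, unfold mem_sec_pullback_model[OF K1 \<rho> U] mem_Collect_eq, rule iffI)
      fix s :: "complex \<Rightarrow> complex vec"
      assume s: "(\<forall>q\<in>U - {0}. s q \<in> carrier_vec K) \<and> (\<forall>j<K. (\<lambda>q. s q $ j) \<in> mero ?D U)"
      show "\<exists>t. (\<forall>r\<in>{1..K}. t r \<in> sec (L r) U) \<and> (\<forall>q\<in>U - {0}. s q = Matrix.vec K (\<lambda>j. \<Sum>r\<in>{1..K}. t r q $ j))"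
      proof (rule exI[of _ "\<lambda>r u. c s r u \<cdot>\<^sub>v v r u"], intro conjI ballI)
        show "(\<lambda>u. c s r u \<cdot>\<^sub>v v r u) \<in> sec (L r) U" if "r \<in> {1..K}" for r
          by (rule cL[OF cmero[OF U that conjunct2[OF s]]])
      qed (rule comb[OF conjunct1[OF s]])
    next
      fix s :: "complex \<Rightarrow> complex vec"
      assume "\<exists>t. (\<forall>r\<in>{1..K}. t r \<in> sec (L r) U) \<and> (\<forall>q\<in>U - {0}. s q = Matrix.vec K (\<lambda>j. \<Sum>r\<in>{1..K}. t r q $ j))"
      then obtain t :: "nat \<Rightarrow> complex \<Rightarrow> complex vec" where t: "\<forall>r\<in>{1..K}. t r \<in> sec (L r) U"
        and s: "\<forall>q\<in>U - {0}. s q = Matrix.vec K (\<lambda>j. \<Sum>r\<in>{1..K}. t r q $ j)" by (elim exE conjE)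
      have "\<forall>r\<in>{1..K}. \<exists>f. f \<in> mero ?D U \<and> (\<forall>u\<in>U - {0}. t r u = f u \<cdot>\<^sub>v v r u)"
        using t unfolding mem_sec[OF U] .
      from bchoice[OF this] obtain f where f: "\<forall>r\<in>{1..K}. f r \<in> mero ?D U \<and> (\<forall>u\<in>U - {0}. t r u = f r u \<cdot>\<^sub>v v r u)" ..
      have "(\<lambda>q. s q $ j) \<in> mero ?D U" if j: "j < K" for j
      proof (rule Y.mero_cong[OF U])
        show "(\<lambda>u. \<Sum>r\<in>{1..K}. f r u * (u powi ?b j * w r u ^ j)) \<in> mero ?D U"
          by (intro Y.mero_sum[OF U] Y.mero_mult[OF U] Y.pole_le_mero[OF U wpole[OF U]]) (use f in simp_all)
        fix u assume "u \<in> U - {pt ?D}"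
        then have u: "u \<in> U - {0}" by simp
        have "s u $ j = (\<Sum>r\<in>{1..K}. t r u $ j)" using bspec[OF s u] j by simp
        also have "\<dots> = (\<Sum>r\<in>{1..K}. f r u * (u powi ?b j * w r u ^ j))"
          by (rule tj[OF _ u j]) (use f in blast)
        finally show "s u $ j = (\<Sum>r\<in>{1..K}. f r u * (u powi ?b j * w r u ^ j))" .
      qed
      then show "(\<forall>q\<in>U - {0}. s q \<in> carrier_vec K) \<and> (\<forall>j<K. (\<lambda>q. s q $ j) \<in> mero ?D U)"
        using s by simp
    qed
    show "fil (pullback ?D CP1 (cover_map K) (2 * K) K (model_sheaf K N)) \<alpha> U =
        {s. \<exists>t. (\<forall>r\<in>{1..K}. t r \<in> fil (L r) \<alpha> U) \<and>
           (\<forall>q\<in>U - {0}. s q = Matrix.vec K (\<lambda>j. \<Sum>r\<in>{1..K}. t r q $ j))}" for \<alpha>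
    proof (rule Set.set_eqI, unfold mem_fil_pullback_model[OF K1 \<rho> U] mem_Collect_eq, rule iffI)
      fix s :: "complex \<Rightarrow> complex vec"
      assume s: "(\<forall>q\<in>U - {0}. s q \<in> carrier_vec K) \<and> (\<forall>j<K. (\<lambda>q. s q $ j) \<in> pole_le ?D (\<lfloor>\<alpha>\<rfloor> - ?b j) U)"
      show "\<exists>t. (\<forall>r\<in>{1..K}. t r \<in> fil (L r) \<alpha> U) \<and> (\<forall>q\<in>U - {0}. s q = Matrix.vec K (\<lambda>j. \<Sum>r\<in>{1..K}. t r q $ j))"
      proof (rule exI[of _ "\<lambda>r u. c s r u \<cdot>\<^sub>v v r u"], intro conjI ballI)
        show "(\<lambda>u. c s r u \<cdot>\<^sub>v v r u) \<in> fil (L r) \<alpha> U" if "r \<in> {1..K}" for r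
          by (rule cF[OF cpole[OF U that conjunct2[OF s]]])
      qed (rule comb[OF conjunct1[OF s]])
    next
      fix s :: "complex \<Rightarrow> complex vec"
      assume "\<exists>t. (\<forall>r\<in>{1..K}. t r \<in> fil (L r) \<alpha> U) \<and> (\<forall>q\<in>U - {0}. s q = Matrix.vec K (\<lambda>j. \<Sum>r\<in>{1..K}. t r q $ j))"
      then obtain t :: "nat \<Rightarrow> complex \<Rightarrow> complex vec" where t: "\<forall>r\<in>{1..K}. t r \<in> fil (L r) \<alpha> U"
        and s: "\<forall>q\<in>U - {0}. s q = Matrix.vec K (\<lambda>j. \<Sum>r\<in>{1..K}. t r q $ j)" by (elim exE conjE)
      have "\<forall>r\<in>{1..K}. \<exists>f. f \<in> pole_le ?D \<lfloor>\<alpha>\<rfloor> U \<and> (\<forall>u\<in>U - {0}. t r u = f u \<cdot>\<^sub>v v r u)"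
        using t unfolding mem_fil[OF U] .
      from bchoice[OF this] obtain f where f: "\<forall>r\<in>{1..K}. f r \<in> pole_le ?D \<lfloor>\<alpha>\<rfloor> U \<and> (\<forall>u\<in>U - {0}. t r u = f r u \<cdot>\<^sub>v v r u)" ..
      have "(\<lambda>q. s q $ j) \<in> pole_le ?D (\<lfloor>\<alpha>\<rfloor> - ?b j) U" if j: "j < K" for j
      proof (rule Y.pole_le_cong[OF U])
        have "(\<lambda>u. \<Sum>r\<in>{1..K}. f r u * (u powi ?b j * w r u ^ j)) \<in> pole_le ?D (\<lfloor>\<alpha>\<rfloor> + - ?b j) U"
          by (intro Y.pole_le_sum[OF U] Y.pole_le_mult[OF U] wpole[OF U]) (use f in simp_all)
        then show "(\<lambda>u. \<Sum>r\<in>{1..K}. f r u * (u powi ?b j * w r u ^ j)) \<in> pole_le ?D (\<lfloor>\<alpha>\<rfloor> - ?b j) U" by simp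
        fix u assume "u \<in> U - {pt ?D}"
        then have u: "u \<in> U - {0}" by simp
        have "s u $ j = (\<Sum>r\<in>{1..K}. t r u $ j)" using bspec[OF s u] j by simp
        also have "\<dots> = (\<Sum>r\<in>{1..K}. f r u * (u powi ?b j * w r u ^ j))"
          by (rule tj[OF _ u j]) (use f in blast)
        finally show "s u $ j = (\<Sum>r\<in>{1..K}. f r u * (u powi ?b j * w r u ^ j))" .
      qed
      then show "(\<forall>q\<in>U - {0}. s q \<in> carrier_vec K) \<and> (\<forall>j<K. (\<lambda>q. s q $ j) \<in> pole_le ?D (\<lfloor>\<alpha>\<rfloor> - ?b j) U)"
        using s by simp
    qed
    fix t :: "nat \<Rightarrow> complex \<Rightarrow> complex vec" and r q
    assume t: "\<forall>r\<in>{1..K}. t r \<in> sec (L r) U"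
      and z: "\<forall>q\<in>U - {0}. Matrix.vec K (\<lambda>j. \<Sum>r\<in>{1..K}. t r q $ j) = 0\<^sub>v K"
      and r: "r \<in> {1..K}" and q: "q \<in> U - {0}"
    have "\<forall>r\<in>{1..K}. \<exists>a. t r q = a \<cdot>\<^sub>v v r q"
    proof
      fix r assume "r \<in> {1..K}"
      from bspec[OF t this, unfolded mem_sec[OF U]] obtain f where
        "f \<in> mero ?D U \<and> (\<forall>u\<in>U - {0}. t r u = f u \<cdot>\<^sub>v v r u)" ..
      from bspec[OF conjunct2[OF this] q] show "\<exists>a. t r q = a \<cdot>\<^sub>v v r q" ..
    qed
    from bchoice[OF this] obtain a where a: "\<forall>r\<in>{1..K}. t r q = a r \<cdot>\<^sub>v v r q" ..
    have "Matrix.vec K (\<lambda>j. \<Sum>r\<in>{1..K}. (a r \<cdot>\<^sub>v v r q) $ j) = Matrix.vec K (\<lambda>j. \<Sum>r\<in>{1..K}. t r q $ j)"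
      by (rule arg_cong[where f = "Matrix.vec K"], rule ext, rule sum.cong[OF refl]) (simp only: a[rule_format])
    also have "\<dots> = 0\<^sub>v K" by (rule bspec[OF z q])
    finally have z': "Matrix.vec K (\<lambda>j. \<Sum>r\<in>{1..K}. (a r \<cdot>\<^sub>v v r q) $ j) = 0\<^sub>v K" .
    have "q \<in> ball 0 \<rho> - {0}" using q Ub[OF U] by blast
    from unique[OF z' this r] have "a r = 0" .
    then have "t r q = 0 \<cdot>\<^sub>v v r q" using bspec[OF a r] by simp
    then show "t r q = 0\<^sub>v K" by (simp add: v_def zero_vec_def smult_vec_def)
  qed
  define l where "l r u = - 2 * of_nat K / u ^ (2 * K + 1) * (inverse (u ^ (2 * N)) * w r u)" for r u
  have eig: "pulled_back_higgs K (model K N (base_poly K N P)) u \<in> carrier_mat K K \<and>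
      pulled_back_higgs K (model K N (base_poly K N P)) u *\<^sub>v v r u = l r u \<cdot>\<^sub>v v r u"
    if r: "r \<in> {1..K}" and u: "u \<in> ball 0 \<rho> - {0}" for r u
  proof -
    have u0: "u \<noteq> 0" using u by auto
    let ?A = "model_higgs K (base_poly K N P) (Some (1 / u ^ (2 * K)))"
    have A: "?A \<in> carrier_mat K K" by (simp add: model_higgs_def)
    have Phi: "pulled_back_higgs K (model K N (base_poly K N P)) u = (- 2 * of_nat K / u ^ (2 * K + 1)) \<cdot>\<^sub>m ?A"
      unfolding pulled_back_higgs_nz[OF u0] by (simp add: model_def)
    define y where "y = inverse (u ^ (2 * N)) * w r u"
    define x where "x = Matrix.vec K (\<lambda>j. y ^ j)"
    have vx: "v r u = u powi (int N * (int K - 1)) \<cdot>\<^sub>v x"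
    proof (rule eq_vecI)
      fix j assume "j < dim_vec (u powi (int N * (int K - 1)) \<cdot>\<^sub>v x)"
      then have j: "j < K" by (simp add: x_def)
      have "?b j = int N * (int K - 1) + - int (2 * N * j)" by (simp add: weight_def algebra_simps)
      then have "u powi ?b j = u powi (int N * (int K - 1)) * inverse (u ^ (2 * N * j))"
        using u0 by (simp only: power_int_add power_int_minus power_int_of_nat simp_thms)
      then have "u powi ?b j = u powi (int N * (int K - 1)) * inverse (u ^ (2 * N)) ^ j"
        unfolding power_mult power_inverse .
      then show "v r u $ j = (u powi (int N * (int K - 1)) \<cdot>\<^sub>v x) $ j"
        using j by (simp add: v_def x_def y_def power_mult_distrib mult.assoc)
    qed (simp add: v_def x_def)
    have xc: "x \<in> carrier_vec K" by (simp add: x_def)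
    have "?A *\<^sub>v x = y \<cdot>\<^sub>v x" unfolding x_def
      by (rule model_higgs_eigenvector[OF K]) (use root r u in \<open>simp add: y_def\<close>)
    then have "?A *\<^sub>v v r u = y \<cdot>\<^sub>v v r u"
      unfolding vx using mult_mat_vec[OF A xc] by (simp add: smult_smult_assoc mult.commute)
    moreover have "v r u \<in> carrier_vec K" by (simp add: v_def)
    ultimately show ?thesis unfolding Phi using A
      by (simp add: smult_mat_mult_vec[OF A] smult_smult_assoc l_def y_def)
  qed
  have lmero: "l r \<in> mero ?D U" if r: "r \<in> {1..K}" and U: "Y.opn U" for r U
  proof -
    have "w r holomorphic_on U" using w r holomorphic_on_subset[OF _ Ub[OF U]] by blast
    then have "w r \<in> pole_le ?D 0 U" by (intro Y.hol_pole_le[OF U]) simp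
    from Y.pole_le_cmult[OF U Y.pole_le_mult[OF U Y.pole_le_coord_powi[OF U Ub[OF U], of "int (2 * N + 2 * K + 1)"] this],
        of "- 2 * of_nat K"]
    have "(\<lambda>u. - 2 * of_nat K * (u powi (- int (2 * N + 2 * K + 1)) * w r u)) \<in> mero ?D U"
      unfolding coord_disc by (rule Y.pole_le_mero[OF U])
    moreover have "l r = (\<lambda>u. - 2 * of_nat K * (u powi (- int (2 * N + 2 * K + 1)) * w r u))"
      unfolding l_def power_int_minus power_int_of_nat
      by (rule ext) (simp add: power_add divide_inverse mult_ac)
    ultimately show ?thesis by simp
  qed
  have lpole: "(\<lambda>u. l r u - deriv (irregular_part K N r) u) \<in> pole_le ?D 1 U"
    if r: "r \<in> {1..K}" and U: "Y.opn U" for r U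
  proof (rule Y.pole_le_cong[OF U])
    have "g r holomorphic_on U" using g r holomorphic_on_subset[OF _ Ub[OF U]] by blast
    then have "g r \<in> pole_le ?D 0 U" by (intro Y.hol_pole_le[OF U]) simp
    from Y.pole_le_cmult[OF U Y.pole_le_mult[OF U Y.pole_le_coord_powi[OF U Ub[OF U], of 1] this],
        of "- 2 * of_nat K"]
    show "(\<lambda>u. - 2 * of_nat K * (u powi (- 1) * g r u)) \<in> pole_le ?D 1 U" by simp
    fix u assume u: "u \<in> U - {pt ?D}"
    then have u': "u \<noteq> 0" "u \<in> ball 0 \<rho>" using Ub[OF U] by auto
    have "w r u = unity_root K r + u ^ (2 * N + 2 * K) * g r u" using wg r u' by blast
    then show "l r u - deriv (irregular_part K N r) u = - 2 * of_nat K * (u powi (- 1) * g r u)"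
      unfolding l_def deriv_irregular_part[OF u'(1) K1] using u'(1)
      by (simp add: power_add field_simps)
  qed
  show ?thesis
    unfolding good_at_infinity_def
  proof (rule exI[of _ \<rho>], intro conjI \<rho>, rule exI[of _ L], intro conjI ballI allI impI)
    show "filtered_direct_sum ?D K {1..K} L (pullback ?D CP1 (cover_map K) (2 * K) K (underlying (model K N (base_poly K N P))))"
      using ds by (simp add: model_def)
    fix r assume r: "r \<in> {1..K}"
    show "filtered_bundle ?D K 1 (L r)" unfolding L_def by (rule line_frame.filtered_bundle_line[OF line])
    show "\<exists>M. locally_free ?D (hol ?D) K 1 M \<and> (\<forall>U. Y.opn U \<longrightarrow> sec (L r) U = sec (pole_order_filtration M) U \<and>
        (\<forall>\<alpha>. fil (L r) \<alpha> U = fil (pole_order_filtration M) \<alpha> U))"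
      unfolding L_def by (rule line_frame.line_sheaf_pole_order[OF line])
    fix U assume U: "Y.opn U"
    note ops = line_frame.line_sheaf_operator[OF line U eig[OF r] lmero[OF r] lpole[OF r], folded L_def]
    show "(\<lambda>u. pulled_back_higgs K (model K N (base_poly K N P)) u *\<^sub>v s u) \<in> sec (L r) U"
      if "s \<in> sec (L r) U" for s by (rule ops(1)[OF _ _ _ that])
    show "(\<lambda>u. pulled_back_higgs K (model K N (base_poly K N P)) u *\<^sub>v s u -
        deriv (irregular_part K N r) u \<cdot>\<^sub>v s u) \<in> fil (L r) (\<alpha> + 1) U"
      if "s \<in> fil (L r) \<alpha> U" for s \<alpha> by (rule ops(2)[OF _ _ _ that])
  qed
qed

section \<open>The image of the Hitchin map\<close>

lemma char_higgs_isomorphic: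
  assumes "C_isomorphism K g H H'" "H \<in> C_objects K N" "H' \<in> C_objects K N"
  shows "char_higgs H' = char_higgs H"
proof (rule ext)
  fix z
  have car: "higgs H (Some z) \<in> carrier_mat K K" "higgs H' (Some z) \<in> carrier_mat K K"
    using assms(2,3) by (simp_all add: C_objects_def filtered_SL_Higgs_bundle_def)
  have g: "g (Some z) \<in> carrier_mat K K" "invertible_mat (g (Some z))"
    "higgs H' (Some z) * g (Some z) = g (Some z) * higgs H (Some z)"
    using assms(1) by (simp_all add: C_isomorphism_def)
  obtain B where B: "inverts_mat (g (Some z)) B" "inverts_mat B (g (Some z))"
    using g(2) unfolding invertible_mat_def by blast
  have gB: "g (Some z) * B = 1\<^sub>m K" using B(1) g(1) by (simp add: inverts_mat_def)
  have "dim_col B = K" using arg_cong[OF gB, of dim_col] by simp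
  moreover have "dim_row B = K"
    using arg_cong[OF B(2)[unfolded inverts_mat_def], of dim_col] g(1) by simp
  ultimately have Bc: "B \<in> carrier_mat K K" by auto
  have "det (g (Some z)) * det B = 1" using det_mult[OF g(1) Bc] gB by simp
  then have "det (g (Some z)) \<noteq> 0" by auto
  from char_poly_intertwined[OF car(2,1) g(1) this g(3)]
  show "char_higgs H' z = char_higgs H z" by (simp add: char_higgs_def)
qed

text \<open>
  Together with the invariance of the characteristic polynomial this makes the image of every class a singleton.
\<close>

lemma C_isomorphism_refl:
  assumes H: "H \<in> C_objects K N"
  shows "C_isomorphism K (\<lambda>_. 1\<^sub>m K) H H"
proof -
  have fb: "filtered_bundle CP1 K K (underlying H)" and car: "higgs H (Some z) \<in> carrier_mat K K" for z
    using H by (simp_all add: C_objects_def filtered_SL_Higgs_bundle_def)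
  have inv: "invertible_mat (1\<^sub>m K :: complex mat)"
    unfolding invertible_mat_def inverts_mat_def by (auto intro!: exI[of _ "1\<^sub>m K"])
  have id: "S U = {t. \<exists>s\<in>S U. \<forall>q\<in>U - {pt CP1}. t q = 1\<^sub>m K *\<^sub>v s q}"
    if lf: "locally_free CP1 R K K S" and U: "openin (top_of CP1) U" for R S U
  proof -
    have sc: "\<And>s q. s \<in> S U \<Longrightarrow> q \<in> U - {pt CP1} \<Longrightarrow> s q \<in> carrier_vec K"
      using lf[unfolded locally_free_def, THEN conjunct1, rule_format, OF U] by blast
    have cong: "\<And>s t. s \<in> S U \<Longrightarrow> \<forall>q\<in>U - {pt CP1}. t q = s q \<Longrightarrow> t \<in> S U"
      using lf[unfolded locally_free_def, THEN conjunct2, THEN conjunct1, rule_format, OF U] by blast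
    show ?thesis
    proof (rule Set.set_eqI, unfold mem_Collect_eq, rule iffI)
      fix t assume t: "t \<in> S U"
      then show "\<exists>s\<in>S U. \<forall>q\<in>U - {pt CP1}. t q = 1\<^sub>m K *\<^sub>v s q"
        using sc[OF t] by (intro bexI[OF _ t] ballI) simp
    next
      fix t assume "\<exists>s\<in>S U. \<forall>q\<in>U - {pt CP1}. t q = 1\<^sub>m K *\<^sub>v s q"
      then obtain s where s: "s \<in> S U" "\<forall>q\<in>U - {pt CP1}. t q = 1\<^sub>m K *\<^sub>v s q" by (elim bexE)
      have "\<forall>q\<in>U - {pt CP1}. t q = s q" using s(2) sc[OF s(1)] by simp
      then show "t \<in> S U" by (rule cong[OF s(1)])
    qed
  qed
  show ?thesis unfolding C_isomorphism_def
  proof (intro conjI allI impI)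
    fix U assume U: "openin (top_of CP1) U"
    show "sec (underlying H) U = {t. \<exists>s\<in>sec (underlying H) U. \<forall>q\<in>U - {pt CP1}. t q = 1\<^sub>m K *\<^sub>v s q}"
      by (rule id[OF fb[unfolded filtered_bundle_def, THEN conjunct1] U])
    show "fil (underlying H) \<alpha> U = {t. \<exists>s\<in>fil (underlying H) \<alpha> U. \<forall>q\<in>U - {pt CP1}. t q = 1\<^sub>m K *\<^sub>v s q}" for \<alpha>
      by (rule id[OF fb[unfolded filtered_bundle_def, THEN conjunct2, THEN conjunct1, rule_format] U])
  qed (simp_all add: car inv left_mult_one_mat[OF car] right_mult_one_mat[OF car])
qed

lemma hitchin_base_eq: "hitchin_base K N = char_higgs ` C_objects K N"
proof -
  define rel where "rel = {(H, H'). H \<in> C_objects K N \<and> H' \<in> C_objects K N \<and> (\<exists>g. C_isomorphism K g H H')}"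
  have cls: "hitchin_map (rel `` {H}) = char_higgs H" if H: "H \<in> C_objects K N" for H
  proof -
    have "H \<in> rel `` {H}" using H C_isomorphism_refl[OF H] by (auto simp: rel_def)
    moreover have "char_higgs H' = char_higgs H" if "H' \<in> rel `` {H}" for H'
      using that char_higgs_isomorphic unfolding rel_def by blast
    ultimately have "char_higgs ` (rel `` {H}) = {char_higgs H}" by blast
    then show ?thesis by (simp add: hitchin_map_def)
  qed
  have "hitchin_base K N = hitchin_map ` ((\<lambda>H. rel `` {H}) ` C_objects K N)"
    unfolding hitchin_base_def moduli_def rel_def[symmetric] quotient_def by (rule arg_cong) blast
  also have "\<dots> = char_higgs ` C_objects K N" unfolding image_image using cls by (intro image_cong) auto
  finally show ?thesis .
qed

theorem proposition2p14:
  fixes K N :: nat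
  assumes "K \<ge> 2" and "N \<ge> 1" and "coprime K N"
  shows "hitchin_base K N =
    {F. \<exists>P :: nat \<Rightarrow> complex poly.
        (\<forall>i\<in>{2..K}. P i = 0 \<or>
           real (degree (P i)) \<le> real N * (real i - 1) / real K - 1) \<and>
        F = (\<lambda>z. (monom 1 K - [:z ^ N:]) + (\<Sum>i=2..K. monom (poly (P i) z) (K - i)))}"
    (is "_ = ?R")
proof -
  have R: "?R = {F. \<exists>P. (\<forall>i\<in>{2..K}. P i = 0 \<or> real (degree (P i)) \<le> real N * (real i - 1) / real K - 1) \<and>
        F = base_poly K N P}"
    unfolding base_poly_def[abs_def] ..
  show ?thesis unfolding R hitchin_base_eq
  proof (intro Set.equalityI Set.subsetI)
    fix F assume "F \<in> char_higgs ` C_objects K N"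
    then obtain H where "F = char_higgs H" "H \<in> C_objects K N" by (rule imageE)
    then show "F \<in> {F. \<exists>P. (\<forall>i\<in>{2..K}. P i = 0 \<or> real (degree (P i)) \<le> real N * (real i - 1) / real K - 1) \<and>
        F = base_poly K N P}"
      using char_higgs_in_base[OF assms(1)] by simp
  next
    fix F assume "F \<in> {F. \<exists>P. (\<forall>i\<in>{2..K}. P i = 0 \<or> real (degree (P i)) \<le> real N * (real i - 1) / real K - 1) \<and>
        F = base_poly K N P}"
    then obtain P where deg: "\<forall>i\<in>{2..K}. P i = 0 \<or> real (degree (P i)) \<le> real N * (real i - 1) / real K - 1"
      and F: "F = base_poly K N P" by (elim CollectE exE conjE)
    have "model K N F \<in> C_objects K N" unfolding C_objects_def F
      using filtered_SL_Higgs_bundle_model[OF assms(1)] good_at_infinity_model[OF assms(1) deg] by simp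
    moreover have "F = char_higgs (model K N F)" unfolding F by (rule char_higgs_model[OF assms(1), symmetric])
    ultimately show "F \<in> char_higgs ` C_objects K N" by (intro image_eqI[of F char_higgs "model K N F"])
  qed
qed

end
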